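(* Let $\theta\in C^1(\mathbb{R})$ and suppose that $\dot\theta$ has compact support. Then there is a positive constant $c_S$, depending on $\dot\theta$ and $\omega$, such that for every non-zero $\Psi\in H_0^1(\Omega_\theta)\cap L^2(\Omega_\theta,\rho^{-2})$ $$\|\nabla\Psi\|_{L^2(\Omega_\theta)}^2-E_1\|\Psi\|_{L^2(\Omega_\theta)}^2\ \ge\ c_S\,\frac{\|\Psi\|_{L^2(\Omega_\theta)}^6}{\|\Psi\|_1^4},$$ where $$\|\Psi\|_1:=\sqrt{\int_\omega dx_2\,dx_3\left(\int_{\mathbb{R}}dx_1\,|(\Psi\circ\mathcal{L}_\theta)(x)|\right)^2}.$$
   Context: Let $\omega\subset\mathbb{R}^2$ be a nonempty bounded open connected set (no regularity assumed) and $\Omega_0:=\mathbb{R}\times\omega$. For a $C^1$ function $\theta:\mathbb{R}\to\mathbb{R}$ with bounded derivative $\dot\theta$, let $$\mathcal{L}_\theta(x):=\big(x_1,\;x_2\cos\theta(x_1)+x_3\sin\theta(x_1),\;-x_2\sin\theta(x_1)+x_3\cos\theta(x_1)\big),\quad x\in\mathbb{R}^3,$$ and $\Omega_\theta:=\mathcal{L}_\theta(\Omega_0)$, an open set. $E_1$ is the first eigenvalue of the Dirichlet Laplacian in $\omega$. $\rho(x):=1/\sqrt{1+x_1^2}$, and $L^2(\Omega_\theta,\rho^{-2})$ is the weighted space with norm $\|\rho^{-1}\Psi\|_{L^2(\Omega_\theta)}$. No assumption is made on whether the tube is twisted or not. *)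

theory Defs
  imports "HOL-Analysis.Analysis"
begin

text \<open>
  Function spaces are complex. An element of a Lebesgue space over \<open>\<Omega>\<close> is given by any
  Lebesgue measurable representative \<open>f :: 'a \<Rightarrow> complex\<close>; its values outside \<open>\<Omega>\<close> are
  irrelevant, and equality is equality almost everywhere in \<open>\<Omega>\<close>.
  Euclidean 3-space is \<open>real \<times> real \<times> real\<close>, so that the straight tube is \<open>UNIV \<times> \<omega>\<close>;
  the norm and the Lebesgue measure on this type are the Euclidean ones.
\<close>

definition L2_weighted :: "'a::euclidean_space set \<Rightarrow> ('a \<Rightarrow> real) \<Rightarrow> ('a \<Rightarrow> complex) set" where
  "L2_weighted \<Omega> w =
     {f \<in> borel_measurable (lebesgue_on \<Omega>).
        integrable (lebesgue_on \<Omega>) (\<lambda>x. w x * (cmod (f x))\<^sup>2)}"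

definition L2 :: "'a::euclidean_space set \<Rightarrow> ('a \<Rightarrow> complex) set" where
  "L2 \<Omega> = L2_weighted \<Omega> (\<lambda>x. 1)"

definition L2_norm :: "'a::euclidean_space set \<Rightarrow> ('a \<Rightarrow> complex) \<Rightarrow> real" where
  "L2_norm \<Omega> f = sqrt (\<integral>x. (cmod (f x))\<^sup>2 \<partial>lebesgue_on \<Omega>)"

definition L2_zero :: "'a::euclidean_space set \<Rightarrow> ('a \<Rightarrow> complex) \<Rightarrow> bool" where
  "L2_zero \<Omega> f \<longleftrightarrow> (AE x in lebesgue_on \<Omega>. f x = 0)"

definition partial_deriv :: "'a::euclidean_space \<Rightarrow> ('a \<Rightarrow> complex) \<Rightarrow> 'a \<Rightarrow> complex" where
  "partial_deriv b f x = frechet_derivative f (at x) b"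

primrec C_k :: "nat \<Rightarrow> ('a::euclidean_space \<Rightarrow> complex) \<Rightarrow> bool" where
  "C_k 0 f \<longleftrightarrow> continuous_on UNIV f"
| "C_k (Suc k) f \<longleftrightarrow>
     (\<forall>x. f differentiable (at x)) \<and> (\<forall>b\<in>Basis. C_k k (partial_deriv b f))"

text \<open>The space of test functions on \<open>\<Omega>\<close>, each extended by zero to the whole space.\<close>

definition test_functions :: "'a::euclidean_space set \<Rightarrow> ('a \<Rightarrow> complex) set" where
  "test_functions \<Omega> =
     {\<phi>. (\<forall>k. C_k k \<phi>) \<and> compact (closure {x. \<phi> x \<noteq> 0}) \<and> closure {x. \<phi> x \<noteq> 0} \<subseteq> \<Omega>}"

definition has_weak_partial ::
    "'a::euclidean_space set \<Rightarrow> 'a \<Rightarrow> ('a \<Rightarrow> complex) \<Rightarrow> ('a \<Rightarrow> complex) \<Rightarrow> bool" where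
  "has_weak_partial \<Omega> b f g \<longleftrightarrow> f \<in> L2 \<Omega> \<and> g \<in> L2 \<Omega> \<and>
     (\<forall>\<phi>\<in>test_functions \<Omega>.
        (\<integral>x. f x * partial_deriv b \<phi> x \<partial>lebesgue_on \<Omega>) =
        - (\<integral>x. g x * \<phi> x \<partial>lebesgue_on \<Omega>))"

text \<open>For open \<open>\<Omega>\<close> the weak derivative is unique almost everywhere, so the choice is immaterial.\<close>

definition weak_partial ::
    "'a::euclidean_space set \<Rightarrow> 'a \<Rightarrow> ('a \<Rightarrow> complex) \<Rightarrow> 'a \<Rightarrow> complex" where
  "weak_partial \<Omega> b f = (SOME g. has_weak_partial \<Omega> b f g)"

definition H1 :: "'a::euclidean_space set \<Rightarrow> ('a \<Rightarrow> complex) set" where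
  "H1 \<Omega> = {f \<in> L2 \<Omega>. \<forall>b\<in>Basis. \<exists>g. has_weak_partial \<Omega> b f g}"

definition grad_norm :: "'a::euclidean_space set \<Rightarrow> ('a \<Rightarrow> complex) \<Rightarrow> real" where
  "grad_norm \<Omega> f = sqrt (\<Sum>b\<in>Basis. (L2_norm \<Omega> (weak_partial \<Omega> b f))\<^sup>2)"

definition H1_norm :: "'a::euclidean_space set \<Rightarrow> ('a \<Rightarrow> complex) \<Rightarrow> real" where
  "H1_norm \<Omega> f = sqrt ((L2_norm \<Omega> f)\<^sup>2 + (grad_norm \<Omega> f)\<^sup>2)"

definition H10 :: "'a::euclidean_space set \<Rightarrow> ('a \<Rightarrow> complex) set" where
  "H10 \<Omega> = {f \<in> H1 \<Omega>. \<forall>\<epsilon>>0. \<exists>\<phi>\<in>test_functions \<Omega>. H1_norm \<Omega> (\<lambda>x. f x - \<phi> x) < \<epsilon>}"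

text \<open>
  The graph of the Dirichlet Laplacian: the self-adjoint operator in \<open>L2 \<Omega>\<close> associated with the
  quadratic form \<open>u \<mapsto> \<parallel>\<nabla>u\<parallel>\<^sup>2\<close> with form domain \<open>H10 \<Omega>\<close>; it sends \<open>u\<close> to \<open>f = - \<Delta>u\<close>.
\<close>

definition dirichlet_laplacian ::
    "'a::euclidean_space set \<Rightarrow> ('a \<Rightarrow> complex) \<Rightarrow> ('a \<Rightarrow> complex) \<Rightarrow> bool" where
  "dirichlet_laplacian \<Omega> u f \<longleftrightarrow> u \<in> H10 \<Omega> \<and> f \<in> L2 \<Omega> \<and>
     (\<forall>v\<in>H10 \<Omega>.
        (\<Sum>b\<in>Basis. \<integral>x. weak_partial \<Omega> b u x * cnj (weak_partial \<Omega> b v x) \<partial>lebesgue_on \<Omega>) =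
        (\<integral>x. f x * cnj (v x) \<partial>lebesgue_on \<Omega>))"

definition dirichlet_eigenvalue :: "'a::euclidean_space set \<Rightarrow> real \<Rightarrow> bool" where
  "dirichlet_eigenvalue \<Omega> e \<longleftrightarrow>
     (\<exists>u. \<not> L2_zero \<Omega> u \<and> dirichlet_laplacian \<Omega> u (\<lambda>x. complex_of_real e * u x))"

text \<open>
  All eigenvalues are real by self-adjointness; a least one exists for every nonempty bounded
  open \<open>\<Omega>\<close>, because the resolvent is then compact.
\<close>

definition first_dirichlet_eigenvalue :: "'a::euclidean_space set \<Rightarrow> real" where
  "first_dirichlet_eigenvalue \<Omega> = (LEAST e. dirichlet_eigenvalue \<Omega> e)"

definition twist_map :: "(real \<Rightarrow> real) \<Rightarrow> real \<times> real \<times> real \<Rightarrow> real \<times> real \<times> real" where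
  "twist_map \<theta> = (\<lambda>(x1, x2, x3).
     (x1, x2 * cos (\<theta> x1) + x3 * sin (\<theta> x1), - x2 * sin (\<theta> x1) + x3 * cos (\<theta> x1)))"

definition tube :: "(real \<Rightarrow> real) \<Rightarrow> (real \<times> real) set \<Rightarrow> (real \<times> real \<times> real) set" where
  "tube \<theta> \<omega> = twist_map \<theta> ` (UNIV \<times> \<omega>)"

definition rho :: "real \<times> real \<times> real \<Rightarrow> real" where
  "rho x = 1 / sqrt (1 + (fst x)\<^sup>2)"

text \<open>
  On \<open>L2_weighted (tube \<theta> \<omega>) (\<lambda>x. 1 / (rho x)\<^sup>2)\<close> the inner integral is finite for almost every
  \<open>y\<close> and the outer one is finite, by the Cauchy-Schwarz inequality and \<open>rho \<in> L2\<close> in \<open>x1\<close>.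
\<close>

definition norm_one ::
    "(real \<Rightarrow> real) \<Rightarrow> (real \<times> real) set \<Rightarrow> (real \<times> real \<times> real \<Rightarrow> complex) \<Rightarrow> real" where
  "norm_one \<theta> \<omega> \<Psi> =
     sqrt (\<integral>y. (\<integral>x1. cmod (\<Psi> (twist_map \<theta> (x1, y))) \<partial>lebesgue)\<^sup>2 \<partial>lebesgue_on \<omega>)"

end

theory Submission
  imports Defs "HOL-Complex_Analysis.Great_Picard"
begin

text \<open>
  Every cross-section of the tube is a rotated copy of \<open>\<omega>\<close>, hence has the same first eigenvalue,
  and integrating over the cross-sections gives
  \<open>Q[\<Psi>] := \<parallel>\<nabla>\<Psi>\<parallel>\<^sup>2 - E\<^sub>1 \<parallel>\<Psi>\<parallel>\<^sup>2 \<ge> \<parallel>\<partial>\<^sub>1\<Psi>\<parallel>\<^sup>2\<close> with the straight derivative \<open>\<partial>\<^sub>1\<close>.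
  Write \<open>N\<close> for the squared norm \<open>\<parallel>\<Psi>\<parallel>\<^sub>1\<^sup>2\<close> and cut the fibres of the tube into intervals of length \<open>l\<close>.
  A Poincare inequality on each of them bounds \<open>\<parallel>\<Psi>\<parallel>\<^sup>2\<close> by \<open>l\<^sup>2 \<parallel>D\<Psi>\<parallel>\<^sup>2 + N / l\<close> up to a constant, \<open>D\<close>
  being the derivative along the fibre. Where the twisting angle is constant, \<open>D = \<partial>\<^sub>1\<close>, so that the outer
  part of the tube is controlled by \<open>l\<^sup>2 Q + N / l\<close>; the bounded middle part is controlled by a
  piece of the outer part and by \<open>Q\<close>, by moving along straight lines of the ambient space. Everywhere,
  \<open>\<parallel>D\<Psi>\<parallel>\<^sup>2\<close> is at most a constant times \<open>Q + \<parallel>\<Psi>\<parallel>\<^sup>2\<close>, which settles small \<open>l\<close> by absorption. Altogether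
  \<open>\<parallel>\<Psi>\<parallel>\<^sup>2 \<le> C (l\<^sup>2 Q + N / l)\<close> for all \<open>l > 0\<close>, and the choice \<open>l = 2 C N / \<parallel>\<Psi>\<parallel>\<^sup>2\<close> gives the claim.
  The estimates are proved for test functions, with the limit function entering \<open>N\<close> already, because
  \<open>N\<close> is not continuous in \<open>H\<^sup>1\<close>.
\<close>

subsection \<open>Square-integrable functions\<close>

text \<open>The obstacle is the long scale. The derivative along a twisted fibre contains
  transversal derivatives, whose energy is at least E1
  \<open>\<parallel>\<Psi>\<parallel>\<^sup>2\<close> and is not controlled by \<open>Q\<close>;
  multiplied by \<open>l\<^sup>2\<close> it can be absorbed only for small \<open>l\<close>. For
  large \<open>l\<close> it has to be avoided altogether, which works where the fibres are straight,
  on two half-lines that hold intervals of every length. On the bounded piece that remains, segments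
  parallel to the axis may leave the tube; test functions extend smoothly by zero, so the boundary
  never enters. All of this uses upper bounds for
  \<open>\<parallel>\<Psi>\<parallel>\<^sup>2\<close> only, so no Hardy inequality is involved and
  twisted and untwisted tubes are treated alike. The error of replacing \<Psi> by a test function
  enters the final estimate with a coefficient independent of \<open>l\<close>, and vanishes in the
  limit at each fixed \<open>l\<close>. A second task is hidden in E1, which is the least eigenvalue
  of an operator: a minimiser of the Rayleigh quotient must exist, and the compactness for it comes
  from averages over a square grid, again through extension by zero.\<close>

definition sq_int :: "'a measure \<Rightarrow> ('a \<Rightarrow> complex) \<Rightarrow> bool" where
  "sq_int M f \<longleftrightarrow> f \<in> borel_measurable M \<and> integrable M (\<lambda>x. (cmod (f x))\<^sup>2)"

text \<open>\<open>sq_int\<close> and \<open>nrm\<close> take an arbitrary measure because the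
  estimates move between \<open>lebesgue_on \<Omega>\<close>, where the function spaces live, and
  \<open>lborel\<close>, where translations and iterated integrals are available.\<close>

definition nrm :: "'a measure \<Rightarrow> ('a \<Rightarrow> complex) \<Rightarrow> real" where
  "nrm M f = sqrt (\<integral>x. (cmod (f x))\<^sup>2 \<partial>M)"

lemma mem_L2_iff: "f \<in> L2 \<Omega> \<longleftrightarrow> sq_int (lebesgue_on \<Omega>) f"
  by (simp add: L2_def L2_weighted_def sq_int_def)

lemma L2_norm_eq_nrm: "L2_norm \<Omega> f = nrm (lebesgue_on \<Omega>) f"
  by (simp add: L2_norm_def nrm_def)

lemma nrm_nonneg [simp]: "0 \<le> nrm M f"
  by (simp add: nrm_def)

lemma nrm_sq: "(nrm M f)\<^sup>2 = (\<integral>x. (cmod (f x))\<^sup>2 \<partial>M)"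
  by (simp add: nrm_def)

lemma sq_int_measurable [measurable_dest]: "sq_int M f \<Longrightarrow> f \<in> borel_measurable M"
  by (simp add: sq_int_def)

lemma sq_int_integrable: "sq_int M f \<Longrightarrow> integrable M (\<lambda>x. (cmod (f x))\<^sup>2)"
  by (simp add: sq_int_def)

lemma cmod_add_sq_le: "(cmod (a + b))\<^sup>2 \<le> 2 * (cmod a)\<^sup>2 + 2 * (cmod b)\<^sup>2"
proof -
  have "(cmod (a + b))\<^sup>2 \<le> (cmod a + cmod b)\<^sup>2"
    by (simp add: norm_triangle_ineq power_mono)
  also have "\<dots> \<le> 2 * (cmod a)\<^sup>2 + 2 * (cmod b)\<^sup>2"
    using sum_squares_bound[of "cmod a" "cmod b"] by (simp add: power2_sum)
  finally show ?thesis .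
qed

lemma cmod_diff_sq_le: "(cmod (a - b))\<^sup>2 \<le> 2 * (cmod a)\<^sup>2 + 2 * (cmod b)\<^sup>2"
  using cmod_add_sq_le[of a "- b"] by simp

lemma sq_int_cmult: "sq_int M f \<Longrightarrow> sq_int M (\<lambda>x. c * f x)"
  by (auto simp: sq_int_def norm_mult power_mult_distrib)

lemma sq_int_minus: "sq_int M f \<Longrightarrow> sq_int M (\<lambda>x. - f x)"
  by (auto simp: sq_int_def)

lemma sq_int_cnj:
  assumes "sq_int M f" shows "sq_int M (\<lambda>x. cnj (f x))"
proof -
  have "cnj \<in> borel_measurable borel"
    by (intro borel_measurable_continuous_onI continuous_intros)
  from measurable_compose[OF sq_int_measurable[OF assms] this] show ?thesis
    using assms by (simp add: sq_int_def)
qed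

lemma sq_int_add:
  assumes [measurable]: "sq_int M f" "sq_int M g" shows "sq_int M (\<lambda>x. f x + g x)"
  unfolding sq_int_def
proof
  show "integrable M (\<lambda>x. (cmod (f x + g x))\<^sup>2)"
    by (rule Bochner_Integration.integrable_bound[of M "\<lambda>x. 2 * (cmod (f x))\<^sup>2 + 2 * (cmod (g x))\<^sup>2"])
      (use assms[THEN sq_int_integrable] cmod_add_sq_le in auto)
qed measurable

lemma sq_int_diff: "sq_int M f \<Longrightarrow> sq_int M g \<Longrightarrow> sq_int M (\<lambda>x. f x - g x)"
  using sq_int_add[of M f "\<lambda>x. - g x"] sq_int_minus by force

lemma integrable_mult_sq_int:
  assumes [measurable]: "sq_int M f" "sq_int M g" shows "integrable M (\<lambda>x. f x * g x)"
proof (rule Bochner_Integration.integrable_bound[of M "\<lambda>x. (cmod (f x))\<^sup>2 + (cmod (g x))\<^sup>2"])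
  show "integrable M (\<lambda>x. (cmod (f x))\<^sup>2 + (cmod (g x))\<^sup>2)"
    using assms[THEN sq_int_integrable] by auto
  have "norm (f x * g x) \<le> norm ((cmod (f x))\<^sup>2 + (cmod (g x))\<^sup>2)" for x
  proof -
    have "cmod (f x) * cmod (g x) \<le> 2 * cmod (f x) * cmod (g x)"
      by (simp add: mult_le_cancel_right1)
    also have "\<dots> \<le> (cmod (f x))\<^sup>2 + (cmod (g x))\<^sup>2"
      by (rule sum_squares_bound)
    finally show ?thesis by (simp add: norm_mult)
  qed
  then show "AE x in M. norm (f x * g x) \<le> norm ((cmod (f x))\<^sup>2 + (cmod (g x))\<^sup>2)" by simp
qed measurable

text \<open>The discriminant argument: at the minimiser \<open>- b / c\<close> the value is
  \<open>a - b\<^sup>2 / c\<close>. It yields Cauchy-Schwarz for the L2 product and for the possibly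
  degenerate form behind the eigenvalue equation, so \<open>c = 0\<close> has to be allowed.\<close>

lemma quadratic_nonneg_imp:
  fixes a b c :: real
  assumes "\<And>t. 0 \<le> a + 2 * t * b + t\<^sup>2 * c" "0 \<le> a" "0 \<le> c"
  shows "b\<^sup>2 \<le> a * c"
proof (cases "c = 0")
  case True
  have "b = 0"
  proof (rule ccontr)
    assume "b \<noteq> 0"
    \<comment> \<open>For \<open>c = 0\<close> the polynomial is affine in \<open>t\<close>; this
      \<open>t\<close> sends it to \<open>- a - 2\<close>.\<close>
    have "0 \<le> a + 2 * (- (a + 1) / b) * b" using assms(1)[of "- (a + 1) / b"] True by simp
    also have "\<dots> = - a - 2" using \<open>b \<noteq> 0\<close> by (simp add: field_simps)
    finally show False using assms(2) by simp
  qed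
  then show ?thesis using True by simp
next
  case False
  then have c: "c > 0" using assms(3) by simp
  have "0 \<le> a + 2 * (- b / c) * b + (- b / c)\<^sup>2 * c" by (rule assms)
  also have "\<dots> = a - b\<^sup>2 / c" using c by (simp add: field_simps power2_eq_square)
  finally show ?thesis using c by (simp add: field_simps)
qed

section \<open>Cauchy-Schwarz and Minkowski inequalities\<close>

lemma CS_real:
  fixes f g :: "'a \<Rightarrow> real"
  assumes "integrable M (\<lambda>x. (f x)\<^sup>2)" "integrable M (\<lambda>x. (g x)\<^sup>2)" "integrable M (\<lambda>x. f x * g x)"
  shows "(\<integral>x. f x * g x \<partial>M)\<^sup>2 \<le> (\<integral>x. (f x)\<^sup>2 \<partial>M) * (\<integral>x. (g x)\<^sup>2 \<partial>M)"
proof (rule quadratic_nonneg_imp)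
  fix t :: real
  have "0 \<le> (\<integral>x. (f x + t * g x)\<^sup>2 \<partial>M)" by simp
  also have "(\<lambda>x. (f x + t * g x)\<^sup>2) = (\<lambda>x. (f x)\<^sup>2 + 2 * t * (f x * g x) + t\<^sup>2 * (g x)\<^sup>2)"
    by (auto simp: power2_eq_square algebra_simps)
  also have "(\<integral>x. (f x)\<^sup>2 + 2 * t * (f x * g x) + t\<^sup>2 * (g x)\<^sup>2 \<partial>M)
      = (\<integral>x. (f x)\<^sup>2 \<partial>M) + 2 * t * (\<integral>x. f x * g x \<partial>M) + t\<^sup>2 * (\<integral>x. (g x)\<^sup>2 \<partial>M)"
    using assms by simp
  finally show "0 \<le> (\<integral>x. (f x)\<^sup>2 \<partial>M) + 2 * t * (\<integral>x. f x * g x \<partial>M) + t\<^sup>2 * (\<integral>x. (g x)\<^sup>2 \<partial>M)" .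
qed auto

lemma CS_nrm:
  assumes "sq_int M f" "sq_int M g"
  shows "(\<integral>x. cmod (f x) * cmod (g x) \<partial>M) \<le> nrm M f * nrm M g"
proof -
  have "integrable M (\<lambda>x. cmod (f x) * cmod (g x))"
    using integrable_norm[OF integrable_mult_sq_int[OF assms]] by (simp add: norm_mult)
  from CS_real[OF assms[THEN sq_int_integrable] this]
  have "(\<integral>x. cmod (f x) * cmod (g x) \<partial>M)\<^sup>2 \<le> (nrm M f * nrm M g)\<^sup>2"
    by (simp add: nrm_sq power_mult_distrib)
  then show ?thesis by (rule power2_le_imp_le) simp
qed

lemma CS_integral:
  assumes "sq_int M f" "sq_int M g"
  shows "cmod (\<integral>x. f x * g x \<partial>M) \<le> nrm M f * nrm M g"
proof -
  have "cmod (\<integral>x. f x * g x \<partial>M) \<le> (\<integral>x. cmod (f x * g x) \<partial>M)"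
    by simp
  also have "\<dots> \<le> nrm M f * nrm M g"
    using CS_nrm[OF assms] by (simp add: norm_mult)
  finally show ?thesis .
qed

lemma nrm_triangle:
  assumes "sq_int M f" "sq_int M g"
  shows "nrm M (\<lambda>x. f x + g x) \<le> nrm M f + nrm M g"
proof -
  have i: "integrable M (\<lambda>x. cmod (f x) * cmod (g x))"
    using integrable_norm[OF integrable_mult_sq_int[OF assms]] by (simp add: norm_mult)
  have "(nrm M (\<lambda>x. f x + g x))\<^sup>2 \<le> (\<integral>x. (cmod (f x))\<^sup>2 + 2 * (cmod (f x) * cmod (g x)) + (cmod (g x))\<^sup>2 \<partial>M)"
    unfolding nrm_sq
  proof (rule integral_mono)
    show "integrable M (\<lambda>x. (cmod (f x + g x))\<^sup>2)"
      using sq_int_add[OF assms] by (rule sq_int_integrable)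
    show "integrable M (\<lambda>x. (cmod (f x))\<^sup>2 + 2 * (cmod (f x) * cmod (g x)) + (cmod (g x))\<^sup>2)"
      using i assms[THEN sq_int_integrable] by auto
    fix x
    have "(cmod (f x + g x))\<^sup>2 \<le> (cmod (f x) + cmod (g x))\<^sup>2"
      by (simp add: norm_triangle_ineq power_mono)
    then show "(cmod (f x + g x))\<^sup>2 \<le> (cmod (f x))\<^sup>2 + 2 * (cmod (f x) * cmod (g x)) + (cmod (g x))\<^sup>2"
      by (simp add: power2_sum)
  qed
  also have "\<dots> = (nrm M f)\<^sup>2 + 2 * (\<integral>x. cmod (f x) * cmod (g x) \<partial>M) + (nrm M g)\<^sup>2"
    using i assms[THEN sq_int_integrable] by (simp add: nrm_sq)
  also have "\<dots> \<le> (nrm M f + nrm M g)\<^sup>2"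
    using CS_nrm[OF assms] by (simp add: power2_sum)
  finally show ?thesis by (rule power2_le_imp_le) simp
qed

lemma nrm_diff_sq_le:
  assumes "sq_int M f" "sq_int M g"
  shows "(nrm M (\<lambda>x. f x - g x))\<^sup>2 \<le> 2 * (nrm M f)\<^sup>2 + 2 * (nrm M g)\<^sup>2"
proof -
  note i = assms[THEN sq_int_integrable]
  have "(nrm M (\<lambda>x. f x - g x))\<^sup>2 \<le> (\<integral>x. 2 * (cmod (f x))\<^sup>2 + 2 * (cmod (g x))\<^sup>2 \<partial>M)"
    unfolding nrm_sq
    by (rule integral_mono[OF sq_int_integrable[OF sq_int_diff[OF assms]]]) (use i cmod_diff_sq_le in auto)
  then show ?thesis using i by (simp add: nrm_sq)
qed

lemma nrm_cmult: "nrm M (\<lambda>x. c * f x) = cmod c * nrm M f"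
  by (simp add: nrm_def norm_mult power_mult_distrib real_sqrt_mult)

lemma nrm_cnj: "nrm M (\<lambda>x. cnj (f x)) = nrm M f"
  by (simp add: nrm_def)

lemma nrm_diff_commute: "nrm M (\<lambda>x. f x - g x) = nrm M (\<lambda>x. g x - f x)"
  by (simp add: nrm_def norm_minus_commute)

lemma nrm_le_add_diff:
  assumes "sq_int M f" "sq_int M g"
  shows "nrm M f \<le> nrm M g + nrm M (\<lambda>x. f x - g x)"
  using nrm_triangle[OF assms(2) sq_int_diff[OF assms]] by simp

lemma nrm_AE_cong:
  assumes "AE x in M. f x = g x" "f \<in> borel_measurable M" "g \<in> borel_measurable M"
  shows "nrm M f = nrm M g"
  unfolding nrm_def using assms(1)
  by (intro arg_cong[where f=sqrt] integral_cong_AE)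
     (use assms in \<open>auto\<close>)

lemma nrm_eq_0_iff:
  assumes "sq_int M f" shows "nrm M f = 0 \<longleftrightarrow> (AE x in M. f x = 0)"
proof -
  have "nrm M f = 0 \<longleftrightarrow> (AE x in M. (cmod (f x))\<^sup>2 = 0)"
    unfolding nrm_def by (simp add: integral_nonneg_eq_0_iff_AE[OF sq_int_integrable[OF assms]])
  then show ?thesis by simp
qed

lemma nn_integral_sq_nrm:
  assumes "sq_int M f"
  shows "(\<integral>\<^sup>+x. ennreal ((cmod (f x))\<^sup>2) \<partial>M) = ennreal ((nrm M f)\<^sup>2)"
  unfolding nrm_sq using sq_int_integrable[OF assms] by (simp add: nn_integral_eq_integral)

lemma sq_intI_nn:
  assumes "f \<in> borel_measurable M" "(\<integral>\<^sup>+x. ennreal ((cmod (f x))\<^sup>2) \<partial>M) < \<infinity>"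
  shows "sq_int M f"
  using assms by (auto simp: sq_int_def intro!: integrableI_nonneg)

lemma nrm_le_nn:
  assumes "f \<in> borel_measurable M" "(\<integral>\<^sup>+x. ennreal ((cmod (f x))\<^sup>2) \<partial>M) \<le> ennreal (c\<^sup>2)" "0 \<le> c"
  shows "nrm M f \<le> c"
proof -
  have "sq_int M f"
    using assms(1) le_less_trans[OF assms(2)] by (intro sq_intI_nn) auto
  then have "ennreal ((nrm M f)\<^sup>2) \<le> ennreal (c\<^sup>2)"
    using assms by (simp add: nn_integral_sq_nrm)
  then have "(nrm M f)\<^sup>2 \<le> c\<^sup>2" by simp
  then show ?thesis using assms(3) by (rule power2_le_imp_le)
qed

text \<open>Fatou's lemma for squared moduli. A bound from some index \<open>K\<close> on suffices,
  which is the form in which a Cauchy condition supplies it.\<close>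

lemma nn_integral_sq_limit_le:
  fixes f :: "nat \<Rightarrow> 'a \<Rightarrow> complex"
  assumes [measurable]: "\<And>k. f k \<in> borel_measurable M"
    and lim: "AE x in M. (\<lambda>k. f k x) \<longlonglongrightarrow> g x"
    and bound: "\<And>k. k \<ge> K \<Longrightarrow> (\<integral>\<^sup>+x. ennreal ((cmod (f k x))\<^sup>2) \<partial>M) \<le> c"
  shows "(\<integral>\<^sup>+x. ennreal ((cmod (g x))\<^sup>2) \<partial>M) \<le> c"
proof -
  have "(\<integral>\<^sup>+x. ennreal ((cmod (g x))\<^sup>2) \<partial>M) = (\<integral>\<^sup>+x. liminf (\<lambda>k. ennreal ((cmod (f k x))\<^sup>2)) \<partial>M)"
  proof (rule nn_integral_cong_AE)
    show "AE x in M. ennreal ((cmod (g x))\<^sup>2) = liminf (\<lambda>k. ennreal ((cmod (f k x))\<^sup>2))"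
      using lim
    proof eventually_elim
      fix x assume "(\<lambda>k. f k x) \<longlonglongrightarrow> g x"
      then have "(\<lambda>k. ennreal ((cmod (f k x))\<^sup>2)) \<longlonglongrightarrow> ennreal ((cmod (g x))\<^sup>2)"
        by (intro tendsto_intros)
      then show "ennreal ((cmod (g x))\<^sup>2) = liminf (\<lambda>k. ennreal ((cmod (f k x))\<^sup>2))"
        by (rule lim_imp_Liminf[symmetric, OF sequentially_bot])
    qed
  qed
  also have "\<dots> \<le> liminf (\<lambda>k. \<integral>\<^sup>+x. ennreal ((cmod (f k x))\<^sup>2) \<partial>M)"
    by (rule nn_integral_liminf) measurable
  also have "\<dots> \<le> limsup (\<lambda>k. \<integral>\<^sup>+x. ennreal ((cmod (f k x))\<^sup>2) \<partial>M)"
    by (rule Liminf_le_Limsup) simp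
  also have "\<dots> \<le> c"
    by (rule Limsup_bounded) (use bound in \<open>auto simp: eventually_sequentially\<close>)
  finally show ?thesis .
qed

text \<open>
  Along a subsequence whose consecutive differences have squared norm below \<open>8\<^sup>-\<^sup>k\<close>, the bound
  \<open>t \<le> 2\<^sup>-\<^sup>k + 2\<^sup>k t\<^sup>2\<close> makes the series of differences absolutely convergent almost everywhere,
  also when \<open>M\<close> is infinite.
\<close>

lemma sq_int_complete:
  fixes f :: "nat \<Rightarrow> 'a \<Rightarrow> complex"
  assumes sq: "\<And>n. sq_int M (f n)"
    and cauchy: "\<And>e. e > 0 \<Longrightarrow> \<exists>N. \<forall>m\<ge>N. \<forall>n\<ge>N. nrm M (\<lambda>x. f m x - f n x) < e"
  obtains g where "sq_int M g" "(\<lambda>n. nrm M (\<lambda>x. f n x - g x)) \<longlonglongrightarrow> 0"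
proof -
  have mf[measurable]: "f n \<in> borel_measurable M" for n using sq by (rule sq_int_measurable)
  \<comment> \<open>Chosen so that the weighted terms \<open>2^k * (e k)\<^sup>2\<close> are
    \<open>(1/4)^k\<close>, a summable series.\<close>
  define e where "e k = sqrt ((1/8::real)^k)" for k :: nat
  have epos: "e k > 0" for k by (simp add: e_def)
  have "\<exists>N. \<forall>m\<ge>N. \<forall>n\<ge>N. nrm M (\<lambda>x. f m x - f n x) < e k" for k
    using cauchy epos by blast
  then obtain N where N: "\<And>k m n. m \<ge> N k \<Longrightarrow> n \<ge> N k \<Longrightarrow> nrm M (\<lambda>x. f m x - f n x) < e k"
    by metis
  define r where "r = rec_nat (N 0) (\<lambda>k a. max (Suc a) (N (Suc k)))"
  have r0: "r 0 = N 0" and rS: "r (Suc k) = max (Suc (r k)) (N (Suc k))" for k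
    by (simp_all add: r_def)
  have rN: "r k \<ge> N k" for k by (cases k) (simp_all add: r0 rS)
  have rr: "r k < r (Suc k)" for k by (simp add: rS)
  have smr: "strict_mono r" using rr by (simp add: strict_mono_Suc_iff)
  define d where "d k x = f (r (Suc k)) x - f (r k) x" for k x
  have dn: "nrm M (d k) < e k" for k
    unfolding d_def using N[of k "r (Suc k)" "r k"] rN[of k] rr[of k] by simp
  have sd: "sq_int M (d k)" for k unfolding d_def using sq sq_int_diff by blast
  have [measurable]: "d k \<in> borel_measurable M" for k using sd by (rule sq_int_measurable)
  have "(\<integral>\<^sup>+x. (\<Sum>k. ennreal (2^k * (cmod (d k x))\<^sup>2)) \<partial>M) = (\<Sum>k. \<integral>\<^sup>+x. ennreal (2^k * (cmod (d k x))\<^sup>2) \<partial>M)"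
    by (rule nn_integral_suminf) measurable
  also have "\<dots> \<le> (\<Sum>k. ennreal ((1/4)^k))"
  proof (intro suminf_le summableI)
    fix k
    have "(\<integral>\<^sup>+x. ennreal (2^k * (cmod (d k x))\<^sup>2) \<partial>M) = ennreal (2^k) * (\<integral>\<^sup>+x. ennreal ((cmod (d k x))\<^sup>2) \<partial>M)"
      by (subst nn_integral_cmult[symmetric]) (auto simp: ennreal_mult)
    also have "\<dots> = ennreal (2^k * (nrm M (d k))\<^sup>2)"
      using nn_integral_sq_nrm[OF sd] by (simp add: ennreal_mult)
    also have "\<dots> \<le> ennreal (2^k * (e k)\<^sup>2)"
      using dn[of k] by (intro ennreal_leI mult_left_mono power_mono) auto
    also have "2^k * (e k)\<^sup>2 = (1/4::real)^k"
      by (simp add: e_def power_mult_distrib[symmetric] del: power_mult_distrib)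
    finally show "(\<integral>\<^sup>+x. ennreal (2^k * (cmod (d k x))\<^sup>2) \<partial>M) \<le> ennreal ((1/4)^k)" .
  qed
  also have "\<dots> = ennreal (\<Sum>k. (1/4)^k)"
    by (intro suminf_ennreal2) (auto simp: summable_geometric)
  also have "\<dots> < \<infinity>" by simp
  finally have fin: "(\<integral>\<^sup>+x. (\<Sum>k. ennreal (2^k * (cmod (d k x))\<^sup>2)) \<partial>M) \<noteq> \<infinity>" by simp
  have "AE x in M. (\<Sum>k. ennreal (2^k * (cmod (d k x))\<^sup>2)) \<noteq> \<infinity>"
    by (rule nn_integral_PInf_AE[OF _ fin]) measurable
  then have conv: "AE x in M. convergent (\<lambda>k. f (r k) x)"
  proof eventually_elim
    fix x assume fin: "(\<Sum>k. ennreal (2^k * (cmod (d k x))\<^sup>2)) \<noteq> \<infinity>"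
    have s1: "summable (\<lambda>k. 2^k * (cmod (d k x))\<^sup>2)"
      using fin by (intro summable_suminf_not_top) auto
    have "summable (\<lambda>k. (1/2)^k + 2^k * (cmod (d k x))\<^sup>2)"
      using s1 by (intro summable_add) (auto simp: summable_geometric)
    then have "summable (\<lambda>k. d k x)"
    proof (rule summable_comparison_test')
      fix k :: nat assume "k \<ge> 0"
      define t where "t = (2::real)^k * cmod (d k x)"
      have "t \<ge> 0" "2 * t \<le> 1 + t\<^sup>2"
        using sum_squares_bound[of 1 t] by (auto simp: t_def)
      then have "t / 2^k \<le> (1 + t\<^sup>2) / 2^k" by (intro divide_right_mono) auto
      also have "\<dots> = (1/2)^k + 2^k * (cmod (d k x))\<^sup>2"
      proof -
        have "(a * c)\<^sup>2 / a = a * c\<^sup>2" if "a \<noteq> 0" for a c :: real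
          using that by (simp add: power2_eq_square)
        from this[of "2^k"] have "t\<^sup>2 / 2^k = 2^k * (cmod (d k x))\<^sup>2"
          unfolding t_def by simp
        then show ?thesis by (simp only: add_divide_distrib power_one_over)
      qed
      finally show "norm (d k x) \<le> (1/2)^k + 2^k * (cmod (d k x))\<^sup>2"
        by (simp add: t_def)
    qed
    then have "convergent (\<lambda>n. \<Sum>k<n. d k x)" by (simp add: summable_iff_convergent)
    moreover have "(\<Sum>k<n. d k x) = f (r n) x - f (r 0) x" for n
      unfolding d_def by (rule sum_lessThan_telescope)
    ultimately have "convergent (\<lambda>n. (f (r n) x - f (r 0) x) + f (r 0) x)"
      by (intro convergent_add convergent_const) simp
    then show "convergent (\<lambda>k. f (r k) x)" by simp
  qed
  define g where "g x = lim (\<lambda>k. f (r k) x)" for x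
  have [measurable]: "g \<in> borel_measurable M" unfolding g_def by measurable
  have limg: "AE x in M. (\<lambda>k. f (r k) x) \<longlonglongrightarrow> g x"
    using conv by eventually_elim (simp add: g_def convergent_LIMSEQ_iff)
  \<comment> \<open>Fatou along the subsequence carries a bound on the distances to late members
    over to the distance to \<open>g\<close>. It is used twice: for the convergence of the whole
    sequence and for the square integrability of \<open>g\<close>.\<close>
  have key: "(\<integral>\<^sup>+x. ennreal ((cmod (f n x - g x))\<^sup>2) \<partial>M) \<le> ennreal (c\<^sup>2)"
    if c: "\<And>m. m \<ge> K \<Longrightarrow> nrm M (\<lambda>x. f n x - f m x) \<le> c" for n c K
  proof (rule nn_integral_sq_limit_le[where f = "\<lambda>k x. f n x - f (r k) x" and K = K])
    show "AE x in M. (\<lambda>k. f n x - f (r k) x) \<longlonglongrightarrow> f n x - g x"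
      using limg by eventually_elim (intro tendsto_intros)
    fix k assume "K \<le> k"
    then have "r k \<ge> K" using smr seq_suble le_trans by blast
    then show "(\<integral>\<^sup>+x. ennreal ((cmod (f n x - f (r k) x))\<^sup>2) \<partial>M) \<le> ennreal (c\<^sup>2)"
      using c[of "r k"] nn_integral_sq_nrm[OF sq_int_diff[OF sq sq], of n "r k"]
      by (simp add: power_mono)
  qed measurable
  have lim0: "(\<lambda>n. nrm M (\<lambda>x. f n x - g x)) \<longlonglongrightarrow> 0"
  proof (rule LIMSEQ_I)
    fix c :: real assume "c > 0"
    then obtain K where K: "\<And>m n. m \<ge> K \<Longrightarrow> n \<ge> K \<Longrightarrow> nrm M (\<lambda>x. f m x - f n x) < c / 2"
      using cauchy[of "c/2"] by auto
    have "nrm M (\<lambda>x. f n x - g x) \<le> c / 2" if "n \<ge> K" for n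
    proof (rule nrm_le_nn[OF _ key[of K n "c/2"]])
      show "nrm M (\<lambda>x. f n x - f m x) \<le> c / 2" if "K \<le> m" for m
        using K[OF \<open>n \<ge> K\<close> that] by simp
    qed (use \<open>c > 0\<close> in auto)
    then show "\<exists>no. \<forall>n\<ge>no. norm (nrm M (\<lambda>x. f n x - g x) - 0) < c"
      using \<open>c > 0\<close> by (intro exI[of _ K]) fastforce
  qed
  have "sq_int M g"
  proof -
    obtain K where K: "\<And>m n. m \<ge> K \<Longrightarrow> n \<ge> K \<Longrightarrow> nrm M (\<lambda>x. f m x - f n x) < 1"
      using cauchy[of 1] by auto
    have "(\<integral>\<^sup>+x. ennreal ((cmod (f K x - g x))\<^sup>2) \<partial>M) \<le> ennreal (1\<^sup>2)"
      by (rule key[of K K]) (use K[of K] in \<open>auto intro: less_imp_le\<close>)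
    then have "sq_int M (\<lambda>x. f K x - g x)"
      by (intro sq_intI_nn) (auto simp: less_top[symmetric] top_unique)
    from sq_int_diff[OF sq[of K] this] show ?thesis by simp
  qed
  then show ?thesis using that lim0 by blast
qed

subsection \<open>Test functions\<close>

lemma partial_deriv_eq: "(f has_derivative f') (at x) \<Longrightarrow> partial_deriv b f x = f' b"
  unfolding partial_deriv_def by (simp add: frechet_derivative_at[symmetric])

lemma differentiable_has_derivative:
  "f differentiable (at x) \<Longrightarrow> (f has_derivative frechet_derivative f (at x)) (at x)"
  by (simp add: frechet_derivative_works)

lemma C_k_0_imp_continuous:
  assumes "C_k k f" shows "continuous_on UNIV f"
proof (cases k)
  case (Suc j)
  then have "isCont f x" for x
    using assms differentiable_imp_continuous_within[of f x UNIV] by simp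
  then show ?thesis by (simp add: continuous_at_imp_continuous_on)
qed (use assms in simp)

text \<open>Monotonicity in the order is not visible in the recursion for \<open>C_k\<close>. The
  product rule depends on it, since it multiplies one factor by a derivative of the other.\<close>

lemma C_k_Suc_imp: "C_k (Suc k) f \<Longrightarrow> C_k k f"
proof (induction k arbitrary: f)
  case 0 from C_k_0_imp_continuous[OF this] show ?case by simp
next
  case (Suc k)
  then show ?case by (metis C_k.simps(2))
qed

lemma partial_deriv_add:
  assumes "f differentiable (at x)" "g differentiable (at x)"
  shows "partial_deriv b (\<lambda>x. f x + g x) x = partial_deriv b f x + partial_deriv b g x"
  using has_derivative_add[OF assms[THEN differentiable_has_derivative], THEN partial_deriv_eq]
  by (simp add: partial_deriv_def)

lemma partial_deriv_cmult:
  assumes "f differentiable (at x)"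
  shows "partial_deriv b (\<lambda>x. c * f x) x = c * partial_deriv b f x"
  using has_derivative_mult_right[OF assms[THEN differentiable_has_derivative], THEN partial_deriv_eq]
  by (simp add: partial_deriv_def)

lemma partial_deriv_cnj:
  assumes "f differentiable (at x)"
  shows "partial_deriv b (\<lambda>x. cnj (f x)) x = cnj (partial_deriv b f x)"
  using bounded_linear.has_derivative[OF bounded_linear_cnj assms[THEN differentiable_has_derivative], THEN partial_deriv_eq]
  by (simp add: partial_deriv_def)

lemma partial_deriv_mult:
  assumes "f differentiable (at x)" "g differentiable (at x)"
  shows "partial_deriv b (\<lambda>x. f x * g x) x = f x * partial_deriv b g x + partial_deriv b f x * g x"
  using has_derivative_mult[OF assms[THEN differentiable_has_derivative], THEN partial_deriv_eq]
  by (simp add: partial_deriv_def)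

lemma C_k_add: "C_k k f \<Longrightarrow> C_k k g \<Longrightarrow> C_k k (\<lambda>x. f x + g x)"
proof (induction k arbitrary: f g)
  case 0 then show ?case by (auto intro: continuous_intros)
next
  case (Suc k)
  have "partial_deriv b (\<lambda>x. f x + g x) = (\<lambda>x. partial_deriv b f x + partial_deriv b g x)" for b
    using Suc.prems by (auto simp: partial_deriv_add)
  then show ?case using Suc by auto
qed

lemma C_k_cmult: "C_k k f \<Longrightarrow> C_k k (\<lambda>x. c * f x)"
proof (induction k arbitrary: f)
  case 0 then show ?case by (auto intro: continuous_intros)
next
  case (Suc k)
  have "partial_deriv b (\<lambda>x. c * f x) = (\<lambda>x. c * partial_deriv b f x)" for b
    using Suc.prems by (auto simp: partial_deriv_cmult)
  then show ?case using Suc by auto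
qed

lemma C_k_cnj: "C_k k f \<Longrightarrow> C_k k (\<lambda>x. cnj (f x))"
proof (induction k arbitrary: f)
  case 0 then show ?case by (auto intro: continuous_intros)
next
  case (Suc k)
  have "partial_deriv b (\<lambda>x. cnj (f x)) = (\<lambda>x. cnj (partial_deriv b f x))" for b
    using Suc.prems by (auto simp: partial_deriv_cnj)
  moreover have "(\<lambda>x. cnj (f x)) differentiable (at x)" for x
    using bounded_linear.has_derivative[OF bounded_linear_cnj differentiable_has_derivative, of f x] Suc.prems
    by (auto simp: differentiable_def)
  ultimately show ?case using Suc by auto
qed

lemma C_k_mult: "C_k k f \<Longrightarrow> C_k k g \<Longrightarrow> C_k k (\<lambda>x. f x * g x)"
proof (induction k arbitrary: f g)
  case 0 then show ?case by (auto intro: continuous_intros)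
next
  case (Suc k)
  have "partial_deriv b (\<lambda>x. f x * g x) = (\<lambda>x. f x * partial_deriv b g x + partial_deriv b f x * g x)" for b
    using Suc.prems by (auto simp: partial_deriv_mult)
  moreover have "C_k k f" "C_k k g" using Suc.prems by (blast intro: C_k_Suc_imp)+
  ultimately show ?case using Suc by (auto intro!: C_k_add)
qed

lemma C_k_const: "C_k k (\<lambda>x. c)"
proof (induction k arbitrary: c)
  case (Suc k)
  have "partial_deriv b (\<lambda>x. c) = (\<lambda>x. 0)" for b :: 'a
    by (auto simp: partial_deriv_eq[OF has_derivative_const])
  then show ?case using Suc[of 0] by auto
qed auto

lemma C_k_sum: "(\<And>i. i \<in> I \<Longrightarrow> C_k k (f i)) \<Longrightarrow> C_k k (\<lambda>x. \<Sum>i\<in>I. f i x)"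
  by (induction I rule: infinite_finite_induct) (auto intro: C_k_add C_k_const)

lemma C_k_prod: "(\<And>i. i \<in> I \<Longrightarrow> C_k k (f i)) \<Longrightarrow> C_k k (\<lambda>x. \<Prod>i\<in>I. f i x)"
  by (induction I rule: infinite_finite_induct) (auto intro: C_k_mult C_k_const)

lemma linear_partial_deriv_expand:
  assumes "f differentiable (at x)"
  shows "frechet_derivative f (at x) v = (\<Sum>e\<in>Basis. complex_of_real (v \<bullet> e) * partial_deriv e f x)"
proof -
  have l: "linear (frechet_derivative f (at x))"
    using differentiable_has_derivative[OF assms] has_derivative_linear by blast
  have "frechet_derivative f (at x) v = frechet_derivative f (at x) (\<Sum>e\<in>Basis. (v \<bullet> e) *\<^sub>R e)"
    by (simp add: euclidean_representation)
  also have "\<dots> = (\<Sum>e\<in>Basis. (v \<bullet> e) *\<^sub>R frechet_derivative f (at x) e)"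
    by (simp add: linear_sum[OF l] linear_cmul[OF l])
  finally show ?thesis by (simp add: partial_deriv_def scaleR_conv_of_real)
qed

text \<open>The chain rule for an affine map has constant coefficients, so the induction needs only
  sums and scalar multiples. Applied to the one-dimensional factors of a bump and to restrictions to
  rotated cross-sections of the tube.\<close>

lemma C_k_affine:
  fixes A :: "'a::euclidean_space \<Rightarrow> 'b::euclidean_space"
  assumes "bounded_linear A"
  shows "C_k k f \<Longrightarrow> C_k k (\<lambda>x. f (c + A x))"
    and partial_deriv_affine: "C_k (Suc m) g \<Longrightarrow> partial_deriv b (\<lambda>x. g (c + A x)) x =
       (\<Sum>e\<in>Basis. complex_of_real (A b \<bullet> e) * partial_deriv e g (c + A x))"
proof -
  have hd: "((\<lambda>x. f (c + A x)) has_derivative (\<lambda>h. frechet_derivative f (at (c + A x)) (A h))) (at x)"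
    if "f differentiable (at (c + A x))" for f :: "'b \<Rightarrow> complex" and x
  proof -
    have "((\<lambda>x. c + A x) has_derivative A) (at x)"
      using has_derivative_add[OF has_derivative_const bounded_linear.has_derivative[OF assms has_derivative_ident], of c]
      by simp
    from diff_chain_at[OF this differentiable_has_derivative[OF that]]
    show ?thesis by (simp add: o_def)
  qed
  have pd: "partial_deriv b (\<lambda>x. f (c + A x)) x =
       (\<Sum>e\<in>Basis. complex_of_real (A b \<bullet> e) * partial_deriv e f (c + A x))"
    if "f differentiable (at (c + A x))" for f :: "'b \<Rightarrow> complex" and x b
    using partial_deriv_eq[OF hd[OF that]] linear_partial_deriv_expand[OF that] by metis
  show "C_k k f \<Longrightarrow> C_k k (\<lambda>x. f (c + A x))"
  proof (induction k arbitrary: f)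
    case 0
    have "continuous_on UNIV (\<lambda>x. c + A x)"
      by (intro continuous_intros linear_continuous_on assms)
    with 0 show ?case by (auto intro: continuous_on_compose2)
  next
    case (Suc k)
    have "partial_deriv b (\<lambda>x. f (c + A x)) =
       (\<lambda>x. \<Sum>e\<in>Basis. complex_of_real (A b \<bullet> e) * partial_deriv e f (c + A x))" for b
      using Suc.prems by (auto simp: pd)
    moreover have "(\<lambda>x. f (c + A x)) differentiable (at x)" for x
      using hd[of f x] Suc.prems by (auto simp: differentiable_def)
    ultimately show ?case
      using Suc by (auto intro!: C_k_sum C_k_cmult)
  qed
  show "C_k (Suc m) g \<Longrightarrow> partial_deriv b (\<lambda>x. g (c + A x)) x =
       (\<Sum>e\<in>Basis. complex_of_real (A b \<bullet> e) * partial_deriv e g (c + A x))"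
    by (rule pd) simp
qed

lemma test_functionsI:
  assumes "\<And>k. C_k k \<phi>" "compact K" "K \<subseteq> \<Omega>" "\<And>x. x \<notin> K \<Longrightarrow> \<phi> x = 0"
  shows "\<phi> \<in> test_functions \<Omega>"
proof -
  have "{x. \<phi> x \<noteq> 0} \<subseteq> K" using assms(4) by auto
  then have "closure {x. \<phi> x \<noteq> 0} \<subseteq> K"
    using assms(2) by (intro closure_minimal compact_imp_closed)
  moreover from this have "compact (closure {x. \<phi> x \<noteq> 0})"
    using assms(2) closed_closure compact_Int_closed[of K "closure {x. \<phi> x \<noteq> 0}"]
    by (simp add: Int_absorb1)
  ultimately show ?thesis using assms by (auto simp: test_functions_def)
qed

lemma test_functionsE:
  assumes "\<phi> \<in> test_functions \<Omega>"
  obtains K where "compact K" "K \<subseteq> \<Omega>" "\<And>x. x \<notin> K \<Longrightarrow> \<phi> x = 0"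
proof (rule that[of "closure {x. \<phi> x \<noteq> 0}"])
  fix x assume "x \<notin> closure {x. \<phi> x \<noteq> 0}"
  then show "\<phi> x = 0" using closure_subset[of "{x. \<phi> x \<noteq> 0}"] by blast
qed (use assms in \<open>auto simp: test_functions_def\<close>)

lemma test_functions_C_k: "\<phi> \<in> test_functions \<Omega> \<Longrightarrow> C_k k \<phi>"
  by (simp add: test_functions_def)

lemma test_functions_continuous: "\<phi> \<in> test_functions \<Omega> \<Longrightarrow> continuous_on UNIV \<phi>"
  using test_functions_C_k[of \<phi> \<Omega> 0] by simp

lemma test_functions_differentiable: "\<phi> \<in> test_functions \<Omega> \<Longrightarrow> \<phi> differentiable (at x)"
  using test_functions_C_k[of \<phi> \<Omega> 1] by simp

lemma test_functions_outside: "\<phi> \<in> test_functions \<Omega> \<Longrightarrow> x \<notin> \<Omega> \<Longrightarrow> \<phi> x = 0"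
  by (metis test_functionsE subsetD)

lemma test_functions_measurable: "\<phi> \<in> test_functions \<Omega> \<Longrightarrow> \<phi> \<in> borel_measurable borel"
  using test_functions_continuous borel_measurable_continuous_onI by blast

lemma test_functions_cmult:
  assumes "\<phi> \<in> test_functions \<Omega>" shows "(\<lambda>x. c * \<phi> x) \<in> test_functions \<Omega>"
  using assms
  by (elim test_functionsE, intro test_functionsI) (auto intro!: C_k_cmult test_functions_C_k[OF assms])

lemma test_functions_cnj:
  assumes "\<phi> \<in> test_functions \<Omega>" shows "(\<lambda>x. cnj (\<phi> x)) \<in> test_functions \<Omega>"
  using assms
  by (elim test_functionsE, intro test_functionsI) (auto intro!: C_k_cnj test_functions_C_k[OF assms])

lemma test_functions_add:
  assumes "\<phi> \<in> test_functions \<Omega>" "\<psi> \<in> test_functions \<Omega>"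
  shows "(\<lambda>x. \<phi> x + \<psi> x) \<in> test_functions \<Omega>"
proof -
  obtain K where K: "compact K" "K \<subseteq> \<Omega>" "\<And>x. x \<notin> K \<Longrightarrow> \<phi> x = 0"
    using assms(1) test_functionsE by blast
  obtain L where L: "compact L" "L \<subseteq> \<Omega>" "\<And>x. x \<notin> L \<Longrightarrow> \<psi> x = 0"
    using assms(2) test_functionsE by blast
  show ?thesis
    by (rule test_functionsI[of _ "K \<union> L"]) (use assms K L in \<open>auto intro: C_k_add test_functions_C_k\<close>)
qed

lemma test_functions_diff:
  assumes "\<phi> \<in> test_functions \<Omega>" "\<psi> \<in> test_functions \<Omega>"
  shows "(\<lambda>x. \<phi> x - \<psi> x) \<in> test_functions \<Omega>"
  using test_functions_add[OF assms(1) test_functions_cmult[OF assms(2), of "-1"]] by simp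

lemma test_functions_mult:
  assumes "\<phi> \<in> test_functions \<Omega>" "\<psi> \<in> test_functions \<Omega>'"
  shows "(\<lambda>x. \<phi> x * \<psi> x) \<in> test_functions \<Omega>"
  using assms(1)
  by (elim test_functionsE, intro test_functionsI) (auto intro: C_k_mult test_functions_C_k assms)

section \<open>Supports and integrals of test functions\<close>

lemma partial_deriv_zero_off:
  assumes "compact K" "\<And>x. x \<notin> K \<Longrightarrow> \<phi> x = 0" "x \<notin> K"
  shows "partial_deriv b \<phi> x = 0"
proof -
  have "open (- K)" using assms(1) by (simp add: compact_imp_closed open_Compl)
  have "(\<phi> has_derivative (\<lambda>x. 0)) (at x)"
    by (rule has_derivative_transform_within_open[where f = "\<lambda>x. 0" and s = "- K"])
       (use assms \<open>open (- K)\<close> in auto)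
  then show ?thesis by (rule partial_deriv_eq)
qed

lemma test_functions_partial_deriv:
  assumes "\<phi> \<in> test_functions \<Omega>" "b \<in> Basis"
  shows "partial_deriv b \<phi> \<in> test_functions \<Omega>"
proof -
  obtain K where K: "compact K" "K \<subseteq> \<Omega>" "\<And>x. x \<notin> K \<Longrightarrow> \<phi> x = 0"
    using assms(1) test_functionsE by blast
  show ?thesis
    by (rule test_functionsI[of _ K])
       (use K assms test_functions_C_k[OF assms(1), of "Suc _"] partial_deriv_zero_off[OF K(1,3)] in auto)
qed

lemma partial_deriv_diff_test:
  assumes "\<phi> \<in> test_functions \<Omega>" "\<psi> \<in> test_functions \<Omega>"
  shows "partial_deriv b (\<lambda>x. \<phi> x - \<psi> x) x = partial_deriv b \<phi> x - partial_deriv b \<psi> x"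
  using partial_deriv_add[of \<phi> x "\<lambda>x. (-1) * \<psi> x" b] partial_deriv_cmult[of \<psi> x b "-1"]
    assms[THEN test_functions_differentiable, of x] by simp

lemma integrable_compact_support:
  fixes h :: "'a::euclidean_space \<Rightarrow> 'b::euclidean_space"
  assumes "continuous_on UNIV h" "compact K" "\<And>x. x \<notin> K \<Longrightarrow> h x = 0"
  shows "integrable lborel h"
proof -
  have "integrable lborel (\<lambda>x. indicator K x *\<^sub>R h x)"
    using assms continuous_on_subset by (intro borel_integrable_compact) blast+
  moreover have "(\<lambda>x. indicator K x *\<^sub>R h x) = h"
    using assms(3) by (auto simp: indicator_def)
  ultimately show ?thesis by simp
qed

lemma test_functions_sq_int_lborel:
  assumes "\<phi> \<in> test_functions \<Omega>" shows "sq_int lborel \<phi>"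
proof -
  obtain K where K: "compact K" "K \<subseteq> \<Omega>" "\<And>x. x \<notin> K \<Longrightarrow> \<phi> x = 0"
    using assms(1) test_functionsE by blast
  have "integrable lborel (\<lambda>x. (cmod (\<phi> x))\<^sup>2)"
    by (rule integrable_compact_support[OF _ K(1)])
       (use K test_functions_continuous[OF assms] in \<open>auto intro!: continuous_intros\<close>)
  then show ?thesis
    using test_functions_measurable[OF assms] by (simp add: sq_int_def)
qed

lemma test_functions_integrable_lborel:
  assumes "\<phi> \<in> test_functions \<Omega>" shows "integrable lborel \<phi>"
  using assms by (elim test_functionsE) (auto intro: integrable_compact_support test_functions_continuous[OF assms])

text \<open>Vanishing off \<open>\<Omega>\<close> removes the restriction and Borel measurability
  removes the completion. For test functions all computations can therefore take place in
  \<open>lborel\<close>.\<close>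

lemma integrable_lebesgue_on_iff:
  fixes h :: "'a::euclidean_space \<Rightarrow> 'b::euclidean_space"
  assumes "\<Omega> \<in> sets lebesgue" "h \<in> borel_measurable borel" "\<And>x. x \<notin> \<Omega> \<Longrightarrow> h x = 0"
  shows "integrable (lebesgue_on \<Omega>) h \<longleftrightarrow> integrable lborel h"
    and integral_lebesgue_on_eq: "(\<integral>x. h x \<partial>lebesgue_on \<Omega>) = (\<integral>x. h x \<partial>lborel)"
proof -
  have "(\<lambda>x. indicator \<Omega> x *\<^sub>R h x) = h" using assms(3) by (auto simp: indicator_def)
  then show "integrable (lebesgue_on \<Omega>) h \<longleftrightarrow> integrable lborel h"
    "(\<integral>x. h x \<partial>lebesgue_on \<Omega>) = (\<integral>x. h x \<partial>lborel)"
    using assms by (simp_all add: integrable_restrict_space integral_restrict_space integrable_completion integral_completion)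
qed

lemma borel_measurable_lebesgue_onI: "h \<in> borel_measurable borel \<Longrightarrow> h \<in> borel_measurable (lebesgue_on \<Omega>)"
  by (intro measurable_restrict_space1 measurable_completion) simp

lemma test_functions_sq_int:
  assumes "\<phi> \<in> test_functions \<Omega>" "\<Omega> \<in> sets lebesgue" shows "sq_int (lebesgue_on \<Omega>) \<phi>"
proof -
  have "(\<lambda>x. (cmod (\<phi> x))\<^sup>2) \<in> borel_measurable borel"
    using test_functions_measurable[OF assms(1)] by measurable
  then have "integrable (lebesgue_on \<Omega>) (\<lambda>x. (cmod (\<phi> x))\<^sup>2)"
    using test_functions_sq_int_lborel[OF assms(1)] assms(2) test_functions_outside[OF assms(1)]
    by (subst integrable_lebesgue_on_iff) (auto simp: sq_int_def)
  then show ?thesis using test_functions_measurable[OF assms(1)]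
    by (simp add: sq_int_def borel_measurable_lebesgue_onI)
qed

lemma test_functions_nrm:
  assumes "\<phi> \<in> test_functions \<Omega>" "\<Omega> \<in> sets lebesgue"
  shows "nrm (lebesgue_on \<Omega>) \<phi> = nrm lborel \<phi>"
proof -
  have "(\<lambda>x. (cmod (\<phi> x))\<^sup>2) \<in> borel_measurable borel"
    using test_functions_measurable[OF assms(1)] by measurable
  then show ?thesis unfolding nrm_def
    using assms(2) test_functions_outside[OF assms(1)] by (subst integral_lebesgue_on_eq) auto
qed

text \<open>The difference quotients \<open>q n\<close> in direction \<open>b\<close> have integral
  zero by translation invariance, and dominated convergence transfers this to the
  derivative.\<close>

lemma integral_partial_deriv_zero:
  fixes h :: "'a::euclidean_space \<Rightarrow> complex"
  assumes h: "h \<in> test_functions \<Omega>" and b: "b \<in> Basis"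
  shows "(\<integral>x. partial_deriv b h x \<partial>lborel) = 0"
proof -
  obtain K where K: "compact K" "K \<subseteq> \<Omega>" "\<And>x. x \<notin> K \<Longrightarrow> h x = 0"
    using h test_functionsE by blast
  define g where "g = partial_deriv b h"
  have gT: "g \<in> test_functions \<Omega>" unfolding g_def using test_functions_partial_deriv[OF h b] .
  have "bounded (g ` K)"
    using K(1) test_functions_continuous[OF gT] continuous_on_subset
    by (intro compact_imp_bounded compact_continuous_image) auto
  then obtain B where B: "\<And>x. x \<in> K \<Longrightarrow> cmod (g x) \<le> B" "B > 0"
    by (auto simp: bounded_pos)
  have gB: "cmod (g x) \<le> B" for x
    using B partial_deriv_zero_off[of K h x b, OF K(1,3)] by (cases "x \<in> K") (auto simp: g_def)
  \<comment> \<open>All points that reach \<open>K\<close> by a step of length at most one in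
    direction \<open>b\<close>: a common support for \<open>h\<close> and all quotients
    \<open>q n\<close>, and hence the carrier of the dominating function.\<close>
  define L where "L = (\<lambda>(x, s). x - s *\<^sub>R b) ` (K \<times> {0..1::real})"
  have L: "compact L" unfolding L_def
    using K(1) by (intro compact_continuous_image compact_Times) (auto intro!: continuous_intros simp: case_prod_unfold)
  have KL: "K \<subseteq> L"
    unfolding L_def by (force simp: image_iff)
  define q where "q n x = complex_of_real (real (Suc n)) * (h (x + (1 / real (Suc n)) *\<^sub>R b) - h x)" for n x
  have mh[measurable]: "h \<in> borel_measurable borel" using test_functions_measurable[OF h] .
  have [measurable]: "g \<in> borel_measurable borel" using test_functions_measurable[OF gT] .
  have hv: "((\<lambda>s. h (x + s *\<^sub>R b)) has_vector_derivative g (x + s *\<^sub>R b)) (at s)" for x s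
  proof -
    have "((\<lambda>s. x + s *\<^sub>R b) has_derivative (\<lambda>t. t *\<^sub>R b)) (at s)"
      by (auto intro!: derivative_eq_intros)
    from diff_chain_at[OF this differentiable_has_derivative[OF test_functions_differentiable[OF h]]]
    have "((\<lambda>s. h (x + s *\<^sub>R b)) has_derivative (\<lambda>t. frechet_derivative h (at (x + s *\<^sub>R b)) (t *\<^sub>R b))) (at s)"
      by (simp add: o_def)
    moreover have "linear (frechet_derivative h (at (x + s *\<^sub>R b)))"
      using differentiable_has_derivative[OF test_functions_differentiable[OF h]] has_derivative_linear by blast
    ultimately show ?thesis
      by (simp add: has_vector_derivative_def g_def partial_deriv_def linear_cmul)
  qed
  have bound: "norm (q n x) \<le> B * indicator L x" for n x
  proof (cases "x \<in> L")
    case True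
    have "norm (h (x + (1 / real (Suc n)) *\<^sub>R b) - h (x + 0 *\<^sub>R b)) \<le> B * norm (1 / real (Suc n) - 0)"
    proof (rule differentiable_bound[where S=UNIV and f = "\<lambda>s. h (x + s *\<^sub>R b)" and f' = "\<lambda>s t. t *\<^sub>R g (x + s *\<^sub>R b)"])
      show "((\<lambda>s. h (x + s *\<^sub>R b)) has_derivative (\<lambda>t. t *\<^sub>R g (x + s *\<^sub>R b))) (at s within UNIV)" for s
        using hv[of x s] by (simp add: has_vector_derivative_def)
      show "onorm (\<lambda>t. t *\<^sub>R g (x + s *\<^sub>R b)) \<le> B" for s
        using gB[of "x + s *\<^sub>R b"] B(2) by (intro onorm_le) (simp add: mult.commute[of B] mult_left_mono)
    qed auto
    then have "norm (q n x) \<le> real (Suc n) * (B * (1 / real (Suc n)))"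
      unfolding q_def norm_mult norm_of_real by (intro mult_mono) (auto simp: abs_of_nonneg)
    then show ?thesis using True by (simp del: of_nat_Suc)
  next
    case False
    have "x \<notin> K" using False KL by auto
    moreover have "x + (1 / real (Suc n)) *\<^sub>R b \<notin> K"
    proof
      assume "x + (1 / real (Suc n)) *\<^sub>R b \<in> K"
      then have "x \<in> L" unfolding L_def
        by (intro image_eqI[of _ _ "(x + (1 / real (Suc n)) *\<^sub>R b, 1 / real (Suc n))"]) auto
      then show False using False by simp
    qed
    ultimately show ?thesis using K(3) B(2) by (simp add: q_def)
  qed
  have ih: "integrable lborel h" using test_functions_integrable_lborel[OF h] .
  have "(\<integral>x. q n x \<partial>lborel) = 0" for n
  proof -
    have sh: "(\<integral>x. h (c + x) \<partial>lborel) = (\<integral>x. h x \<partial>lborel) \<and> integrable lborel (\<lambda>x. h (c + x))" for c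
    proof -
      have "(\<integral>x. h x \<partial>lborel) = (\<integral>x. h x \<partial>distr lborel borel ((+) c))"
        using lborel_distr_plus by metis
      also have "\<dots> = (\<integral>x. h (c + x) \<partial>lborel)" by (subst integral_distr) auto
      finally have "(\<integral>x. h (c + x) \<partial>lborel) = (\<integral>x. h x \<partial>lborel)" by simp
      moreover have "integrable (distr lborel borel ((+) c)) h" using ih lborel_distr_plus by metis
      then have "integrable lborel (\<lambda>x. h (c + x))" by (subst (asm) integrable_distr_eq) auto
      ultimately show ?thesis by simp
    qed
    have "(\<integral>x. q n x \<partial>lborel) = complex_of_real (real (Suc n)) * (\<integral>x. h ((1 / real (Suc n)) *\<^sub>R b + x) - h x \<partial>lborel)"
      unfolding q_def by (simp add: add.commute)
    also have "\<dots> = 0" using sh ih by (subst Bochner_Integration.integral_diff) auto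
    finally show ?thesis .
  qed
  moreover have "(\<lambda>n. \<integral>x. q n x \<partial>lborel) \<longlonglongrightarrow> (\<integral>x. g x \<partial>lborel)"
  proof (rule integral_dominated_convergence)
    have "emeasure lborel L < \<infinity>" using L by (intro emeasure_bounded_finite compact_imp_bounded)
    then show "integrable lborel (\<lambda>x. B * indicator L x)"
      using L by (intro integrable_mult_right integrable_real_indicator) (auto intro: borel_compact)
    show "AE x in lborel. (\<lambda>n. q n x) \<longlonglongrightarrow> g x"
    proof (rule AE_I2)
      fix x
      have "((\<lambda>s. norm (h (x + s *\<^sub>R b) - h x - s *\<^sub>R g x) / norm s) \<longlongrightarrow> 0) (at 0)"
        using hv[of x 0] by (simp add: has_vector_derivative_def has_derivative_at)
      moreover have "filterlim (\<lambda>n. 1 / real (Suc n)) (at 0) sequentially"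
        unfolding filterlim_at using LIMSEQ_Suc[OF lim_1_over_n] by auto
      ultimately have "(\<lambda>n. norm (h (x + (1 / real (Suc n)) *\<^sub>R b) - h x - (1 / real (Suc n)) *\<^sub>R g x)
          / norm (1 / real (Suc n))) \<longlonglongrightarrow> 0"
        by (rule filterlim_compose)
      moreover have "norm (h (x + (1 / real (Suc n)) *\<^sub>R b) - h x - (1 / real (Suc n)) *\<^sub>R g x)
          / norm (1 / real (Suc n)) = norm (q n x - g x)" for n
      proof -
        have "q n x - g x = complex_of_real (real (Suc n)) *
            (h (x + (1 / real (Suc n)) *\<^sub>R b) - h x - (1 / real (Suc n)) *\<^sub>R g x)"
          by (simp add: q_def scaleR_conv_of_real right_diff_distrib del: of_nat_Suc)
        then show ?thesis by (simp add: norm_mult del: of_nat_Suc)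
      qed
      ultimately have "(\<lambda>n. q n x - g x) \<longlonglongrightarrow> 0"
        by (simp add: tendsto_norm_zero_iff)
      then show "(\<lambda>n. q n x) \<longlonglongrightarrow> g x" by (simp add: Lim_null[symmetric] LIM_zero_iff)
    qed
  qed (use bound in \<open>auto simp: q_def\<close>)
  ultimately have "(\<lambda>n. 0) \<longlonglongrightarrow> (\<integral>x. g x \<partial>lborel)" by simp
  then show ?thesis using LIMSEQ_unique[OF tendsto_const] g_def by metis
qed

subsection \<open>The fundamental lemma of the calculus of variations\<close>

text \<open>Bridge from Lebesgue to Borel measurable representatives; the product measure and the
  twist are handled for Borel functions only.\<close>

lemma borel_version_complex:
  fixes f :: "'a::euclidean_space \<Rightarrow> complex"
  assumes [measurable]: "f \<in> borel_measurable lebesgue"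
  obtains g where "g \<in> borel_measurable borel" "AE x in lborel. f x = g x"
proof -
  have m: "(\<lambda>x. Re (f x)) \<in> borel_measurable (completion lborel)"
    "(\<lambda>x. Im (f x)) \<in> borel_measurable (completion lborel)"
    by measurable
  obtain r where r: "r \<in> borel_measurable lborel" "AE x in lborel. Re (f x) = r x"
    using completion_ex_borel_measurable_real[OF m(1)] by auto
  obtain s where s: "s \<in> borel_measurable lborel" "AE x in lborel. Im (f x) = s x"
    using completion_ex_borel_measurable_real[OF m(2)] by auto
  show ?thesis
  proof (rule that[of "\<lambda>x. complex_of_real (r x) + \<i> * complex_of_real (s x)"])
    show "(\<lambda>x. complex_of_real (r x) + \<i> * complex_of_real (s x)) \<in> borel_measurable borel"
      using r(1) s(1) by measurable
    show "AE x in lborel. f x = complex_of_real (r x) + \<i> * complex_of_real (s x)"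
      using r(2) s(2) by eventually_elim (simp add: complex_eq_iff)
  qed
qed

lemma Int_stable_boxes: "Int_stable (range (\<lambda>(a, b). box a b :: 'a::euclidean_space set))"
  by (auto simp: Int_stable_def box_Int_box)

text \<open>Boxes form an intersection-stable generator of the Borel sets, so the vanishing of
  integrals spreads by Dynkin's argument. Complements need the total integral to vanish, and the
  support condition makes that one of the box integrals.\<close>

lemma AE_zero_of_box_integrals:
  fixes g :: "'a::euclidean_space \<Rightarrow> complex"
  assumes g: "integrable lborel g"
    and supp: "\<And>x. x \<notin> box a b \<Longrightarrow> g x = 0"
    and box: "\<And>c d. set_lebesgue_integral lborel (box c d) g = 0"
  shows "AE x in lborel. g x = 0"
proof (rule sigma_finite_measure.density_zero[OF sigma_finite_lborel g])
  have si: "set_integrable lborel A g" if "A \<in> sets borel" for A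
    using integrable_mult_indicator[of A lborel g] g that by (simp add: set_integrable_def)
  fix A assume "A \<in> sets (lborel :: 'a measure)"
  then have "A \<in> sigma_sets UNIV (range (\<lambda>(a, b). box a b))"
    unfolding borel_eq_box sets_lborel by simp
  with Int_stable_boxes have "Int_stable (range (\<lambda>(a, b). box a b :: 'a set))"
    and "range (\<lambda>(a, b). box a b :: 'a set) \<subseteq> Pow UNIV"
    and "A \<in> sigma_sets UNIV (range (\<lambda>(a, b). box a b))" by auto
  then show "set_lebesgue_integral lborel A g = 0"
  proof (induction rule: sigma_sets_induct_disjoint)
    case (basic A) then show ?case using box by auto
  next
    case empty show ?case by (simp add: set_lebesgue_integral_def)
  next
    case (compl A)
    then have A[measurable]: "A \<in> sets borel" by (simp add: borel_eq_box)
    have "set_lebesgue_integral lborel (UNIV - A) g = (\<integral>x. g x - indicator A x *\<^sub>R g x \<partial>lborel)"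
      unfolding set_lebesgue_integral_def by (intro Bochner_Integration.integral_cong) (auto simp: indicator_def)
    also have "\<dots> = (\<integral>x. g x \<partial>lborel) - set_lebesgue_integral lborel A g"
      unfolding set_lebesgue_integral_def
      using si[OF A] g by (intro Bochner_Integration.integral_diff) (auto simp: set_integrable_def)
    also have "(\<integral>x. g x \<partial>lborel) = set_lebesgue_integral lborel (box a b) g"
      unfolding set_lebesgue_integral_def
      by (intro Bochner_Integration.integral_cong) (use supp in \<open>auto simp: indicator_def\<close>)
    finally show ?case using compl box by simp
  next
    case (union F)
    then have F: "F i \<in> sets borel" for i by (simp add: borel_eq_box subset_eq)
    have "set_lebesgue_integral lborel (\<Union>i. F i) g = (\<Sum>i. set_lebesgue_integral lborel (F i) g)"
    proof (rule lebesgue_integral_countable_add)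
      show "set_integrable lborel (\<Union>i. F i) g" using F by (intro si) auto
      show "F i \<inter> F j = {}" if "i \<noteq> j" for i j
        using union.hyps that by (auto simp: disjoint_family_on_def)
    qed (use F in simp)
    then show ?case using union by simp
  qed
qed

text \<open>
  The family \<open>e\<^sup>-\<^sup>1\<^sup>/\<^sup>t / t\<^sup>n\<close> is, up to linear combinations, closed under differentiation; this gives
  smoothness of its member \<open>n = 0\<close> by induction.
\<close>

definition flat_exp :: "nat \<Rightarrow> real \<Rightarrow> real" where
  "flat_exp n t = (if t \<le> 0 then 0 else exp (- (1 / t)) / t ^ n)"

text \<open>In the variable \<open>1 / t\<close> this is the dominance of the exponential over
  powers. It gives the derivative at the origin, because the difference quotient of
  \<open>flat_exp n\<close> there is \<open>flat_exp (Suc n)\<close>.\<close>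

lemma flat_exp_tendsto_0: "(flat_exp n \<longlongrightarrow> 0) (at 0)"
proof -
  have "((\<lambda>t. (1 / t) ^ n / exp (1 / t)) \<longlongrightarrow> (0::real)) (at_right 0)"
    using filterlim_compose[OF tendsto_power_div_exp_0 filterlim_inverse_at_top_right]
    by (simp add: inverse_eq_divide)
  moreover have "\<forall>\<^sub>F t in at_right (0::real). (1 / t) ^ n / exp (1 / t) = flat_exp n t"
    unfolding eventually_at_right_field
    by (auto intro!: exI[of _ 1] simp: flat_exp_def power_one_over exp_minus field_simps)
  ultimately have "(flat_exp n \<longlongrightarrow> 0) (at_right 0)" by (rule Lim_transform_eventually)
  moreover have "\<forall>\<^sub>F t in at_left (0::real). 0 = flat_exp n t"
    unfolding eventually_at_left_field by (auto intro!: exI[of _ "-1"] simp: flat_exp_def)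
  then have "(flat_exp n \<longlongrightarrow> 0) (at_left 0)" by (rule Lim_transform_eventually[OF tendsto_const])
  ultimately show ?thesis by (simp add: filterlim_split_at)
qed

lemma flat_exp_DERIV:
  "(flat_exp n has_real_derivative flat_exp (n + 2) t - real n * flat_exp (n + 1) t) (at t)"
proof -
  consider "t < 0" | "t > 0" | "t = 0" by linarith
  then show ?thesis
  proof cases
    case 1
    have "((\<lambda>t. 0) has_real_derivative 0) (at t)" by simp
    then have "(flat_exp n has_real_derivative 0) (at t)"
      by (rule DERIV_cong_ev[THEN iffD1, rotated 3])
         (use 1 eventually_nhds_in_open[of "{..<0}" t] in \<open>auto elim!: eventually_mono simp: flat_exp_def\<close>)
    then show ?thesis using 1 by (simp add: flat_exp_def)
  next
    case 2
    have "((\<lambda>t. exp (- (1 / t)) / t ^ n) has_real_derivative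
        exp (- (1 / t)) / t ^ (n + 2) - real n * (exp (- (1 / t)) / t ^ (n + 1))) (at t)"
    proof (cases n)
      case 0 show ?thesis unfolding 0 using 2
        by (auto intro!: derivative_eq_intros simp: power2_eq_square field_simps)
    next
      case (Suc m)
      have p: "((\<lambda>t. t ^ Suc m) has_real_derivative real (Suc m) * t ^ m) (at t)"
        using DERIV_pow[of "Suc m" t] by simp
      have e: "((\<lambda>t. exp (- (1 / t))) has_real_derivative exp (- (1 / t)) / t\<^sup>2) (at t)"
        using 2 by (auto intro!: derivative_eq_intros simp: power2_eq_square)
      show ?thesis unfolding Suc
        by (rule DERIV_cong[OF DERIV_divide[OF e p]])
           (use 2 in \<open>simp_all add: power2_eq_square divide_simps, simp add: algebra_simps\<close>)
    qed
    then have "(flat_exp n has_real_derivative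
        exp (- (1 / t)) / t ^ (n + 2) - real n * (exp (- (1 / t)) / t ^ (n + 1))) (at t)"
      by (rule DERIV_cong_ev[THEN iffD1, rotated 3])
         (use 2 eventually_nhds_in_open[of "{0<..}" t] in \<open>auto elim!: eventually_mono simp: flat_exp_def\<close>)
    then show ?thesis using 2 by (simp add: flat_exp_def)
  next
    case 3
    have "(\<lambda>h. (flat_exp n (0 + h) - flat_exp n 0) / h) = flat_exp (Suc n)"
      by (auto simp: flat_exp_def)
    then have "(flat_exp n has_real_derivative 0) (at 0)"
      using flat_exp_tendsto_0[of "Suc n"] unfolding DERIV_def by simp
    then show ?thesis using 3 by (simp add: flat_exp_def)
  qed
qed

lemma C_k_flat_exp: "C_k k (\<lambda>t. complex_of_real (flat_exp n t))"
proof (induction k arbitrary: n)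
  case 0
  have "continuous_on UNIV (flat_exp n)"
    using flat_exp_DERIV DERIV_isCont continuous_at_imp_continuous_on by blast
  then show ?case by (auto intro: continuous_intros)
next
  case (Suc k)
  have d: "((\<lambda>t. complex_of_real (flat_exp n t)) has_derivative
      (\<lambda>h. complex_of_real (h * (flat_exp (n + 2) t - real n * flat_exp (n + 1) t)))) (at t)" for t
    using bounded_linear.has_derivative[OF bounded_linear_of_real
        flat_exp_DERIV[unfolded has_field_derivative_def]]
    by (simp add: mult.commute[of _ "_ - _"])
  have "partial_deriv 1 (\<lambda>t. complex_of_real (flat_exp n t)) =
      (\<lambda>t. complex_of_real (flat_exp (n + 2) t) + complex_of_real (- real n) * complex_of_real (flat_exp (n + 1) t))"
    by (auto simp: partial_deriv_eq[OF d])
  moreover have "C_k k (\<lambda>t. complex_of_real (flat_exp (n + 2) t) + complex_of_real (- real n) * complex_of_real (flat_exp (n + 1) t))"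
    by (intro C_k_add C_k_cmult Suc)
  moreover have "(\<lambda>t. complex_of_real (flat_exp n t)) differentiable (at t)" for t
    using d[of t] by (auto simp: differentiable_def)
  ultimately show ?case by simp
qed

text \<open>The parameter \<open>s\<close> sharpens the bump: a factor
  \<open>exp (- 1 / (s * t))\<close> tends to 1 for every \<open>t > 0\<close>. For growing
  \<open>s\<close> these functions approximate the indicator of the open box and never exceed
  it.\<close>

definition bump :: "real \<Rightarrow> 'a::euclidean_space \<Rightarrow> 'a \<Rightarrow> 'a \<Rightarrow> real" where
  "bump s a b x = (\<Prod>i\<in>Basis. flat_exp 0 (s * (x \<bullet> i - a \<bullet> i)) * flat_exp 0 (s * (b \<bullet> i - x \<bullet> i)))"

lemma flat_exp_bounds: "0 \<le> flat_exp 0 t" "flat_exp 0 t \<le> 1" "0 < flat_exp 0 t \<longleftrightarrow> 0 < t"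
  by (auto simp: flat_exp_def)

lemma bump_bounds: "0 \<le> bump s a b x" "bump s a b x \<le> 1"
  unfolding bump_def
  by (auto intro!: prod_nonneg prod_le_1 mult_le_one simp: flat_exp_bounds)

lemma bump_pos_iff:
  assumes "s > 0" shows "0 < bump s a b x \<longleftrightarrow> x \<in> box a b"
proof
  assume "x \<in> box a b"
  then show "0 < bump s a b x"
    using assms unfolding bump_def by (intro prod_pos) (auto simp: flat_exp_bounds mem_box)
next
  assume *: "0 < bump s a b x"
  have "0 < s * (x \<bullet> i - a \<bullet> i) \<and> 0 < s * (b \<bullet> i - x \<bullet> i)" if i: "i \<in> Basis" for i
  proof -
    have "bump s a b x \<noteq> 0" using * by simp
    then have "flat_exp 0 (s * (x \<bullet> i - a \<bullet> i)) \<noteq> 0 \<and> flat_exp 0 (s * (b \<bullet> i - x \<bullet> i)) \<noteq> 0"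
      unfolding bump_def prod_zero_iff[OF finite_Basis] using i by auto
    then show ?thesis by (simp add: flat_exp_def split: if_splits)
  qed
  then show "x \<in> box a b" using assms by (auto simp: mem_box zero_less_mult_iff)
qed

lemma bump_test_function:
  assumes "s > 0" "cbox a b \<subseteq> \<Omega>"
  shows "(\<lambda>x. complex_of_real (bump s a b x)) \<in> test_functions \<Omega>"
proof (rule test_functionsI[OF _ compact_cbox assms(2)])
  fix k
  have l: "C_k k (\<lambda>x::'a. complex_of_real (flat_exp 0 (c + r * (x \<bullet> i))))" for c r i
  proof -
    have "bounded_linear (\<lambda>x::'a. r * (x \<bullet> i))"
      by (intro bounded_linear_const_mult bounded_linear_inner_left)
    from C_k_affine(1)[OF this C_k_flat_exp] show ?thesis .
  qed
  have "(\<lambda>x. complex_of_real (bump s a b x)) =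
    (\<lambda>x. \<Prod>i\<in>Basis. complex_of_real (flat_exp 0 (- s * (a \<bullet> i) + s * (x \<bullet> i)))
       * complex_of_real (flat_exp 0 (s * (b \<bullet> i) + (- s) * (x \<bullet> i))))"
    by (auto simp: bump_def algebra_simps)
  moreover have "C_k k \<dots>"
    by (intro C_k_prod C_k_mult l)
  ultimately show "C_k k (\<lambda>x. complex_of_real (bump s a b x))" by (simp only:)
next
  fix x assume "x \<notin> cbox a b"
  then have "x \<notin> box a b" using box_subset_cbox by blast
  then have "\<not> 0 < bump s a b x" using bump_pos_iff[OF assms(1)] by blast
  then show "complex_of_real (bump s a b x) = 0" using bump_bounds(1)[of s a b x] by simp
qed

lemma bump_tendsto_indicator:
  "(\<lambda>n. bump (real (Suc n)) a b x) \<longlonglongrightarrow> indicator (box a b) x"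
proof (cases "x \<in> box a b")
  case True
  have 1: "(\<lambda>n. flat_exp 0 (real (Suc n) * t)) \<longlonglongrightarrow> 1" if "t > 0" for t
  proof -
    have "(\<lambda>n. exp (- (1 / real (Suc n) * (1 / t)))) \<longlonglongrightarrow> exp (- (0 * (1 / t)))"
      by (intro tendsto_intros LIMSEQ_Suc[OF lim_1_over_n])
    moreover have "exp (- (1 / real (Suc n) * (1 / t))) = flat_exp 0 (real (Suc n) * t)" for n
      using mult_pos_pos[OF _ that, of "real (Suc n)"] by (simp add: flat_exp_def not_le del: of_nat_Suc)
    ultimately show ?thesis by simp
  qed
  have "(\<lambda>n. bump (real (Suc n)) a b x) \<longlonglongrightarrow> (\<Prod>i\<in>(Basis::'a set). 1 * 1)"
    unfolding bump_def by (intro tendsto_prod tendsto_mult 1) (use True in \<open>auto simp: mem_box\<close>)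
  then show ?thesis using True by simp
next
  case False
  then have "bump (real (Suc n)) a b x = 0" for n
    using bump_pos_iff[of "real (Suc n)" a b x] bump_bounds(1)[of "real (Suc n)" a b x] by simp
  then show ?thesis using False by simp
qed

text \<open>Boxes have finite measure. Paired with this indicator, a square-integrable function
  becomes integrable over the box.\<close>

lemma sq_int_box_indicator:
  assumes "\<Omega> \<in> sets lebesgue"
  shows "sq_int (lebesgue_on \<Omega>) (\<lambda>x. complex_of_real (indicator (cbox a b) x))"
proof -
  have e: "(\<lambda>x. (cmod (complex_of_real (indicator (cbox a b) x)))\<^sup>2) = indicat_real (cbox a b)"
    by (auto simp: indicator_def)
  have "emeasure (lebesgue_on \<Omega>) (\<Omega> \<inter> cbox a b) \<le> emeasure lebesgue (cbox a b)"
    using assms by (subst emeasure_restrict_space) (auto intro!: emeasure_mono simp del: emeasure_completion)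
  also have "\<dots> < \<infinity>" by (simp add: emeasure_lborel_cbox_eq)
  finally have f: "emeasure (lebesgue_on \<Omega>) (\<Omega> \<inter> cbox a b) < \<infinity>" .
  have "integrable (lebesgue_on \<Omega>) (indicat_real (\<Omega> \<inter> cbox a b))"
    using f assms by (intro integrable_real_indicator) (auto simp: sets_restrict_space_iff)
  then have "integrable (lebesgue_on \<Omega>) (indicat_real (cbox a b))"
    by (rule Bochner_Integration.integrable_cong[THEN iffD1, rotated 2]) (auto simp: indicator_def)
  moreover have "(\<lambda>x. complex_of_real (indicator (cbox a b) x)) \<in> borel_measurable (lebesgue_on \<Omega>)"
    by (intro borel_measurable_lebesgue_onI) measurable
  ultimately show ?thesis unfolding sq_int_def e by simp
qed

text \<open>Sharpened bumps turn orthogonality to test functions into vanishing integrals over all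
  boxes with closure in \<open>\<Omega>\<close>; on each such box Dynkin's argument makes
  \<open>f\<close> vanish, and countably many closed boxes exhaust \<open>\<Omega>\<close>.\<close>

lemma fundamental_lemma:
  fixes f :: "'a::euclidean_space \<Rightarrow> complex"
  assumes \<Omega>: "open \<Omega>" and f: "sq_int (lebesgue_on \<Omega>) f"
    and ortho: "\<And>\<phi>. \<phi> \<in> test_functions \<Omega> \<Longrightarrow> (\<integral>x. f x * \<phi> x \<partial>lebesgue_on \<Omega>) = 0"
  shows "AE x in lebesgue_on \<Omega>. f x = 0"
proof -
  have S: "\<Omega> \<in> sets lebesgue" using \<Omega> by simp
  have mf[measurable]: "f \<in> borel_measurable (lebesgue_on \<Omega>)" using f by (rule sq_int_measurable)
  have loc: "AE x in lborel. x \<in> cbox a b \<longrightarrow> f x = 0" if ab: "cbox a b \<subseteq> \<Omega>" for a b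
  proof -
    have intc: "integrable (lebesgue_on \<Omega>) (\<lambda>x. f x * complex_of_real (indicator (cbox a b) x))"
      by (rule integrable_mult_sq_int[OF f sq_int_box_indicator[OF S]])
    have zero: "(\<integral>x. f x * complex_of_real (indicator (box c d) x) \<partial>lebesgue_on \<Omega>) = 0"
      if cd: "cbox c d \<subseteq> \<Omega>" for c d
    proof -
      have "(\<lambda>n. \<integral>x. f x * complex_of_real (bump (real (Suc n)) c d x) \<partial>lebesgue_on \<Omega>)
         \<longlonglongrightarrow> (\<integral>x. f x * complex_of_real (indicator (box c d) x) \<partial>lebesgue_on \<Omega>)"
      proof (rule integral_dominated_convergence)
        show "integrable (lebesgue_on \<Omega>) (\<lambda>x. cmod (f x * complex_of_real (indicator (cbox c d) x)))"
          by (intro integrable_norm integrable_mult_sq_int[OF f sq_int_box_indicator[OF S]])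
        show "(\<lambda>x. f x * complex_of_real (indicator (box c d) x)) \<in> borel_measurable (lebesgue_on \<Omega>)"
          by (intro borel_measurable_times mf borel_measurable_lebesgue_onI borel_measurable_of_real
                borel_measurable_indicator) simp
        show "(\<lambda>x. f x * complex_of_real (bump (real (Suc n)) c d x)) \<in> borel_measurable (lebesgue_on \<Omega>)" for n
          using test_functions_measurable[OF bump_test_function[OF _ cd, of "real (Suc n)"]]
          by (intro borel_measurable_times mf borel_measurable_lebesgue_onI) auto
        show "AE x in lebesgue_on \<Omega>. (\<lambda>n. f x * complex_of_real (bump (real (Suc n)) c d x))
            \<longlonglongrightarrow> f x * complex_of_real (indicator (box c d) x)"
          by (intro AE_I2 tendsto_intros bump_tendsto_indicator)
        show "AE x in lebesgue_on \<Omega>. norm (f x * complex_of_real (bump (real (Suc n)) c d x))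
            \<le> cmod (f x * complex_of_real (indicator (cbox c d) x))" for n
        proof (rule AE_I2)
          fix x
          have "bump (real (Suc n)) c d x \<le> indicator (cbox c d) x"
            using bump_bounds[of "real (Suc n)" c d x] bump_pos_iff[of "real (Suc n)" c d x] box_subset_cbox[of c d]
            by (auto simp: indicator_def not_less)
          then show "norm (f x * complex_of_real (bump (real (Suc n)) c d x))
            \<le> cmod (f x * complex_of_real (indicator (cbox c d) x))"
            using bump_bounds(1)[of "real (Suc n)" c d x] by (simp add: norm_mult mult_left_mono)
        qed
      qed
      moreover have "(\<integral>x. f x * complex_of_real (bump (real (Suc n)) c d x) \<partial>lebesgue_on \<Omega>) = 0" for n
        by (rule ortho[OF bump_test_function[OF _ cd]]) simp
      ultimately have "(\<lambda>n::nat. 0) \<longlonglongrightarrow> (\<integral>x. f x * complex_of_real (indicator (box c d) x) \<partial>lebesgue_on \<Omega>)"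
        by simp
      then show ?thesis using LIMSEQ_unique[OF tendsto_const] by metis
    qed
    define F where "F x = indicator (box a b) x *\<^sub>R f x" for x
    have boxO: "box a b \<subseteq> \<Omega>" using ab box_subset_cbox by blast
    have Feq: "F = (\<lambda>x. indicator \<Omega> x *\<^sub>R F x)" using boxO by (auto simp: F_def indicator_def fun_eq_iff)
    have "integrable (lebesgue_on \<Omega>) F"
    proof (rule Bochner_Integration.integrable_bound[OF intc])
      show "F \<in> borel_measurable (lebesgue_on \<Omega>)"
        unfolding F_def by (intro borel_measurable_scaleR mf borel_measurable_lebesgue_onI) measurable
      show "AE x in lebesgue_on \<Omega>. norm (F x) \<le> norm (f x * complex_of_real (indicator (cbox a b) x))"
        using box_subset_cbox by (intro AE_I2) (auto simp: F_def indicator_def)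
    qed
    then have iF: "integrable lebesgue F"
      using S Feq by (subst (asm) integrable_restrict_space) auto
    have mF: "F \<in> borel_measurable lebesgue" using iF by auto
    obtain g0 where g0: "g0 \<in> borel_measurable borel" "AE x in lborel. F x = g0 x"
      using borel_version_complex[OF mF] by blast
    define g where "g x = indicator (box a b) x *\<^sub>R g0 x" for x
    have gm[measurable]: "g \<in> borel_measurable borel" unfolding g_def using g0(1) by measurable
    have Fg: "AE x in lborel. F x = g x"
      using g0(2) by eventually_elim (auto simp: g_def F_def indicator_def)
    then have Fgc: "AE x in lebesgue. F x = g x" by (rule AE_completion)
    have "integrable lebesgue g"
      by (rule integrable_cong_AE_imp[OF iF]) (use Fgc in \<open>auto intro: measurable_completion\<close>)
    then have ig: "integrable lborel g" by (simp add: integrable_completion)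
    have "AE x in lborel. g x = 0"
    proof (rule AE_zero_of_box_integrals[OF ig])
      show "g x = 0" if "x \<notin> box a b" for x using that by (simp add: g_def)
      fix c d
      \<comment> \<open>\<open>zero\<close> applies only to boxes whose closure lies in
        \<open>\<Omega>\<close>. Intersecting an arbitrary box with \<open>box a b\<close> produces
        such a box, with these corners.\<close>
      define c' where "c' = (\<Sum>i\<in>Basis. max (a\<bullet>i) (c\<bullet>i) *\<^sub>R i)"
      define d' where "d' = (\<Sum>i\<in>Basis. min (b\<bullet>i) (d\<bullet>i) *\<^sub>R i)"
      have cd': "box a b \<inter> box c d = box c' d'" "cbox a b \<inter> cbox c d = cbox c' d'"
        by (simp_all add: box_Int_box Int_interval c'_def d'_def)
      have "set_lebesgue_integral lborel (box c d) g = (\<integral>x. indicator (box c d) x *\<^sub>R g x \<partial>lebesgue)"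
        unfolding set_lebesgue_integral_def by (subst integral_completion) auto
      also have "\<dots> = (\<integral>x. indicator (box c d) x *\<^sub>R F x \<partial>lebesgue)"
      proof (rule integral_cong_AE)
        show "AE x in lebesgue. indicator (box c d) x *\<^sub>R g x = indicator (box c d) x *\<^sub>R F x"
          using Fgc by eventually_elim simp
      next
        have i: "indicat_real (box c d) \<in> borel_measurable lebesgue"
          by (intro measurable_completion) simp
        have "g \<in> borel_measurable lebesgue" using gm by (intro measurable_completion) simp
        then show "(\<lambda>x. indicator (box c d) x *\<^sub>R g x) \<in> borel_measurable lebesgue"
          "(\<lambda>x. indicator (box c d) x *\<^sub>R F x) \<in> borel_measurable lebesgue"
          by (intro borel_measurable_scaleR[OF i] mF; simp)+
      qed
      also have "\<dots> = (\<integral>x. indicator \<Omega> x *\<^sub>R (f x * complex_of_real (indicator (box c' d') x)) \<partial>lebesgue)"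
        by (intro Bochner_Integration.integral_cong refl)
           (use boxO in \<open>auto simp: F_def indicator_def cd'(1)[symmetric]\<close>)
      also have "\<dots> = (\<integral>x. f x * complex_of_real (indicator (box c' d') x) \<partial>lebesgue_on \<Omega>)"
        using S by (subst integral_restrict_space) auto
      also have "\<dots> = 0" using zero[of c' d'] ab cd'(2) by blast
      finally show "set_lebesgue_integral lborel (box c d) g = 0" .
    qed
    moreover have "AE x in lborel. x \<notin> cbox a b - box a b"
      using null_sets_cbox_Diff_box by (rule AE_not_in)
    ultimately show ?thesis using Fg
      by eventually_elim (auto simp: F_def indicator_def split: if_splits)
  qed
  obtain \<D> where D: "countable \<D>" "\<D> \<subseteq> Pow \<Omega>" "\<And>X. X \<in> \<D> \<Longrightarrow> \<exists>a b. X = cbox a b" "\<Union>\<D> = \<Omega>"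
    using open_countable_Union_open_cbox[OF \<Omega>] by metis
  have "AE x in lborel. \<forall>X\<in>\<D>. x \<in> X \<longrightarrow> f x = 0"
  proof (rule AE_ball_countable[OF D(1), THEN iffD2], rule ballI)
    fix X assume X: "X \<in> \<D>"
    then obtain a b where "X = cbox a b" using D(3) by blast
    then show "AE x in lborel. x \<in> X \<longrightarrow> f x = 0" using loc[of a b] X D(2) by auto
  qed
  then have "AE x in lborel. x \<in> \<Omega> \<longrightarrow> f x = 0"
    using D(4) by (auto elim!: eventually_mono)
  then have "AE x in lebesgue. x \<in> \<Omega> \<longrightarrow> f x = 0" by (rule AE_completion)
  then show ?thesis using S by (simp add: AE_restrict_space_iff)
qed

subsection \<open>Weak derivatives and \<open>H\<^sub>0\<^sup>1\<close>\<close>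

text \<open>Since \<open>weak_partial\<close> is an arbitrary choice, every statement about its norm
  passes through this fact.\<close>

lemma has_weak_partial_unique:
  assumes \<Omega>: "open \<Omega>" and g: "has_weak_partial \<Omega> b f g" and h: "has_weak_partial \<Omega> b f h"
  shows "AE x in lebesgue_on \<Omega>. g x = h x"
proof -
  have sq: "sq_int (lebesgue_on \<Omega>) g" "sq_int (lebesgue_on \<Omega>) h"
    using g h by (auto simp: has_weak_partial_def mem_L2_iff)
  have "AE x in lebesgue_on \<Omega>. g x - h x = 0"
  proof (rule fundamental_lemma[OF \<Omega> sq_int_diff[OF sq]])
    fix \<phi> assume \<phi>: "\<phi> \<in> test_functions \<Omega>"
    have s\<phi>: "sq_int (lebesgue_on \<Omega>) \<phi>" using test_functions_sq_int[OF \<phi>] \<Omega> by simp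
    have "- (\<integral>x. g x * \<phi> x \<partial>lebesgue_on \<Omega>) = - (\<integral>x. h x * \<phi> x \<partial>lebesgue_on \<Omega>)"
      using g h \<phi> unfolding has_weak_partial_def by metis
    then show "(\<integral>x. (g x - h x) * \<phi> x \<partial>lebesgue_on \<Omega>) = 0"
      using integrable_mult_sq_int[OF sq(1) s\<phi>] integrable_mult_sq_int[OF sq(2) s\<phi>]
      by (simp add: left_diff_distrib)
  qed
  then show ?thesis by simp
qed

lemma has_weak_partial_weak_partial:
  assumes "has_weak_partial \<Omega> b f g" shows "has_weak_partial \<Omega> b f (weak_partial \<Omega> b f)"
  unfolding weak_partial_def using assms by (rule someI[of _ g])

lemma has_weak_partial_sq_int:
  assumes "has_weak_partial \<Omega> b f g"
  shows "sq_int (lebesgue_on \<Omega>) f" "sq_int (lebesgue_on \<Omega>) g"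
  using assms by (auto simp: has_weak_partial_def mem_L2_iff)

text \<open>Integration by parts: the product of two test functions is a test function, and the
  integral of its derivative vanishes.\<close>

lemma has_weak_partial_test:
  assumes \<phi>: "\<phi> \<in> test_functions \<Omega>" and S: "\<Omega> \<in> sets lebesgue" and b: "b \<in> Basis"
  shows "has_weak_partial \<Omega> b \<phi> (partial_deriv b \<phi>)"
  unfolding has_weak_partial_def mem_L2_iff
proof (intro conjI ballI)
  have d\<phi>: "partial_deriv b \<phi> \<in> test_functions \<Omega>" using test_functions_partial_deriv[OF \<phi> b] .
  show "sq_int (lebesgue_on \<Omega>) \<phi>" "sq_int (lebesgue_on \<Omega>) (partial_deriv b \<phi>)"
    using \<phi> d\<phi> S test_functions_sq_int by blast+
  fix \<eta> assume \<eta>: "\<eta> \<in> test_functions \<Omega>"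
  have d\<eta>: "partial_deriv b \<eta> \<in> test_functions \<Omega>" using test_functions_partial_deriv[OF \<eta> b] .
  have p: "(\<lambda>x. \<phi> x * partial_deriv b \<eta> x) \<in> test_functions \<Omega>"
    "(\<lambda>x. partial_deriv b \<phi> x * \<eta> x) \<in> test_functions \<Omega>"
    using test_functions_mult \<phi> \<eta> d\<phi> d\<eta> by blast+
  have red: "(\<integral>x. h x \<partial>lebesgue_on \<Omega>) = (\<integral>x. h x \<partial>lborel)" if "h \<in> test_functions \<Omega>" for h
    using that S test_functions_measurable test_functions_outside by (intro integral_lebesgue_on_eq) blast+
  have "0 = (\<integral>x. partial_deriv b (\<lambda>x. \<phi> x * \<eta> x) x \<partial>lborel)"
    using integral_partial_deriv_zero[OF test_functions_mult[OF \<phi> \<eta>] b] by simp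
  also have "\<dots> = (\<integral>x. \<phi> x * partial_deriv b \<eta> x + partial_deriv b \<phi> x * \<eta> x \<partial>lborel)"
    using \<phi> \<eta> by (simp add: partial_deriv_mult test_functions_differentiable)
  also have "\<dots> = (\<integral>x. \<phi> x * partial_deriv b \<eta> x \<partial>lborel) + (\<integral>x. partial_deriv b \<phi> x * \<eta> x \<partial>lborel)"
    using p by (intro Bochner_Integration.integral_add test_functions_integrable_lborel)
  finally show "(\<integral>x. \<phi> x * partial_deriv b \<eta> x \<partial>lebesgue_on \<Omega>) =
      - (\<integral>x. partial_deriv b \<phi> x * \<eta> x \<partial>lebesgue_on \<Omega>)"
    using red[OF p(1)] red[OF p(2)] by (simp add: eq_neg_iff_add_eq_0)
qed

lemma has_weak_partial_diff:
  assumes \<Omega>: "\<Omega> \<in> sets lebesgue" and b: "b \<in> Basis"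
    and f: "has_weak_partial \<Omega> b f f'" and g: "has_weak_partial \<Omega> b g g'"
  shows "has_weak_partial \<Omega> b (\<lambda>x. f x - g x) (\<lambda>x. f' x - g' x)"
  unfolding has_weak_partial_def mem_L2_iff
proof (intro conjI ballI)
  note s = has_weak_partial_sq_int[OF f] has_weak_partial_sq_int[OF g]
  show "sq_int (lebesgue_on \<Omega>) (\<lambda>x. f x - g x)" "sq_int (lebesgue_on \<Omega>) (\<lambda>x. f' x - g' x)"
    using s sq_int_diff by blast+
  fix \<phi> assume \<phi>: "\<phi> \<in> test_functions \<Omega>"
  have t: "sq_int (lebesgue_on \<Omega>) \<phi>" "sq_int (lebesgue_on \<Omega>) (partial_deriv b \<phi>)"
    using test_functions_sq_int \<phi> test_functions_partial_deriv[OF \<phi> b] \<Omega> by blast+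
  note i = integrable_mult_sq_int[OF s(1) t(2)] integrable_mult_sq_int[OF s(2) t(1)]
    integrable_mult_sq_int[OF s(3) t(2)] integrable_mult_sq_int[OF s(4) t(1)]
  show "(\<integral>x. (f x - g x) * partial_deriv b \<phi> x \<partial>lebesgue_on \<Omega>)
      = - (\<integral>x. (f' x - g' x) * \<phi> x \<partial>lebesgue_on \<Omega>)"
    using i f g \<phi> by (simp add: left_diff_distrib has_weak_partial_def)
qed

lemma H10_weak_partial:
  assumes "f \<in> H10 \<Omega>" "b \<in> Basis"
  shows "has_weak_partial \<Omega> b f (weak_partial \<Omega> b f)"
  using assms has_weak_partial_weak_partial unfolding H10_def H1_def by blast

lemma H10_sq_int: "f \<in> H10 \<Omega> \<Longrightarrow> sq_int (lebesgue_on \<Omega>) f"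
  by (simp add: H10_def H1_def mem_L2_iff)

text \<open>\<open>H1_norm\<close> of a difference involves a derivative chosen for that difference,
  which is not by definition the difference of the chosen derivatives. Uniqueness identifies the
  norms.\<close>

lemma nrm_weak_partial_diff_test:
  assumes \<Omega>: "open \<Omega>" and b: "b \<in> Basis" and f: "has_weak_partial \<Omega> b f g"
    and \<phi>: "\<phi> \<in> test_functions \<Omega>"
  shows "nrm (lebesgue_on \<Omega>) (weak_partial \<Omega> b (\<lambda>x. f x - \<phi> x))
       = nrm (lebesgue_on \<Omega>) (\<lambda>x. g x - partial_deriv b \<phi> x)"
proof -
  have S: "\<Omega> \<in> sets lebesgue" using \<Omega> by simp
  have w: "has_weak_partial \<Omega> b (\<lambda>x. f x - \<phi> x) (\<lambda>x. g x - partial_deriv b \<phi> x)"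
    by (rule has_weak_partial_diff[OF S b f has_weak_partial_test[OF \<phi> S b]])
  note w' = has_weak_partial_weak_partial[OF w]
  show ?thesis
    using has_weak_partial_unique[OF \<Omega> w' w] has_weak_partial_sq_int[OF w'] has_weak_partial_sq_int[OF w]
    by (intro nrm_AE_cong) (auto intro: sq_int_measurable)
qed

lemma H1_norm_sq: "(H1_norm \<Omega> f)\<^sup>2 = (nrm (lebesgue_on \<Omega>) f)\<^sup>2
    + (\<Sum>b\<in>Basis. (nrm (lebesgue_on \<Omega>) (weak_partial \<Omega> b f))\<^sup>2)"
  by (simp add: H1_norm_def grad_norm_def L2_norm_eq_nrm sum_nonneg)

lemma H10_approx:
  assumes \<Omega>: "open \<Omega>" and f: "f \<in> H10 \<Omega>" and e: "e > 0"
  obtains \<phi> where "\<phi> \<in> test_functions \<Omega>" "nrm (lebesgue_on \<Omega>) (\<lambda>x. f x - \<phi> x) < e"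
    "\<And>b. b \<in> Basis \<Longrightarrow> nrm (lebesgue_on \<Omega>) (\<lambda>x. weak_partial \<Omega> b f x - partial_deriv b \<phi> x) < e"
proof -
  obtain \<phi> where \<phi>: "\<phi> \<in> test_functions \<Omega>" and h: "H1_norm \<Omega> (\<lambda>x. f x - \<phi> x) < e"
    using f e unfolding H10_def by blast
  have H: "(H1_norm \<Omega> (\<lambda>x. f x - \<phi> x))\<^sup>2 < e\<^sup>2"
    using h by (intro power_strict_mono) (auto simp: H1_norm_def sum_nonneg)
  let ?w = "\<lambda>b. (nrm (lebesgue_on \<Omega>) (weak_partial \<Omega> b (\<lambda>x. f x - \<phi> x)))\<^sup>2"
  have "(nrm (lebesgue_on \<Omega>) (\<lambda>x. f x - \<phi> x))\<^sup>2 < e\<^sup>2"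
    using H sum_nonneg[of Basis ?w] unfolding H1_norm_sq by simp
  then have 1: "nrm (lebesgue_on \<Omega>) (\<lambda>x. f x - \<phi> x) < e" by (rule power2_less_imp_less) (use e in auto)
  have 2: "nrm (lebesgue_on \<Omega>) (\<lambda>x. weak_partial \<Omega> b f x - partial_deriv b \<phi> x) < e" if b: "b \<in> Basis" for b
  proof -
    have "?w b \<le> sum ?w Basis" using b by (intro member_le_sum) auto
    then have "?w b < e\<^sup>2" using H zero_le_power2[of "nrm (lebesgue_on \<Omega>) (\<lambda>x. f x - \<phi> x)"]
      unfolding H1_norm_sq by linarith
    then have "nrm (lebesgue_on \<Omega>) (weak_partial \<Omega> b (\<lambda>x. f x - \<phi> x)) < e"
      by (rule power2_less_imp_less) (use e in auto)
    then show ?thesis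
      using nrm_weak_partial_diff_test[OF \<Omega> b H10_weak_partial[OF f b] \<phi>] by simp
  qed
  show ?thesis using that \<phi> 1 2 by blast
qed

text \<open>Both sides of the integration-by-parts formula are continuous in L2. A simultaneous L2
  limit of test functions and of their gradients therefore has the limit gradient as weak
  gradient.\<close>

lemma H10I:
  assumes \<Omega>: "open \<Omega>" and f: "sq_int (lebesgue_on \<Omega>) f"
    and g: "\<And>b. b \<in> Basis \<Longrightarrow> sq_int (lebesgue_on \<Omega>) (g b)"
    and approx: "\<And>e. e > 0 \<Longrightarrow> \<exists>\<phi>\<in>test_functions \<Omega>. nrm (lebesgue_on \<Omega>) (\<lambda>x. f x - \<phi> x) < e \<and>
       (\<forall>b\<in>Basis. nrm (lebesgue_on \<Omega>) (\<lambda>x. g b x - partial_deriv b \<phi> x) < e)"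
  shows "f \<in> H10 \<Omega>" and "b \<in> Basis \<Longrightarrow> has_weak_partial \<Omega> b f (g b)"
proof -
  have S: "\<Omega> \<in> sets lebesgue" using \<Omega> by simp
  have wp: "has_weak_partial \<Omega> b f (g b)" if b: "b \<in> Basis" for b
    unfolding has_weak_partial_def mem_L2_iff
  proof (intro conjI ballI f g[OF b])
    fix \<eta> assume \<eta>: "\<eta> \<in> test_functions \<Omega>"
    have t: "sq_int (lebesgue_on \<Omega>) \<eta>" "sq_int (lebesgue_on \<Omega>) (partial_deriv b \<eta>)"
      using test_functions_sq_int \<eta> test_functions_partial_deriv[OF \<eta> b] S by blast+
    \<comment> \<open>The defect in integration by parts. Subtracting the same expression for an
      approximating test function, which is zero, leaves only small factors.\<close>
    define d where "d = (\<integral>x. f x * partial_deriv b \<eta> x \<partial>lebesgue_on \<Omega>) + (\<integral>x. g b x * \<eta> x \<partial>lebesgue_on \<Omega>)"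
    define C where "C = nrm (lebesgue_on \<Omega>) (partial_deriv b \<eta>) + nrm (lebesgue_on \<Omega>) \<eta>"
    have "cmod d \<le> e * C" if e: "e > 0" for e
    proof -
      obtain \<phi> where \<phi>: "\<phi> \<in> test_functions \<Omega>" "nrm (lebesgue_on \<Omega>) (\<lambda>x. f x - \<phi> x) < e"
        "nrm (lebesgue_on \<Omega>) (\<lambda>x. g b x - partial_deriv b \<phi> x) < e"
        using approx[OF e] b by blast
      note w = has_weak_partial_test[OF \<phi>(1) S b]
      note s\<phi> = has_weak_partial_sq_int[OF w]
      have "(\<integral>x. \<phi> x * partial_deriv b \<eta> x \<partial>lebesgue_on \<Omega>) + (\<integral>x. partial_deriv b \<phi> x * \<eta> x \<partial>lebesgue_on \<Omega>) = 0"
        using w \<eta> by (simp add: has_weak_partial_def)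
      then have "d = (\<integral>x. (f x - \<phi> x) * partial_deriv b \<eta> x \<partial>lebesgue_on \<Omega>)
           + (\<integral>x. (g b x - partial_deriv b \<phi> x) * \<eta> x \<partial>lebesgue_on \<Omega>)"
        using integrable_mult_sq_int[OF f t(2)] integrable_mult_sq_int[OF s\<phi>(1) t(2)]
          integrable_mult_sq_int[OF g[OF b] t(1)] integrable_mult_sq_int[OF s\<phi>(2) t(1)]
        by (simp add: d_def left_diff_distrib algebra_simps)
      also have "cmod \<dots> \<le> cmod (\<integral>x. (f x - \<phi> x) * partial_deriv b \<eta> x \<partial>lebesgue_on \<Omega>)
           + cmod (\<integral>x. (g b x - partial_deriv b \<phi> x) * \<eta> x \<partial>lebesgue_on \<Omega>)"
        by (rule norm_triangle_ineq)
      also have "\<dots> \<le> nrm (lebesgue_on \<Omega>) (\<lambda>x. f x - \<phi> x) * nrm (lebesgue_on \<Omega>) (partial_deriv b \<eta>)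
         + nrm (lebesgue_on \<Omega>) (\<lambda>x. g b x - partial_deriv b \<phi> x) * nrm (lebesgue_on \<Omega>) \<eta>"
        using t s\<phi> f g[OF b] by (intro add_mono CS_integral sq_int_diff)
      also have "\<dots> \<le> e * C"
        unfolding C_def distrib_left using \<phi> by (intro add_mono mult_right_mono) auto
      finally show ?thesis .
    qed
    note dC = this
    have "C \<ge> 0" by (simp add: C_def)
    have "cmod d \<le> 0 + e" if "e > 0" for e
    proof -
      have "0 < e / (C + 1)" using \<open>C \<ge> 0\<close> that by simp
      then have "cmod d \<le> e / (C + 1) * C" by (rule dC)
      also have "\<dots> \<le> e" using \<open>C \<ge> 0\<close> that by (simp add: field_simps)
      finally show ?thesis by simp
    qed
    then have "d = 0" using field_le_epsilon[of "cmod d" 0] by simp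
    then show "(\<integral>x. f x * partial_deriv b \<eta> x \<partial>lebesgue_on \<Omega>) = - (\<integral>x. g b x * \<eta> x \<partial>lebesgue_on \<Omega>)"
      by (simp add: d_def eq_neg_iff_add_eq_0)
  qed
  then show "b \<in> Basis \<Longrightarrow> has_weak_partial \<Omega> b f (g b)" .
  have "\<exists>\<phi>\<in>test_functions \<Omega>. H1_norm \<Omega> (\<lambda>x. f x - \<phi> x) < e" if e: "e > 0" for e
  proof -
    \<comment> \<open>The number of squares in the \<open>H1_norm\<close>: one for the function and
      one for each partial derivative.\<close>
    define D where "D = real (DIM('a)) + 1"
    have D: "D > 1" by (simp add: D_def)
    obtain \<phi> where \<phi>: "\<phi> \<in> test_functions \<Omega>" "nrm (lebesgue_on \<Omega>) (\<lambda>x. f x - \<phi> x) < e / D"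
        "\<And>b. b \<in> Basis \<Longrightarrow> nrm (lebesgue_on \<Omega>) (\<lambda>x. g b x - partial_deriv b \<phi> x) < e / D"
      using approx[OF divide_pos_pos[OF e, of D]] D by auto
    have "(H1_norm \<Omega> (\<lambda>x. f x - \<phi> x))\<^sup>2 = (nrm (lebesgue_on \<Omega>) (\<lambda>x. f x - \<phi> x))\<^sup>2
       + (\<Sum>b\<in>Basis. (nrm (lebesgue_on \<Omega>) (\<lambda>x. g b x - partial_deriv b \<phi> x))\<^sup>2)"
      unfolding H1_norm_sq using nrm_weak_partial_diff_test[OF \<Omega> _ wp \<phi>(1)] by simp
    also have "\<dots> < (e / D)\<^sup>2 + (\<Sum>b\<in>(Basis::'a set). (e / D)\<^sup>2)"
      using \<phi> by (intro add_less_le_mono sum_mono power_mono power_strict_mono) (auto intro: less_imp_le)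
    also have "\<dots> = D * (e / D)\<^sup>2" by (simp add: D_def algebra_simps)
    also have "\<dots> = e\<^sup>2 / D" using D by (simp add: power2_eq_square)
    also have "\<dots> \<le> e\<^sup>2" using D e by (simp add: field_simps)
    finally have "H1_norm \<Omega> (\<lambda>x. f x - \<phi> x) < e" by (rule power2_less_imp_less) (use e in auto)
    then show ?thesis using \<phi>(1) by blast
  qed
  then show "f \<in> H10 \<Omega>"
    using f wp by (auto simp: H10_def H1_def mem_L2_iff)
qed

subsection \<open>Rellich compactness\<close>

lemma test_functions_chain:
  assumes \<phi>: "\<phi> \<in> test_functions \<Omega>" and \<gamma>: "(\<gamma> has_vector_derivative v) (at s)"
  shows "((\<lambda>s. \<phi> (\<gamma> s)) has_vector_derivative
     (\<Sum>e\<in>Basis. complex_of_real (v \<bullet> e) * partial_deriv e \<phi> (\<gamma> s))) (at s)"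
proof -
  note d = test_functions_differentiable[OF \<phi>]
  have "((\<lambda>s. \<phi> (\<gamma> s)) has_derivative (\<lambda>h. frechet_derivative \<phi> (at (\<gamma> s)) (h *\<^sub>R v))) (at s)"
    using diff_chain_at[OF \<gamma>[unfolded has_vector_derivative_def] differentiable_has_derivative[OF d]]
    by (simp add: o_def)
  then show ?thesis
    by (simp add: has_vector_derivative_def linear_partial_deriv_expand[OF d] scaleR_conv_of_real
        sum_distrib_left mult.assoc)
qed

lemma nn_integral_lborel_pair:
  fixes f :: "'a::euclidean_space \<times> 'b::euclidean_space \<Rightarrow> ennreal"
  assumes "f \<in> borel_measurable borel"
  shows "(\<integral>\<^sup>+z. f z \<partial>lborel) = (\<integral>\<^sup>+x. \<integral>\<^sup>+y. f (x, y) \<partial>lborel \<partial>lborel)"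
    and nn_integral_lborel_pair_swap:
      "(\<integral>\<^sup>+z. f z \<partial>lborel) = (\<integral>\<^sup>+y. \<integral>\<^sup>+x. f (x, y) \<partial>lborel \<partial>lborel)"
proof -
  have m: "f \<in> borel_measurable (lborel \<Otimes>\<^sub>M lborel)"
    using assms by (simp add: lborel_prod)
  show "(\<integral>\<^sup>+z. f z \<partial>lborel) = (\<integral>\<^sup>+x. \<integral>\<^sup>+y. f (x, y) \<partial>lborel \<partial>lborel)"
    using lborel.nn_integral_fst[OF m] by (simp add: lborel_prod)
  show "(\<integral>\<^sup>+z. f z \<partial>lborel) = (\<integral>\<^sup>+y. \<integral>\<^sup>+x. f (x, y) \<partial>lborel \<partial>lborel)"
    using lborel_pair.nn_integral_snd[OF m] by (simp add: lborel_prod)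
qed

text \<open>
  Squared increments are bounded by testing against the increment \<open>w\<close> itself:
  \<open>|w|\<^sup>2 = \<integral> Re (w\<^sup>* u') \<le> |w|\<^sup>2 / 2 + (b - a) / 2 \<cdot> \<integral> |u'|\<^sup>2\<close>.
\<close>

lemma increment_sq_le:
  fixes u :: "real \<Rightarrow> complex"
  assumes u: "\<And>s. (u has_vector_derivative u' s) (at s)" and c: "continuous_on UNIV u'"
    and x: "x \<in> {a..<b}" and t: "t \<in> {a..<b}"
  shows "ennreal ((cmod (u x - u t))\<^sup>2) \<le> ennreal (b - a) * (\<integral>\<^sup>+s\<in>{a..<b}. ennreal ((cmod (u' s))\<^sup>2) \<partial>lborel)"
proof -
  have main: "(cmod (u x - u t))\<^sup>2 \<le> (b - a) * integral {a..b} (\<lambda>s. (cmod (u' s))\<^sup>2)"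
    if "x \<in> {a..<b}" "t \<in> {a..<b}" "t \<le> x" for x t
  proof -
    define w where "w = u x - u t"
    define l where "l = b - a"
    have l: "l > 0" using that by (simp add: l_def)
    have cu: "continuous_on S u'" for S using c continuous_on_subset by blast
    have i1: "(u' has_integral w) {t..x}"
      unfolding w_def using u that(3)
      by (intro fundamental_theorem_of_calculus) (auto intro: has_vector_derivative_at_within)
    have i2: "((\<lambda>s. Re (cnj w * u' s)) has_integral Re (cnj w * w)) {t..x}"
      using has_integral_linear[OF i1 bounded_linear_compose[OF bounded_linear_Re bounded_linear_mult_right[of "cnj w"]]]
      by (simp add: o_def)
    have io: "(\<lambda>s. (cmod (u' s))\<^sup>2) integrable_on {c..d}" for c d
      using cu by (intro integrable_continuous_real continuous_intros)
    have i3: "((\<lambda>s. (cmod w)\<^sup>2 / (2 * l) + l / 2 * (cmod (u' s))\<^sup>2) has_integral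
        (x - t) * ((cmod w)\<^sup>2 / (2 * l)) + l / 2 * integral {t..x} (\<lambda>s. (cmod (u' s))\<^sup>2)) {t..x}"
      using has_integral_add[OF has_integral_const_real[of "(cmod w)\<^sup>2 / (2 * l)" t x]
          has_integral_mult_right[OF integrable_integral[OF io[of t x]], of "l / 2"]] that(3)
      by simp
    have "Re (cnj w * w) \<le> (x - t) * ((cmod w)\<^sup>2 / (2 * l)) + l / 2 * integral {t..x} (\<lambda>s. (cmod (u' s))\<^sup>2)"
    proof (rule has_integral_le[OF i2 i3])
      fix s
      have "Re (cnj w * u' s) \<le> cmod w * cmod (u' s)"
        using complex_Re_le_cmod[of "cnj w * u' s"] by (simp add: norm_mult)
      moreover have "2 * l * (cmod w * cmod (u' s)) \<le> (cmod w)\<^sup>2 + l\<^sup>2 * (cmod (u' s))\<^sup>2"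
        using sum_squares_bound[of "cmod w" "l * cmod (u' s)"] by (simp add: power_mult_distrib algebra_simps)
      then have "cmod w * cmod (u' s) \<le> ((cmod w)\<^sup>2 + l\<^sup>2 * (cmod (u' s))\<^sup>2) / (2 * l)"
        using l by (simp add: pos_le_divide_eq mult.commute mult.left_commute)
      ultimately show "Re (cnj w * u' s) \<le> (cmod w)\<^sup>2 / (2 * l) + l / 2 * (cmod (u' s))\<^sup>2"
        using l by (simp add: add_divide_distrib power2_eq_square)
    qed
    also have "(x - t) * ((cmod w)\<^sup>2 / (2 * l)) \<le> l * ((cmod w)\<^sup>2 / (2 * l))"
      using that l by (intro mult_right_mono) (auto simp: l_def)
    also have "l * ((cmod w)\<^sup>2 / (2 * l)) = (cmod w)\<^sup>2 / 2" using l by simp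
    also have "integral {t..x} (\<lambda>s. (cmod (u' s))\<^sup>2) \<le> integral {a..b} (\<lambda>s. (cmod (u' s))\<^sup>2)"
      using that by (intro integral_subset_le io) auto
    finally have "Re (cnj w * w) \<le> (cmod w)\<^sup>2 / 2 + l / 2 * integral {a..b} (\<lambda>s. (cmod (u' s))\<^sup>2)"
      using l by simp
    moreover have "Re (cnj w * w) = (cmod w)\<^sup>2"
      by (simp only: cmod_power2) (simp add: power2_eq_square)
    ultimately show ?thesis by (simp add: w_def l_def)
  qed
  have xt: "(cmod (u x - u t))\<^sup>2 \<le> (b - a) * integral {a..b} (\<lambda>s. (cmod (u' s))\<^sup>2)"
    using main[OF x t] main[OF t x] by (cases "t \<le> x") (auto simp: norm_minus_commute)
  have ii: "((\<lambda>s. (cmod (u' s))\<^sup>2) has_integral integral {a..b} (\<lambda>s. (cmod (u' s))\<^sup>2)) {a..b}"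
    using c continuous_on_subset
    by (intro integrable_integral integrable_continuous_real continuous_intros) blast
  have "(\<integral>\<^sup>+s\<in>{a..<b}. ennreal ((cmod (u' s))\<^sup>2) \<partial>lborel) = (\<integral>\<^sup>+s\<in>{a..b}. ennreal ((cmod (u' s))\<^sup>2) \<partial>lborel)"
  proof (rule nn_integral_cong_AE)
    have "AE s in lborel. s \<noteq> b" by (rule AE_lborel_singleton)
    then show "AE s in lborel. ennreal ((cmod (u' s))\<^sup>2) * indicator {a..<b} s
        = ennreal ((cmod (u' s))\<^sup>2) * indicator {a..b} s"
      by eventually_elim (auto simp: indicator_def)
  qed
  also have "\<dots> = ennreal (integral {a..b} (\<lambda>s. (cmod (u' s))\<^sup>2))"
    by (rule nn_integral_has_integral_lebesgue'[OF _ ii]) simp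
  finally show ?thesis
    using xt x by (simp add: ennreal_mult[symmetric] integral_nonneg has_integral_integrable[OF ii] ennreal_leI)
qed

text \<open>Expand the square with the real inner product of the plane; the mixed term integrates to
  the squared integral of \<open>f\<close>. Bounds on increments thereby become bounds on the L2
  norm up to the mean.\<close>

lemma nn_integral_variance:
  assumes M: "finite_measure M" and f: "sq_int M f"
  shows "(\<integral>\<^sup>+p. \<integral>\<^sup>+q. ennreal ((cmod (f p - f q))\<^sup>2) \<partial>M \<partial>M)
     = ennreal (2 * measure M (space M) * (\<integral>x. (cmod (f x))\<^sup>2 \<partial>M) - 2 * (cmod (\<integral>x. f x \<partial>M))\<^sup>2)"
proof -
  interpret finite_measure M by (rule M)
  have [measurable]: "f \<in> borel_measurable M" using f by (rule sq_int_measurable)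
  have "sq_int M (\<lambda>x. 1)" by (simp add: sq_int_def)
  from integrable_mult_sq_int[OF f this] have i: "integrable M f" by simp
  have i2: "integrable M (\<lambda>x. (cmod (f x))\<^sup>2)" using f by (rule sq_int_integrable)
  define \<mu> n \<Phi> where "\<mu> = measure M (space M)" and "n = (\<integral>x. (cmod (f x))\<^sup>2 \<partial>M)" and "\<Phi> = (\<integral>x. f x \<partial>M)"
  have ex: "(cmod (a - b))\<^sup>2 = (cmod a)\<^sup>2 - 2 * (a \<bullet> b) + (cmod b)\<^sup>2" for a b
    by (simp add: power2_norm_eq_inner inner_diff_left inner_diff_right inner_commute)
  have iR: "integrable M (\<lambda>q. c \<bullet> f q)" "(\<integral>q. c \<bullet> f q \<partial>M) = c \<bullet> \<Phi>" for c
    using i by (simp_all add: \<Phi>_def)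
  have inner: "(\<integral>\<^sup>+q. ennreal ((cmod (f p - f q))\<^sup>2) \<partial>M) = ennreal (\<mu> * (cmod (f p))\<^sup>2 - 2 * (f p \<bullet> \<Phi>) + n)" for p
  proof -
    have "integrable M (\<lambda>q. (cmod (f p - f q))\<^sup>2)"
      unfolding ex using iR(1)[of "f p"] i2 by (intro Bochner_Integration.integrable_add Bochner_Integration.integrable_diff) auto
    then have "(\<integral>\<^sup>+q. ennreal ((cmod (f p - f q))\<^sup>2) \<partial>M) = ennreal (\<integral>q. (cmod (f p - f q))\<^sup>2 \<partial>M)"
      by (intro nn_integral_eq_integral) auto
    also have "(\<integral>q. (cmod (f p - f q))\<^sup>2 \<partial>M) = \<mu> * (cmod (f p))\<^sup>2 - 2 * (f p \<bullet> \<Phi>) + n"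
      unfolding ex using iR[of "f p"] i2
      by (subst Bochner_Integration.integral_add, simp, simp, subst Bochner_Integration.integral_diff)
         (simp_all add: \<mu>_def n_def)
    finally show ?thesis .
  qed
  have nn: "0 \<le> \<mu> * (cmod (f p))\<^sup>2 - 2 * (f p \<bullet> \<Phi>) + n" for p
  proof -
    have "0 \<le> (\<integral>q. (cmod (f p - f q))\<^sup>2 \<partial>M)" by simp
    also have "\<dots> = \<mu> * (cmod (f p))\<^sup>2 - 2 * (f p \<bullet> \<Phi>) + n"
      unfolding ex using iR[of "f p"] i2
      by (subst Bochner_Integration.integral_add, simp, simp, subst Bochner_Integration.integral_diff)
         (simp_all add: \<mu>_def n_def)
    finally show ?thesis .
  qed
  have iR': "integrable M (\<lambda>p. f p \<bullet> \<Phi>)" "(\<integral>p. f p \<bullet> \<Phi> \<partial>M) = \<Phi> \<bullet> \<Phi>"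
    using i by (simp_all add: \<Phi>_def)
  have "(\<integral>\<^sup>+p. ennreal (\<mu> * (cmod (f p))\<^sup>2 - 2 * (f p \<bullet> \<Phi>) + n) \<partial>M)
      = ennreal (\<integral>p. \<mu> * (cmod (f p))\<^sup>2 - 2 * (f p \<bullet> \<Phi>) + n \<partial>M)"
    using nn iR'(1) i2 by (intro nn_integral_eq_integral) auto
  also have "(\<integral>p. \<mu> * (cmod (f p))\<^sup>2 - 2 * (f p \<bullet> \<Phi>) + n \<partial>M) = \<mu> * n - 2 * (\<Phi> \<bullet> \<Phi>) + \<mu> * n"
    using iR' i2
    by (subst Bochner_Integration.integral_add, simp, simp, subst Bochner_Integration.integral_diff)
       (simp_all add: \<mu>_def n_def)
  also have "(\<Phi> \<bullet> \<Phi>) = (cmod \<Phi>)\<^sup>2" by (simp add: power2_norm_eq_inner)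
  finally show ?thesis unfolding inner by (simp add: \<mu>_def n_def \<Phi>_def mult.assoc)
qed

section \<open>Poincare inequality on squares and on a grid\<close>

abbreviation e1 :: "real \<times> real" where "e1 \<equiv> (1, 0)"
abbreviation e2 :: "real \<times> real" where "e2 \<equiv> (0, 1)"

lemma Basis_real_pair: "(Basis :: (real \<times> real) set) = {e1, e2}"
  by (auto simp: Basis_prod_def)

lemma sum_Basis_real_pair: "(\<Sum>b\<in>(Basis :: (real \<times> real) set). f b) = f e1 + f e2"
  by (simp add: Basis_real_pair)

text \<open>
  Connect two points of the square by an axis-parallel path, integrate the squared increment over
  both points and use the variance identity.
\<close>

lemma poincare_square:
  fixes \<phi> :: "real \<times> real \<Rightarrow> complex" and a b l :: real
  assumes \<phi>: "\<phi> \<in> test_functions \<Omega>" and l: "l > 0"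
  defines "Q \<equiv> {a..<a+l} \<times> {b..<b+l}"
  shows "(\<integral>p\<in>Q. (cmod (\<phi> p))\<^sup>2 \<partial>lborel) \<le> l\<^sup>2 * (\<integral>p\<in>Q. (\<Sum>e\<in>Basis. (cmod (partial_deriv e \<phi> p))\<^sup>2) \<partial>lborel)
     + (cmod (\<integral>p\<in>Q. \<phi> p \<partial>lborel))\<^sup>2 / l\<^sup>2"
proof -
  define I J where "I = {a..<a+l}" and "J = {b..<b+l}"
  have Q: "Q = I \<times> J" by (simp add: Q_def I_def J_def)
  have IJ[measurable]: "I \<in> sets borel" "J \<in> sets borel" by (auto simp: I_def J_def)
  have Qm[measurable]: "Q \<in> sets borel" unfolding Q by (simp add: borel_Times)
  have eI: "emeasure lborel I = ennreal l" "emeasure lborel J = ennreal l" using l by (auto simp: I_def J_def)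
  have emQ: "emeasure lborel Q = ennreal (l\<^sup>2)"
  proof -
    have "emeasure lborel Q = emeasure lborel I * emeasure lborel J"
      unfolding Q lborel_prod[symmetric] by (rule lborel.emeasure_pair_measure_Times) auto
    also have "\<dots> = ennreal (l\<^sup>2)" using eI l by (simp add: ennreal_mult power2_eq_square)
    finally show ?thesis .
  qed
  then have mul: "measure lborel Q = l\<^sup>2" by (simp add: measure_def)
  have d: "partial_deriv e1 \<phi> \<in> test_functions \<Omega>" "partial_deriv e2 \<phi> \<in> test_functions \<Omega>"
    using test_functions_partial_deriv[OF \<phi>] by (auto simp: Basis_real_pair)
  have [measurable]: "\<phi> \<in> borel_measurable borel" "partial_deriv e1 \<phi> \<in> borel_measurable borel"
     "partial_deriv e2 \<phi> \<in> borel_measurable borel"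
    using \<phi> d test_functions_measurable by blast+
  define K1 where "K1 y = (\<integral>\<^sup>+s\<in>I. ennreal ((cmod (partial_deriv e1 \<phi> (s, y)))\<^sup>2) \<partial>lborel)" for y
  define K2 where "K2 x = (\<integral>\<^sup>+t\<in>J. ennreal ((cmod (partial_deriv e2 \<phi> (x, t)))\<^sup>2) \<partial>lborel)" for x
  have [measurable]: "K1 \<in> borel_measurable borel" "K2 \<in> borel_measurable borel"
    unfolding K1_def K2_def by measurable
  have mK: "(\<lambda>p. K1 (snd p)) \<in> borel_measurable borel" "(\<lambda>p. K2 (fst p)) \<in> borel_measurable borel"
    by (rule measurable_compose[OF borel_measurable_continuous_onI], auto intro!: continuous_intros)+
  have mQ: "(\<lambda>p. f p * indicator Q p) \<in> borel_measurable borel" if "f \<in> borel_measurable borel" for f :: "real \<times> real \<Rightarrow> ennreal"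
    using that Qm by (intro borel_measurable_times_ennreal borel_measurable_indicator) auto
  have mD: "(\<lambda>p. ennreal ((cmod (\<psi> p))\<^sup>2) * indicator Q p) \<in> borel_measurable borel"
    if "\<psi> \<in> borel_measurable borel" for \<psi>
    using that by (intro mQ) measurable
  define D1 where "D1 = (\<integral>\<^sup>+y\<in>J. K1 y \<partial>lborel)"
  define D2 where "D2 = (\<integral>\<^sup>+x\<in>I. K2 x \<partial>lborel)"
  \<comment> \<open>The horizontal leg runs at the height of \<open>p\<close>, the vertical leg at
    the abscissa of \<open>q\<close>. The bound thus splits into a function of \<open>p\<close>
    alone and one of \<open>q\<close> alone.\<close>
  have pw: "ennreal ((cmod (\<phi> p - \<phi> q))\<^sup>2) \<le> 2 * ennreal l * (K1 (snd p) + K2 (fst q))" if pq: "p \<in> Q" "q \<in> Q" for p q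
  proof -
    obtain x y x' y' where p: "p = (x, y)" and q: "q = (x', y')" by fastforce
    have in': "x \<in> I" "x' \<in> I" "y \<in> J" "y' \<in> J" using pq by (auto simp: p q Q)
    have h1: "((\<lambda>s. \<phi> (s, y)) has_vector_derivative partial_deriv e1 \<phi> (s, y)) (at s)" for s
    proof -
      have "((\<lambda>s. (s, y)) has_vector_derivative e1) (at s)"
        by (auto intro!: derivative_eq_intros has_vector_derivative_Pair)
      from test_functions_chain[OF \<phi> this] show ?thesis by (simp add: sum_Basis_real_pair)
    qed
    have h2: "((\<lambda>t. \<phi> (x', t)) has_vector_derivative partial_deriv e2 \<phi> (x', t)) (at t)" for t
    proof -
      have "((\<lambda>t. (x', t)) has_vector_derivative e2) (at t)"
        by (auto intro!: derivative_eq_intros has_vector_derivative_Pair)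
      from test_functions_chain[OF \<phi> this] show ?thesis by (simp add: sum_Basis_real_pair)
    qed
    have c: "continuous_on UNIV (\<lambda>s. partial_deriv e1 \<phi> (s, y))" "continuous_on UNIV (\<lambda>t. partial_deriv e2 \<phi> (x', t))"
      by (rule continuous_on_compose2[OF test_functions_continuous[OF d(1)]],
          auto intro!: continuous_intros)
         (rule continuous_on_compose2[OF test_functions_continuous[OF d(2)]],
          auto intro!: continuous_intros)
    have b1: "ennreal ((cmod (\<phi> (x, y) - \<phi> (x', y)))\<^sup>2) \<le> ennreal l * K1 y"
      using increment_sq_le[OF h1 c(1), of x a "a + l" x'] in' by (simp add: K1_def I_def)
    have b2: "ennreal ((cmod (\<phi> (x', y) - \<phi> (x', y')))\<^sup>2) \<le> ennreal l * K2 x'"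
      using increment_sq_le[OF h2 c(2), of y b "b + l" y'] in' by (simp add: K2_def J_def)
    have "(cmod (\<phi> p - \<phi> q))\<^sup>2 \<le> 2 * (cmod (\<phi> (x, y) - \<phi> (x', y)))\<^sup>2 + 2 * (cmod (\<phi> (x', y) - \<phi> (x', y')))\<^sup>2"
      using cmod_add_sq_le[of "\<phi> (x, y) - \<phi> (x', y)" "\<phi> (x', y) - \<phi> (x', y')"] by (simp add: p q)
    then have "ennreal ((cmod (\<phi> p - \<phi> q))\<^sup>2) \<le> ennreal (2 * (cmod (\<phi> (x, y) - \<phi> (x', y)))\<^sup>2 + 2 * (cmod (\<phi> (x', y) - \<phi> (x', y')))\<^sup>2)"
      by (rule ennreal_leI)
    also have "\<dots> = 2 * (ennreal ((cmod (\<phi> (x, y) - \<phi> (x', y)))\<^sup>2) + ennreal ((cmod (\<phi> (x', y) - \<phi> (x', y')))\<^sup>2))"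
      by (simp add: ennreal_mult distrib_left)
    also have "\<dots> \<le> 2 * (ennreal l * K1 y + ennreal l * K2 x')"
      using b1 b2 by (intro mult_left_mono add_mono) auto
    finally show ?thesis by (simp add: p q distrib_left mult.assoc)
  qed
  have iK: "(\<integral>\<^sup>+q\<in>Q. K2 (fst q) \<partial>lborel) = ennreal l * D2" "(\<integral>\<^sup>+p\<in>Q. K1 (snd p) \<partial>lborel) = ennreal l * D1"
  proof -
    have "(\<integral>\<^sup>+q\<in>Q. K2 (fst q) \<partial>lborel) = (\<integral>\<^sup>+x. \<integral>\<^sup>+y. K2 x * indicator I x * indicator J y \<partial>lborel \<partial>lborel)"
      by (subst nn_integral_lborel_pair[OF mQ[OF mK(2)]]) (simp add: Q indicator_times mult.assoc)
    also have "\<dots> = (\<integral>\<^sup>+x. K2 x * indicator I x * ennreal l \<partial>lborel)"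
      by (simp add: nn_integral_cmult eI)
    finally show "(\<integral>\<^sup>+q\<in>Q. K2 (fst q) \<partial>lborel) = ennreal l * D2"
      by (simp add: nn_integral_multc D2_def mult.commute[of _ "ennreal l"] nn_integral_cmult)
    have "(\<integral>\<^sup>+q\<in>Q. K1 (snd q) \<partial>lborel) = (\<integral>\<^sup>+y. \<integral>\<^sup>+x. K1 y * indicator J y * indicator I x \<partial>lborel \<partial>lborel)"
      by (subst nn_integral_lborel_pair_swap[OF mQ[OF mK(1)]]) (simp add: Q indicator_times mult_ac)
    also have "\<dots> = (\<integral>\<^sup>+y. K1 y * indicator J y * ennreal l \<partial>lborel)"
      by (simp add: nn_integral_cmult eI)
    finally show "(\<integral>\<^sup>+p\<in>Q. K1 (snd p) \<partial>lborel) = ennreal l * D1"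
      by (simp add: nn_integral_multc D1_def mult.commute[of _ "ennreal l"] nn_integral_cmult)
  qed
  define M where "M = restrict_space lborel Q"
  have nnM: "(\<integral>\<^sup>+x. f x \<partial>M) = (\<integral>\<^sup>+x\<in>Q. f x \<partial>lborel)" for f
    unfolding M_def by (simp add: nn_integral_restrict_space)
  note iM = iK[folded nnM]
  have spM: "space M = Q" by (simp add: M_def space_restrict_space)
  have fM: "finite_measure M"
    by (rule finite_measureI) (simp add: spM, simp add: M_def emeasure_restrict_space emQ)
  have meM: "measure M (space M) = l\<^sup>2" "emeasure M (space M) = ennreal (l\<^sup>2)"
    unfolding spM by (simp_all add: M_def measure_restrict_space mul emeasure_restrict_space emQ)
  have [measurable]: "(\<lambda>p. K1 (snd p)) \<in> borel_measurable M" "(\<lambda>p. K2 (fst p)) \<in> borel_measurable M"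
    unfolding M_def using mK by (auto intro!: measurable_restrict_space1)
  have sM: "sq_int M \<phi>"
  proof (rule sq_intI_nn)
    show "\<phi> \<in> borel_measurable M" unfolding M_def by (auto intro!: measurable_restrict_space1)
    have "(\<integral>\<^sup>+x. ennreal ((cmod (\<phi> x))\<^sup>2) \<partial>M) \<le> (\<integral>\<^sup>+x. ennreal ((cmod (\<phi> x))\<^sup>2) \<partial>lborel)"
      unfolding nnM by (intro nn_integral_mono) (auto simp: indicator_def)
    also have "\<dots> < \<infinity>" using nn_integral_sq_nrm[OF test_functions_sq_int_lborel[OF \<phi>]] by simp
    finally show "(\<integral>\<^sup>+x. ennreal ((cmod (\<phi> x))\<^sup>2) \<partial>M) < \<infinity>" .
  qed
  define n where "n = (\<integral>p\<in>Q. (cmod (\<phi> p))\<^sup>2 \<partial>lborel)"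
  define \<Phi> where "\<Phi> = (\<integral>p\<in>Q. \<phi> p \<partial>lborel)"
  have nM: "(\<integral>x. (cmod (\<phi> x))\<^sup>2 \<partial>M) = n" "(\<integral>x. \<phi> x \<partial>M) = \<Phi>"
    unfolding M_def n_def \<Phi>_def set_lebesgue_integral_def by (simp_all add: integral_restrict_space)
  have "ennreal (2 * l\<^sup>2 * n - 2 * (cmod \<Phi>)\<^sup>2) = (\<integral>\<^sup>+p. \<integral>\<^sup>+q. ennreal ((cmod (\<phi> p - \<phi> q))\<^sup>2) \<partial>M \<partial>M)"
    using nn_integral_variance[OF fM sM] by (simp add: meM nM)
  also have "\<dots> \<le> (\<integral>\<^sup>+p. \<integral>\<^sup>+q. 2 * ennreal l * (K1 (snd p) + K2 (fst q)) \<partial>M \<partial>M)"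
    using pw by (intro nn_integral_mono) (auto simp: spM)
  also have "\<dots> = (\<integral>\<^sup>+p. 2 * ennreal l * (ennreal (l\<^sup>2) * K1 (snd p) + ennreal l * D2) \<partial>M)"
    by (simp add: nn_integral_cmult nn_integral_add meM iM mult.commute[of "K1 _"])
  also have "\<dots> = 2 * ennreal l * (ennreal (l\<^sup>2) * (ennreal l * D1) + ennreal l * D2 * ennreal (l\<^sup>2))"
    by (simp add: nn_integral_cmult nn_integral_add meM iM)
  \<comment> \<open>Of the four powers of \<open>l\<close>, one is the length of a leg, one comes
    from the coordinate on which \<open>K1\<close> or \<open>K2\<close> does not depend, and two
    from the area for the other point.\<close>
  also have "\<dots> = ennreal (2 * l^4) * (D1 + D2)"
  proof -
    have "2 * ennreal l * (ennreal (l\<^sup>2) * (ennreal l * D1) + ennreal l * D2 * ennreal (l\<^sup>2))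
       = (2 * ennreal l * ennreal l * ennreal (l\<^sup>2)) * (D1 + D2)" by (simp add: algebra_simps)
    also have "2 * ennreal l * ennreal l * ennreal (l\<^sup>2) = ennreal (2 * l^4)"
      using l by (simp add: ennreal_mult power2_eq_square power4_eq_xxxx mult.assoc)
    finally show ?thesis .
  qed
  also have "D1 + D2 = ennreal (\<integral>p\<in>Q. (\<Sum>e\<in>Basis. (cmod (partial_deriv e \<phi> p))\<^sup>2) \<partial>lborel)"
  proof -
    have "D2 = (\<integral>\<^sup>+p\<in>Q. ennreal ((cmod (partial_deriv e2 \<phi> p))\<^sup>2) \<partial>lborel)"
    proof -
      have "(\<integral>\<^sup>+p\<in>Q. ennreal ((cmod (partial_deriv e2 \<phi> p))\<^sup>2) \<partial>lborel) =
         (\<integral>\<^sup>+x. \<integral>\<^sup>+y. ennreal ((cmod (partial_deriv e2 \<phi> (x, y)))\<^sup>2) * indicator J y * indicator I x \<partial>lborel \<partial>lborel)"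
        using d(2)[THEN test_functions_measurable]
        by (subst nn_integral_lborel_pair[OF mD]) (simp_all add: Q indicator_times mult_ac)
      then show ?thesis unfolding D2_def K2_def by (simp add: nn_integral_multc)
    qed
    moreover have "D1 = (\<integral>\<^sup>+p\<in>Q. ennreal ((cmod (partial_deriv e1 \<phi> p))\<^sup>2) \<partial>lborel)"
    proof -
      have "(\<integral>\<^sup>+p\<in>Q. ennreal ((cmod (partial_deriv e1 \<phi> p))\<^sup>2) \<partial>lborel) =
         (\<integral>\<^sup>+y. \<integral>\<^sup>+x. ennreal ((cmod (partial_deriv e1 \<phi> (x, y)))\<^sup>2) * indicator I x * indicator J y \<partial>lborel \<partial>lborel)"
        using d(1)[THEN test_functions_measurable]
        by (subst nn_integral_lborel_pair_swap[OF mD]) (simp_all add: Q indicator_times mult_ac)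
      then show ?thesis unfolding D1_def K1_def by (simp add: nn_integral_multc)
    qed
    ultimately have "D1 + D2 = (\<integral>\<^sup>+p\<in>Q. ennreal (\<Sum>e\<in>Basis. (cmod (partial_deriv e \<phi> p))\<^sup>2) \<partial>lborel)"
      by (simp add: nn_integral_add[symmetric] sum_Basis_real_pair distrib_right)
    also have "\<dots> = ennreal (\<integral>p\<in>Q. (\<Sum>e\<in>Basis. (cmod (partial_deriv e \<phi> p))\<^sup>2) \<partial>lborel)"
    proof -
      have "integrable lborel (\<lambda>p. \<Sum>e\<in>Basis. (cmod (partial_deriv e \<phi> p))\<^sup>2)"
        using d[THEN test_functions_sq_int_lborel, THEN sq_int_integrable] by (simp add: sum_Basis_real_pair)
      from integrable_mult_indicator[OF _ this, of Q]
      have "integrable lborel (\<lambda>p. indicator Q p *\<^sub>R (\<Sum>e\<in>Basis. (cmod (partial_deriv e \<phi> p))\<^sup>2))" by simp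
      from nn_integral_eq_integral[OF this]
      have "(\<integral>\<^sup>+p. ennreal (indicator Q p *\<^sub>R (\<Sum>e\<in>Basis. (cmod (partial_deriv e \<phi> p))\<^sup>2)) \<partial>lborel)
          = ennreal (\<integral>p\<in>Q. (\<Sum>e\<in>Basis. (cmod (partial_deriv e \<phi> p))\<^sup>2) \<partial>lborel)"
        by (simp add: set_lebesgue_integral_def sum_nonneg)
      moreover have "(\<integral>\<^sup>+p\<in>Q. ennreal (\<Sum>e\<in>Basis. (cmod (partial_deriv e \<phi> p))\<^sup>2) \<partial>lborel)
         = (\<integral>\<^sup>+p. ennreal (indicator Q p *\<^sub>R (\<Sum>e\<in>Basis. (cmod (partial_deriv e \<phi> p))\<^sup>2)) \<partial>lborel)"
        by (intro nn_integral_cong) (auto simp: indicator_def)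
      ultimately show ?thesis by simp
    qed
    finally show ?thesis .
  qed
  finally have "ennreal (2 * l\<^sup>2 * n - 2 * (cmod \<Phi>)\<^sup>2) \<le>
     ennreal (2 * l^4) * ennreal (\<integral>p\<in>Q. (\<Sum>e\<in>Basis. (cmod (partial_deriv e \<phi> p))\<^sup>2) \<partial>lborel)" .
  moreover have D0: "0 \<le> (\<integral>p\<in>Q. (\<Sum>e\<in>Basis. (cmod (partial_deriv e \<phi> p))\<^sup>2) \<partial>lborel)"
    unfolding set_lebesgue_integral_def by (intro integral_nonneg_AE AE_I2) (auto simp: sum_nonneg)
  ultimately have "ennreal (2 * l\<^sup>2 * n - 2 * (cmod \<Phi>)\<^sup>2) \<le>
     ennreal (2 * l^4 * (\<integral>p\<in>Q. (\<Sum>e\<in>Basis. (cmod (partial_deriv e \<phi> p))\<^sup>2) \<partial>lborel))"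
    using l by (simp add: ennreal_mult)
  then have *: "2 * l\<^sup>2 * n - 2 * (cmod \<Phi>)\<^sup>2 \<le> 2 * l^4 * (\<integral>p\<in>Q. (\<Sum>e\<in>Basis. (cmod (partial_deriv e \<phi> p))\<^sup>2) \<partial>lborel)"
    using l D0 by (subst (asm) ennreal_le_iff) auto
  define DD where "DD = (\<integral>p\<in>Q. (\<Sum>e\<in>Basis. (cmod (partial_deriv e \<phi> p))\<^sup>2) \<partial>lborel)"
  have "l\<^sup>2 * (l\<^sup>2 * DD + (cmod \<Phi>)\<^sup>2 / l\<^sup>2) = l ^ 4 * DD + (cmod \<Phi>)\<^sup>2"
    using l by (simp add: distrib_left power2_eq_square power4_eq_xxxx)
  then have "l\<^sup>2 * n \<le> l\<^sup>2 * (l\<^sup>2 * DD + (cmod \<Phi>)\<^sup>2 / l\<^sup>2)"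
    using * unfolding DD_def[symmetric] by simp
  then have "n \<le> l\<^sup>2 * DD + (cmod \<Phi>)\<^sup>2 / l\<^sup>2" using l by simp
  then show ?thesis by (simp add: n_def DD_def \<Phi>_def)
qed

text \<open>Squares of side \<open>1 / m\<close>, half-open so that for fixed \<open>m\<close> they
  partition the plane and the index of a point is given by floors.\<close>

definition cell :: "nat \<Rightarrow> int \<times> int \<Rightarrow> (real \<times> real) set" where
  "cell m k = {of_int (fst k) / real m ..< of_int (fst k) / real m + 1 / real m} \<times>
     {of_int (snd k) / real m ..< of_int (snd k) / real m + 1 / real m}"

lemma mem_cell_iff:
  assumes "m > 0"
  shows "p \<in> cell m k \<longleftrightarrow> k = (\<lfloor>real m * fst p\<rfloor>, \<lfloor>real m * snd p\<rfloor>)"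
proof -
  have *: "of_int i / real m \<le> t \<and> t < of_int i / real m + 1 / real m \<longleftrightarrow> \<lfloor>real m * t\<rfloor> = i" for i t
    using assms by (simp add: floor_eq_iff add_divide_distrib[symmetric] pos_divide_le_eq pos_less_divide_eq mult.commute)
  show ?thesis
    by (cases p; cases k) (auto simp: cell_def *)
qed

lemma cell_sets: "cell m k \<in> sets borel"
  unfolding cell_def by (intro borel_Times) auto

text \<open>Poincare on each cell, summed. Cells that cross the boundary of \<open>\<omega>\<close>
  are harmless because the test function is smooth on the whole plane. Up to a small multiple of the
  gradient, finitely many numbers control the norm: the source of compactness.\<close>

lemma grid_estimate:
  assumes \<phi>: "\<phi> \<in> test_functions \<omega>" and \<omega>: "\<omega> \<subseteq> {- real K..<real K} \<times> {- real K..<real K}" and m: "m > 0"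
  defines "S \<equiv> {- int (K * m)..<int (K * m)} \<times> {- int (K * m)..<int (K * m)}"
  shows "(nrm lborel \<phi>)\<^sup>2 \<le> (\<Sum>b\<in>Basis. (nrm lborel (partial_deriv b \<phi>))\<^sup>2) / (real m)\<^sup>2
     + (real m)\<^sup>2 * (\<Sum>k\<in>S. (cmod (\<integral>p\<in>cell m k. \<phi> p \<partial>lborel))\<^sup>2)"
proof -
  have fS: "finite S" by (simp add: S_def)
  have sum_cells: "(\<Sum>k\<in>S. \<integral>p\<in>cell m k. h p \<partial>lborel) = (\<integral>p. h p \<partial>lborel)"
    if h: "integrable lborel h" "\<And>p. p \<notin> \<omega> \<Longrightarrow> h p = 0" for h :: "real \<times> real \<Rightarrow> real"
  proof -
    have "(\<Sum>k\<in>S. \<integral>p\<in>cell m k. h p \<partial>lborel) = (\<integral>p. (\<Sum>k\<in>S. indicator (cell m k) p *\<^sub>R h p) \<partial>lborel)"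
      unfolding set_lebesgue_integral_def
      by (subst Bochner_Integration.integral_sum)
         (use integrable_mult_indicator[of "cell m _" lborel h] cell_sets h(1) in auto)
    also have "\<dots> = (\<integral>p. h p \<partial>lborel)"
    proof (rule Bochner_Integration.integral_cong[OF refl])
      fix p :: "real \<times> real"
      show "(\<Sum>k\<in>S. indicator (cell m k) p *\<^sub>R h p) = h p"
      proof (cases "p \<in> \<omega>")
        case True
        define k0 where "k0 = (\<lfloor>real m * fst p\<rfloor>, \<lfloor>real m * snd p\<rfloor>)"
        have fl: "\<lfloor>real m * t\<rfloor> \<in> {- int (K * m)..<int (K * m)}" if "- real K \<le> t" "t < real K" for t
        proof -
          have "real m * (- real K) \<le> real m * t" "real m * t < real m * real K"
            using that m mult_left_mono[OF that(1), of "real m"] by auto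
          then show ?thesis by (auto simp: le_floor_iff floor_less_iff mult.commute)
        qed
        have "k0 \<in> S" using True \<omega> fl unfolding S_def k0_def by (cases p) auto
        have "(\<Sum>k\<in>S. indicator (cell m k) p *\<^sub>R h p) = (\<Sum>k\<in>S. if k = k0 then h p else 0)"
          by (intro sum.cong refl) (auto simp: indicator_def mem_cell_iff[OF m] k0_def)
        also have "\<dots> = h p" using fS \<open>k0 \<in> S\<close> by simp
        finally show ?thesis .
      qed (use h(2) in simp)
    qed
    finally show ?thesis .
  qed
  have d: "partial_deriv b \<phi> \<in> test_functions \<omega>" if "b \<in> Basis" for b
    using test_functions_partial_deriv[OF \<phi> that] .
  let ?D = "\<lambda>p. \<Sum>e\<in>Basis. (cmod (partial_deriv e \<phi> p))\<^sup>2"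
  have 1: "(\<Sum>k\<in>S. \<integral>p\<in>cell m k. (cmod (\<phi> p))\<^sup>2 \<partial>lborel) = (nrm lborel \<phi>)\<^sup>2"
    unfolding nrm_sq using test_functions_outside[OF \<phi>] sq_int_integrable[OF test_functions_sq_int_lborel[OF \<phi>]]
    by (intro sum_cells) auto
  have id: "integrable lborel (\<lambda>p. (cmod (partial_deriv e \<phi> p))\<^sup>2)" if "e \<in> Basis" for e
    by (rule sq_int_integrable[OF test_functions_sq_int_lborel[OF d[OF that]]])
  have "(\<Sum>k\<in>S. \<integral>p\<in>cell m k. ?D p \<partial>lborel) = (\<integral>p. ?D p \<partial>lborel)"
    using id test_functions_outside[OF d] by (intro sum_cells) (auto intro!: sum.neutral)
  also have "\<dots> = (\<Sum>b\<in>Basis. (nrm lborel (partial_deriv b \<phi>))\<^sup>2)"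
    unfolding nrm_sq using id by (intro Bochner_Integration.integral_sum) auto
  finally have 2: "(\<Sum>k\<in>S. \<integral>p\<in>cell m k. ?D p \<partial>lborel) = (\<Sum>b\<in>Basis. (nrm lborel (partial_deriv b \<phi>))\<^sup>2)" .
  have "(\<Sum>k\<in>S. \<integral>p\<in>cell m k. (cmod (\<phi> p))\<^sup>2 \<partial>lborel) \<le>
     (\<Sum>k\<in>S. (1 / real m)\<^sup>2 * (\<integral>p\<in>cell m k. ?D p \<partial>lborel) + (cmod (\<integral>p\<in>cell m k. \<phi> p \<partial>lborel))\<^sup>2 / (1 / real m)\<^sup>2)"
    unfolding cell_def using m by (intro sum_mono poincare_square[OF \<phi>]) simp
  also have "\<dots> = (\<Sum>b\<in>Basis. (nrm lborel (partial_deriv b \<phi>))\<^sup>2) / (real m)\<^sup>2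
     + (real m)\<^sup>2 * (\<Sum>k\<in>S. (cmod (\<integral>p\<in>cell m k. \<phi> p \<partial>lborel))\<^sup>2)"
    unfolding sum.distrib sum_distrib_left[symmetric] 2 by (simp add: power_divide sum_divide_distrib sum_distrib_left mult.commute)
  finally show ?thesis unfolding 1 .
qed

text \<open>Cauchy-Schwarz against the indicator of a cell, whose area is at most 1. The bound is
  uniform over all cells and sizes, as the diagonal extraction requires.\<close>

lemma test_functions_cell_integral_le:
  assumes "\<phi> \<in> test_functions \<omega>" "m > 0"
  shows "cmod (\<integral>p\<in>cell m k. \<phi> p \<partial>lborel) \<le> nrm lborel \<phi>"
proof -
  have c: "cell m k \<subseteq> cbox (of_int (fst k) / real m, of_int (snd k) / real m)
      (of_int (fst k) / real m + 1 / real m, of_int (snd k) / real m + 1 / real m)" (is "_ \<subseteq> cbox ?a ?b")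
    by (auto simp: cell_def)
  have e: "emeasure lborel (cbox ?a ?b) = ennreal ((1 / real m)\<^sup>2)"
  proof -
    have "(?b - ?a) = (1 / real m, 1 / real m)" by simp
    then show ?thesis
      by (subst emeasure_lborel_cbox) (auto simp: Basis_real_pair power2_eq_square)
  qed
  have "emeasure lborel (cell m k) \<le> emeasure lborel (cbox ?a ?b)"
    using c by (intro emeasure_mono) auto
  then have le: "emeasure lborel (cell m k) \<le> ennreal ((1 / real m)\<^sup>2)" by (simp only: e)
  define f where "f = (\<lambda>p. complex_of_real (indicator (cell m k) p))"
  have f2: "(\<lambda>x. (cmod (f x))\<^sup>2) = indicat_real (cell m k)" by (auto simp: f_def indicator_def)
  have sf: "sq_int lborel f"
    unfolding sq_int_def f2
  proof
    show "f \<in> borel_measurable lborel" unfolding f_def using cell_sets[of m k] by measurable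
    show "integrable lborel (indicat_real (cell m k))"
      using le cell_sets[of m k] by (intro integrable_real_indicator) (auto intro: le_less_trans)
  qed
  have "nrm lborel f \<le> 1"
  proof (rule nrm_le_nn)
    have "(\<integral>\<^sup>+x. ennreal ((cmod (f x))\<^sup>2) \<partial>lborel) = emeasure lborel (cell m k)"
    proof -
      have "(cmod (f x))\<^sup>2 = indicat_real (cell m k) x" for x using fun_cong[OF f2, of x] .
      then show ?thesis using cell_sets[of m k] by (simp add: ennreal_indicator)
    qed
    also have "\<dots> \<le> ennreal ((1 / real m)\<^sup>2)" by (rule le)
    also have "\<dots> \<le> ennreal (1\<^sup>2)" using assms(2) by (intro ennreal_leI power_mono) auto
    finally show "(\<integral>\<^sup>+x. ennreal ((cmod (f x))\<^sup>2) \<partial>lborel) \<le> ennreal (1\<^sup>2)" .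
  qed (use sq_int_measurable[OF sf] in auto)
  have "(\<integral>p\<in>cell m k. \<phi> p \<partial>lborel) = (\<integral>p. f p * \<phi> p \<partial>lborel)"
    unfolding set_lebesgue_integral_def f_def by (simp add: scaleR_conv_of_real)
  also have "cmod \<dots> \<le> nrm lborel f * nrm lborel \<phi>"
    by (rule CS_integral[OF sf test_functions_sq_int_lborel[OF assms(1)]])
  also have "\<dots> \<le> 1 * nrm lborel \<phi>" using \<open>nrm lborel f \<le> 1\<close> by (intro mult_right_mono) auto
  finally show ?thesis by simp
qed

lemma bounded_subset_square:
  assumes "bounded (\<omega> :: (real \<times> real) set)"
  obtains K where "\<omega> \<subseteq> {- real K..<real K} \<times> {- real K..<real K}"
proof -
  obtain B where B: "\<And>p. p \<in> \<omega> \<Longrightarrow> norm p \<le> B" using assms by (auto simp: bounded_iff)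
  obtain K where K: "B < real K" using reals_Archimedean2 by blast
  have "\<bar>fst p\<bar> < real K \<and> \<bar>snd p\<bar> < real K" if "p \<in> \<omega>" for p
    using B[OF that] K norm_fst_le[of "fst p" "snd p"] norm_snd_le[of "snd p" "fst p"] by auto
  then show ?thesis by (intro that[of K]) (fastforce simp: abs_less_iff)
qed

text \<open>Make all cell integrals of all sizes converge along one subsequence. For a given
  tolerance a fine grid first makes the gradient term small, and then only finitely many convergent
  sequences are left.\<close>

lemma rellich:
  fixes \<phi> :: "nat \<Rightarrow> real \<times> real \<Rightarrow> complex"
  assumes \<omega>: "bounded \<omega>" and T: "\<And>n. \<phi> n \<in> test_functions \<omega>" and n1: "\<And>n. nrm lborel (\<phi> n) \<le> 1"
    and D: "\<And>n. (\<Sum>b\<in>Basis. (nrm lborel (partial_deriv b (\<phi> n)))\<^sup>2) \<le> B"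
  obtains r :: "nat \<Rightarrow> nat" where "strict_mono r"
    "\<And>e. e > 0 \<Longrightarrow> \<exists>N. \<forall>m\<ge>N. \<forall>n\<ge>N. nrm lborel (\<lambda>x. \<phi> (r m) x - \<phi> (r n) x) < e"
proof -
  obtain K where K: "\<omega> \<subseteq> {- real K..<real K} \<times> {- real K..<real K}"
    using bounded_subset_square[OF \<omega>] .
  \<comment> \<open>The index \<open>j\<close> pairs \<open>m - 1\<close> with a cell, so that
    \<open>Suc\<close> runs through all positive \<open>m\<close>; the index set is
    countable.\<close>
  define F where "F n j = (\<integral>p\<in>cell (Suc (fst j)) (snd j). \<phi> n p \<partial>lborel)" for n j
  have "cmod (F n j) \<le> 1" for n j
    using test_functions_cell_integral_le[of "\<phi> n" \<omega> "Suc (fst j)" "snd j"] T n1[of n] by (simp add: F_def)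
  then obtain r where r: "strict_mono r" and conv: "\<And>j. \<exists>l. (\<lambda>n. F (r n) j) \<longlonglongrightarrow> l"
    using function_convergent_subsequence[of "UNIV :: (nat \<times> int \<times> int) set" F 1] by (metis UNIV_I countableI_type)
  have B0: "B \<ge> 0" using D[of 0] by (meson order_trans sum_nonneg zero_le_power2)
  have cauchy: "\<exists>N. \<forall>m\<ge>N. \<forall>n\<ge>N. nrm lborel (\<lambda>x. \<phi> (r m) x - \<phi> (r n) x) < e" if e: "e > 0" for e
  proof -
    \<comment> \<open>The gradient of a difference has square at most \<open>4 * B\<close>; this
      \<open>M\<close> makes its share \<open>4 * B / (real m)\<^sup>2\<close> less than half of
      \<open>e\<^sup>2\<close>.\<close>
    obtain M where M: "8 * B / e\<^sup>2 < real M" using reals_Archimedean2 by blast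
    define m where "m = Suc M"
    have m: "m > 0" by (simp add: m_def)
    have m2: "4 * B / (real m)\<^sup>2 < e\<^sup>2 / 2"
    proof -
      have "real m \<le> (real m)\<^sup>2" using m by (simp add: power2_eq_square)
      then have "8 * B / e\<^sup>2 < (real m)\<^sup>2" using M by (simp add: m_def)
      then show ?thesis using e m by (simp add: field_simps)
    qed
    define S where "S = {- int (K * m)..<int (K * m)} \<times> {- int (K * m)..<int (K * m)}"
    have fS: "finite S" by (simp add: S_def)
    define G where "G n = (\<Sum>k\<in>S. (cmod (F (fst n) (M, k) - F (snd n) (M, k)))\<^sup>2)" for n
    \<comment> \<open>The factor \<open>(real m)\<^sup>2\<close> in front of the cell integrals
      turns \<open>d\<close> into the other half of \<open>e\<^sup>2\<close>.\<close>
    define d where "d = e\<^sup>2 / (2 * (real m)\<^sup>2)"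
    have d: "d > 0" using e m by (simp add: d_def)
    have "\<exists>N. \<forall>i\<ge>N. \<forall>j\<ge>N. G (r i, r j) < d"
    proof -
      define c where "c = sqrt (d / (real (card S) + 1))"
      have c: "c > 0" "c\<^sup>2 = d / (real (card S) + 1)" using d by (auto simp: c_def)
      have "\<forall>k. \<exists>N. \<forall>i\<ge>N. \<forall>j\<ge>N. dist (F (r i) (M, k)) (F (r j) (M, k)) < c"
      proof
        fix k
        have "Cauchy (\<lambda>n. F (r n) (M, k))" using conv[of "(M, k)"] LIMSEQ_imp_Cauchy by blast
        then show "\<exists>N. \<forall>i\<ge>N. \<forall>j\<ge>N. dist (F (r i) (M, k)) (F (r j) (M, k)) < c"
          using c(1) by (simp add: Cauchy_def)
      qed
      then obtain N where N: "\<And>k i j. i \<ge> N k \<Longrightarrow> j \<ge> N k \<Longrightarrow> dist (F (r i) (M, k)) (F (r j) (M, k)) < c"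
        by metis
      define N0 where "N0 = Max (insert 0 (N ` S))"
      have N0: "N k \<le> N0" if "k \<in> S" for k using that fS by (auto simp: N0_def)
      have "G (r i, r j) < d" if "i \<ge> N0" "j \<ge> N0" for i j
      proof -
        have "G (r i, r j) \<le> (\<Sum>k\<in>S. c\<^sup>2)"
          unfolding G_def
        proof (intro sum_mono power_mono)
          fix k assume "k \<in> S"
          then have "dist (F (r i) (M, k)) (F (r j) (M, k)) < c" using N0 that by (intro N) (meson order_trans)+
          then show "cmod (F (fst (r i, r j)) (M, k) - F (snd (r i, r j)) (M, k)) \<le> c"
            by (simp add: dist_norm)
        qed auto
        also have "\<dots> = real (card S) * (d / (real (card S) + 1))" by (simp add: c(2))
        also have "\<dots> < d" using d by (simp add: field_simps)
        finally show ?thesis .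
      qed
      then show ?thesis by blast
    qed
    then obtain N where N: "\<And>i j. i \<ge> N \<Longrightarrow> j \<ge> N \<Longrightarrow> G (r i, r j) < d" by blast
    have "nrm lborel (\<lambda>x. \<phi> (r i) x - \<phi> (r j) x) < e" if ij: "i \<ge> N" "j \<ge> N" for i j
    proof -
      let ?f = "\<lambda>x. \<phi> (r i) x - \<phi> (r j) x"
      have Tf: "?f \<in> test_functions \<omega>" by (intro test_functions_diff T)
      have "(nrm lborel (partial_deriv b ?f))\<^sup>2 \<le> 2 * (nrm lborel (partial_deriv b (\<phi> (r i))))\<^sup>2
            + 2 * (nrm lborel (partial_deriv b (\<phi> (r j))))\<^sup>2" if b: "b \<in> Basis" for b
      proof -
        note s = test_functions_sq_int_lborel[OF test_functions_partial_deriv[OF T b]]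
        have "partial_deriv b ?f = (\<lambda>x. partial_deriv b (\<phi> (r i)) x - partial_deriv b (\<phi> (r j)) x)"
          by (rule ext) (rule partial_deriv_diff_test[OF T T])
        then show ?thesis using nrm_diff_sq_le[OF s s] by simp
      qed
      then have "(\<Sum>b\<in>Basis. (nrm lborel (partial_deriv b ?f))\<^sup>2) \<le>
          (\<Sum>b\<in>Basis. 2 * (nrm lborel (partial_deriv b (\<phi> (r i))))\<^sup>2 + 2 * (nrm lborel (partial_deriv b (\<phi> (r j))))\<^sup>2)"
        by (rule sum_mono)
      also have "\<dots> \<le> 4 * B"
        using D[of "r i"] D[of "r j"] by (simp add: sum.distrib sum_distrib_left[symmetric])
      finally have DB: "(\<Sum>b\<in>Basis. (nrm lborel (partial_deriv b ?f))\<^sup>2) \<le> 4 * B" .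
      have "(\<integral>p\<in>cell m k. ?f p \<partial>lborel) = F (r i) (M, k) - F (r j) (M, k)" for k
      proof -
        have "integrable lborel (\<lambda>p. indicator (cell m k) p *\<^sub>R \<phi> n p)" for n
          using cell_sets test_functions_integrable_lborel[OF T] by (intro integrable_mult_indicator) auto
        then show ?thesis
          by (simp add: F_def m_def set_lebesgue_integral_def scaleR_diff_right)
      qed
      then have "(\<Sum>k\<in>S. (cmod (\<integral>p\<in>cell m k. ?f p \<partial>lborel))\<^sup>2) = G (r i, r j)"
        by (simp add: G_def)
      with grid_estimate[OF Tf K m, folded S_def]
      have "(nrm lborel ?f)\<^sup>2 \<le> (\<Sum>b\<in>Basis. (nrm lborel (partial_deriv b ?f))\<^sup>2) / (real m)\<^sup>2 + (real m)\<^sup>2 * G (r i, r j)"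
        by simp
      also have "\<dots> \<le> 4 * B / (real m)\<^sup>2 + (real m)\<^sup>2 * d"
        using DB N[OF ij] by (intro add_mono divide_right_mono mult_left_mono) auto
      also have "(real m)\<^sup>2 * d = e\<^sup>2 / 2" using m by (simp add: d_def)
      also have "4 * B / (real m)\<^sup>2 + e\<^sup>2 / 2 < e\<^sup>2" using m2 by simp
      finally show ?thesis by (rule power2_less_imp_less) (use e in simp)
    qed
    then show ?thesis by blast
  qed
  show ?thesis by (rule that[OF r]) (rule cauchy)
qed

subsection \<open>The first Dirichlet eigenvalue as a Rayleigh quotient\<close>

definition ip :: "'a measure \<Rightarrow> ('a \<Rightarrow> complex) \<Rightarrow> ('a \<Rightarrow> complex) \<Rightarrow> complex" where
  "ip M f g = (\<integral>x. f x * cnj (g x) \<partial>M)"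

lemma integrable_ip:
  assumes "sq_int M f" "sq_int M g" shows "integrable M (\<lambda>x. f x * cnj (g x))"
  using integrable_mult_sq_int[OF assms(1) sq_int_cnj[OF assms(2)]] .

lemma cmod_ip_le:
  assumes "sq_int M f" "sq_int M g" shows "cmod (ip M f g) \<le> nrm M f * nrm M g"
  using CS_integral[OF assms(1) sq_int_cnj[OF assms(2)]] by (simp add: ip_def nrm_cnj)

lemma ip_diff_left:
  assumes "sq_int M f" "sq_int M g" "sq_int M h"
  shows "ip M (\<lambda>x. f x - g x) h = ip M f h - ip M g h"
  using integrable_ip[OF assms(1,3)] integrable_ip[OF assms(2,3)]
  by (simp add: ip_def left_diff_distrib)

lemma ip_diff_right:
  assumes "sq_int M f" "sq_int M g" "sq_int M h"
  shows "ip M f (\<lambda>x. g x - h x) = ip M f g - ip M f h"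
  using integrable_ip[OF assms(1,2)] integrable_ip[OF assms(1,3)]
  by (simp add: ip_def right_diff_distrib)

lemma ip_self: "ip M f f = complex_of_real ((nrm M f)\<^sup>2)"
proof -
  have "ip M f f = (\<integral>x. complex_of_real ((cmod (f x))\<^sup>2) \<partial>M)"
    by (simp add: ip_def complex_norm_square del: of_real_power)
  then show ?thesis by (simp add: nrm_sq del: of_real_power)
qed

text \<open>Real \<open>t\<close> is enough: \<open>t = 1\<close> and \<open>t = - 1\<close> give
  the parallelogram law, general \<open>t\<close> the Cauchy-Schwarz argument for the Rayleigh
  form.\<close>

lemma nrm_add_scaled_sq:
  assumes "sq_int M f" "sq_int M g"
  shows "(nrm M (\<lambda>x. f x + complex_of_real t * g x))\<^sup>2
     = (nrm M f)\<^sup>2 + 2 * t * Re (ip M f g) + t\<^sup>2 * (nrm M g)\<^sup>2"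
proof -
  have pw: "(cmod (a + complex_of_real t * b))\<^sup>2 = (cmod a)\<^sup>2 + 2 * t * Re (a * cnj b) + t\<^sup>2 * (cmod b)\<^sup>2" for a b
    by (simp only: cmod_power2) (simp add: power2_eq_square algebra_simps)
  note i = sq_int_integrable[OF assms(1)] sq_int_integrable[OF assms(2)] integrable_ip[OF assms]
  have iR: "integrable M (\<lambda>x. 2 * t * Re (f x * cnj (g x)))"
    using integrable_Re[OF i(3)] by (rule integrable_mult_right)
  have "(\<integral>x. 2 * t * Re (f x * cnj (g x)) \<partial>M) = 2 * t * Re (ip M f g)"
    unfolding ip_def using integral_Re[OF i(3)] by (simp only: integral_mult_right_zero)
  then show ?thesis
    unfolding nrm_sq pw using i iR
    by (subst Bochner_Integration.integral_add, simp, simp, subst Bochner_Integration.integral_add)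
       (simp_all only: integrable_mult_right integral_mult_right_zero simp_thms)
qed

lemma nrm_tendsto:
  assumes "\<And>n. sq_int M (f n)" "sq_int M g" "(\<lambda>n. nrm M (\<lambda>x. f n x - g x)) \<longlonglongrightarrow> 0"
  shows "(\<lambda>n. nrm M (f n)) \<longlonglongrightarrow> nrm M g"
proof (rule LIM_zero_cancel, rule tendsto_rabs_zero_cancel, rule tendsto_sandwich[OF _ _ tendsto_const assms(3)])
  have "\<bar>nrm M (f n) - nrm M g\<bar> \<le> nrm M (\<lambda>x. f n x - g x)" for n
    using nrm_le_add_diff[OF assms(1,2), of n] nrm_le_add_diff[OF assms(2) assms(1), of n]
      nrm_diff_commute[of M g "f n"] by (simp add: abs_le_iff)
  then show "\<forall>\<^sub>F n in sequentially. \<bar>nrm M (f n) - nrm M g\<bar> \<le> nrm M (\<lambda>x. f n x - g x)" by simp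
qed simp

lemma ip_tendsto_left:
  assumes f: "\<And>n. sq_int M (f n)" and g: "sq_int M g" and h: "sq_int M h"
    and lim: "(\<lambda>n. nrm M (\<lambda>x. f n x - g x)) \<longlonglongrightarrow> 0"
  shows "(\<lambda>n. ip M (f n) h) \<longlonglongrightarrow> ip M g h"
proof (rule LIM_zero_cancel, rule tendsto_norm_zero_cancel, rule tendsto_sandwich[OF _ _ tendsto_const])
  show "(\<lambda>n. nrm M (\<lambda>x. f n x - g x) * nrm M h) \<longlonglongrightarrow> 0" using tendsto_mult_left_zero[OF lim] .
  show "\<forall>\<^sub>F n in sequentially. norm (ip M (f n) h - ip M g h) \<le> nrm M (\<lambda>x. f n x - g x) * nrm M h"
    using cmod_ip_le[OF sq_int_diff[OF f g] h] ip_diff_left[OF f g h] by simp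
qed simp

lemma ip_tendsto_right:
  assumes f: "\<And>n. sq_int M (f n)" and g: "sq_int M g" and h: "sq_int M h"
    and lim: "(\<lambda>n. nrm M (\<lambda>x. f n x - g x)) \<longlonglongrightarrow> 0"
  shows "(\<lambda>n. ip M h (f n)) \<longlonglongrightarrow> ip M h g"
proof (rule LIM_zero_cancel, rule tendsto_norm_zero_cancel, rule tendsto_sandwich[OF _ _ tendsto_const])
  show "(\<lambda>n. nrm M h * nrm M (\<lambda>x. f n x - g x)) \<longlonglongrightarrow> 0" using tendsto_mult_right_zero[OF lim] .
  show "\<forall>\<^sub>F n in sequentially. norm (ip M h (f n) - ip M h g) \<le> nrm M h * nrm M (\<lambda>x. f n x - g x)"
    using cmod_ip_le[OF h sq_int_diff[OF f g]] ip_diff_right[OF h f g] by simp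
qed simp

lemma H10_approx_seq:
  assumes \<Omega>: "open \<Omega>" and f: "f \<in> H10 \<Omega>"
  obtains \<phi> where "\<And>n. \<phi> n \<in> test_functions \<Omega>" "(\<lambda>n. nrm (lebesgue_on \<Omega>) (\<lambda>x. \<phi> n x - f x)) \<longlonglongrightarrow> 0"
    "\<forall>b\<in>Basis. (\<lambda>n. nrm (lebesgue_on \<Omega>) (\<lambda>x. partial_deriv b (\<phi> n) x - weak_partial \<Omega> b f x)) \<longlonglongrightarrow> 0"
proof -
  let ?P = "\<lambda>n \<phi>. \<phi> \<in> test_functions \<Omega> \<and> nrm (lebesgue_on \<Omega>) (\<lambda>x. f x - \<phi> x) < 1 / real (Suc n) \<and>
    (\<forall>b\<in>Basis. nrm (lebesgue_on \<Omega>) (\<lambda>x. weak_partial \<Omega> b f x - partial_deriv b \<phi> x) < 1 / real (Suc n))"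
  have "\<exists>\<phi>. ?P n \<phi>" for n
  proof -
    have "0 < 1 / real (Suc n)" by simp
    then show ?thesis
    proof (rule H10_approx[OF \<Omega> f])
      fix \<phi> assume 1: "\<phi> \<in> test_functions \<Omega>" "nrm (lebesgue_on \<Omega>) (\<lambda>x. f x - \<phi> x) < 1 / real (Suc n)"
        "\<And>b. b \<in> Basis \<Longrightarrow> nrm (lebesgue_on \<Omega>) (\<lambda>x. weak_partial \<Omega> b f x - partial_deriv b \<phi> x) < 1 / real (Suc n)"
      show ?thesis by (intro exI[of _ \<phi>] conjI ballI 1)
    qed
  qed
  then have "\<forall>n. \<exists>\<phi>. ?P n \<phi>" by (rule allI)
  then obtain \<phi> where P: "\<forall>n. ?P n (\<phi> n)"
    by (rule choice[THEN exE])
  then have \<phi>: "\<And>n. \<phi> n \<in> test_functions \<Omega>"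
    "\<And>n. nrm (lebesgue_on \<Omega>) (\<lambda>x. f x - \<phi> n x) < 1 / real (Suc n)"
    "\<And>n b. b \<in> Basis \<Longrightarrow> nrm (lebesgue_on \<Omega>) (\<lambda>x. weak_partial \<Omega> b f x - partial_deriv b (\<phi> n) x) < 1 / real (Suc n)"
    by blast+
  have z: "a \<longlonglongrightarrow> 0" if "\<And>n. 0 \<le> a n" "\<And>n. a n < 1 / real (Suc n)" for a :: "nat \<Rightarrow> real"
    by (rule tendsto_sandwich[OF _ _ tendsto_const LIMSEQ_Suc[OF lim_1_over_n]])
       (use that in \<open>auto intro!: always_eventually less_imp_le simp del: of_nat_Suc\<close>)
  show ?thesis
  proof (rule that[OF \<phi>(1)])
    show "(\<lambda>n. nrm (lebesgue_on \<Omega>) (\<lambda>x. \<phi> n x - f x)) \<longlonglongrightarrow> 0"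
      unfolding nrm_diff_commute[of "lebesgue_on \<Omega>" "\<phi> _" f] by (rule z[OF nrm_nonneg \<phi>(2)])
    show "\<forall>b\<in>Basis. (\<lambda>n. nrm (lebesgue_on \<Omega>) (\<lambda>x. partial_deriv b (\<phi> n) x - weak_partial \<Omega> b f x)) \<longlonglongrightarrow> 0"
    proof
      fix b :: 'a assume b: "b \<in> Basis"
      show "(\<lambda>n. nrm (lebesgue_on \<Omega>) (\<lambda>x. partial_deriv b (\<phi> n) x - weak_partial \<Omega> b f x)) \<longlonglongrightarrow> 0"
        unfolding nrm_diff_commute[of "lebesgue_on \<Omega>" "partial_deriv b (\<phi> _)" "weak_partial \<Omega> b f"]
        by (rule z[OF nrm_nonneg \<phi>(3)[OF b]])
    qed
  qed
qed

definition grad_sq :: "('a::euclidean_space \<Rightarrow> complex) \<Rightarrow> real" where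
  "grad_sq \<phi> = (\<Sum>b\<in>Basis. (nrm lborel (partial_deriv b \<phi>))\<^sup>2)"

text \<open>Only test functions compete, so that the lower bound can be applied with classical
  derivatives to each cross-section of a test function on the tube.\<close>

definition rayleigh_inf :: "'a::euclidean_space set \<Rightarrow> real" where
  "rayleigh_inf \<omega> = Inf (grad_sq ` {\<phi> \<in> test_functions \<omega>. nrm lborel \<phi> = 1})"

lemma grad_sq_nonneg: "0 \<le> grad_sq \<phi>"
  by (simp add: grad_sq_def sum_nonneg)

lemma grad_sq_cmult:
  assumes "\<phi> \<in> test_functions \<omega>" shows "grad_sq (\<lambda>x. c * \<phi> x) = (cmod c)\<^sup>2 * grad_sq \<phi>"
proof -
  have "partial_deriv b (\<lambda>x. c * \<phi> x) = (\<lambda>x. c * partial_deriv b \<phi> x)" for b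
    using partial_deriv_cmult[OF test_functions_differentiable[OF assms]] by blast
  then show ?thesis by (simp add: grad_sq_def nrm_cmult power_mult_distrib sum_distrib_left)
qed

lemma rayleigh_inf_le:
  assumes \<phi>: "\<phi> \<in> test_functions \<omega>" shows "rayleigh_inf \<omega> * (nrm lborel \<phi>)\<^sup>2 \<le> grad_sq \<phi>"
proof (cases "nrm lborel \<phi> = 0")
  case True then show ?thesis by (simp add: grad_sq_nonneg)
next
  case False
  define n where "n = nrm lborel \<phi>"
  have n: "n > 0" unfolding n_def using False nrm_nonneg[of lborel \<phi>] by linarith
  define \<psi> where "\<psi> = (\<lambda>x. complex_of_real (1 / n) * \<phi> x)"
  have "\<psi> \<in> test_functions \<omega>" "nrm lborel \<psi> = 1"
    using test_functions_cmult[OF \<phi>] n nrm_cmult[of lborel "complex_of_real (1 / n)" \<phi>]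
    by (auto simp: \<psi>_def n_def[symmetric] simp del: of_real_divide)
  then have "rayleigh_inf \<omega> \<le> grad_sq \<psi>"
    unfolding rayleigh_inf_def using grad_sq_nonneg by (intro cInf_lower) (auto intro!: bdd_belowI[of _ 0])
  also have "grad_sq \<psi> = grad_sq \<phi> / n\<^sup>2"
    using grad_sq_cmult[OF \<phi>, of "complex_of_real (1 / n)"] n by (simp add: \<psi>_def power_divide norm_divide)
  finally show ?thesis using n by (simp add: n_def[symmetric] pos_le_divide_eq)
qed

text \<open>A bump on a box inside \<open>\<omega>\<close> is positive on a set of positive measure.
  This makes the infimum in \<open>rayleigh_inf\<close> one over a nonempty set.\<close>

lemma ex_normalised_test_function:
  assumes "open \<omega>" "\<omega> \<noteq> {}"
  obtains \<phi> where "\<phi> \<in> test_functions \<omega>" "nrm lborel \<phi> = 1"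
proof -
  obtain p where "p \<in> \<omega>" using assms(2) by blast
  then obtain a b where ab: "p \<in> box a b" "cbox a b \<subseteq> \<omega>"
    using open_contains_cbox[of \<omega>] assms(1) by metis
  define \<beta> where "\<beta> = (\<lambda>x. complex_of_real (bump 1 a b x))"
  have T: "\<beta> \<in> test_functions \<omega>" unfolding \<beta>_def using ab(2) by (intro bump_test_function) auto
  have "nrm lborel \<beta> \<noteq> 0"
  proof
    assume "nrm lborel \<beta> = 0"
    then have "AE x in lborel. \<beta> x = 0" using nrm_eq_0_iff[OF test_functions_sq_int_lborel[OF T]] by simp
    then have "AE x in lborel. x \<notin> box a b"
    proof eventually_elim
      fix x assume "\<beta> x = 0"
      then show "x \<notin> box a b" using bump_pos_iff[of 1 a b x] by (auto simp: \<beta>_def)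
    qed
    then have "box a b \<in> null_sets lborel" by (simp add: AE_iff_null_sets)
    then have "emeasure lborel (box a b) = 0" by auto
    moreover have "emeasure lborel (box a b) = ennreal (\<Prod>i\<in>Basis. (b - a) \<bullet> i)"
      using ab(1) by (intro emeasure_lborel_box) (auto simp: mem_box intro: less_imp_le less_trans)
    moreover have "0 < (\<Prod>i\<in>Basis. (b - a) \<bullet> i)"
      using ab(1) by (intro prod_pos) (fastforce simp: mem_box inner_diff_left)
    ultimately show False by (metis ennreal_eq_0_iff not_le)
  qed
  then show ?thesis
    using that[of "\<lambda>x. complex_of_real (1 / nrm lborel \<beta>) * \<beta> x"] test_functions_cmult[OF T]
      nrm_cmult[of lborel "complex_of_real (1 / nrm lborel \<beta>)" \<beta>] nrm_nonneg[of lborel \<beta>]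
    by (simp del: of_real_divide)
qed

lemma grad_sq_add_scaled:
  assumes "\<phi> \<in> test_functions \<omega>" "\<psi> \<in> test_functions \<omega>"
  shows "grad_sq (\<lambda>x. \<phi> x + complex_of_real t * \<psi> x)
     = grad_sq \<phi> + 2 * t * Re (\<Sum>b\<in>Basis. ip lborel (partial_deriv b \<phi>) (partial_deriv b \<psi>)) + t\<^sup>2 * grad_sq \<psi>"
proof -
  have pd: "partial_deriv b (\<lambda>x. \<phi> x + complex_of_real t * \<psi> x) =
     (\<lambda>x. partial_deriv b \<phi> x + complex_of_real t * partial_deriv b \<psi> x)" for b
  proof
    fix x
    show "partial_deriv b (\<lambda>x. \<phi> x + complex_of_real t * \<psi> x) x =
       partial_deriv b \<phi> x + complex_of_real t * partial_deriv b \<psi> x"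
      using partial_deriv_add[OF test_functions_differentiable[OF assms(1)]
          test_functions_differentiable[OF test_functions_cmult[OF assms(2)]]]
        partial_deriv_cmult[OF test_functions_differentiable[OF assms(2)]] by metis
  qed
  have "grad_sq (\<lambda>x. \<phi> x + complex_of_real t * \<psi> x) =
     (\<Sum>b\<in>Basis. (nrm lborel (partial_deriv b \<phi>))\<^sup>2 + 2 * t * Re (ip lborel (partial_deriv b \<phi>) (partial_deriv b \<psi>))
        + t\<^sup>2 * (nrm lborel (partial_deriv b \<psi>))\<^sup>2)"
    unfolding grad_sq_def pd
    using assms[THEN test_functions_partial_deriv, THEN test_functions_sq_int_lborel]
    by (intro sum.cong refl nrm_add_scaled_sq)
  then show ?thesis
    by (simp add: grad_sq_def sum.distrib sum_distrib_left)
qed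

lemma ip_test_lebesgue_on:
  assumes "\<phi> \<in> test_functions \<omega>" "\<psi> \<in> test_functions \<omega>" "\<omega> \<in> sets lebesgue"
  shows "ip (lebesgue_on \<omega>) \<phi> \<psi> = ip lborel \<phi> \<psi>"
proof -
  have "(\<lambda>x. \<phi> x * cnj (\<psi> x)) \<in> test_functions \<omega>"
    by (rule test_functions_mult[OF assms(1) test_functions_cnj[OF assms(2)]])
  then show ?thesis unfolding ip_def
    using assms(3) test_functions_measurable test_functions_outside by (intro integral_lebesgue_on_eq) blast+
qed

lemma rayleigh_inf_nonneg:
  assumes "open \<omega>" "\<omega> \<noteq> {}" shows "0 \<le> rayleigh_inf \<omega>"
  unfolding rayleigh_inf_def
  using ex_normalised_test_function[OF assms] grad_sq_nonneg by (intro cInf_greatest) blast+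

lemma rayleigh_minimising_sequence:
  assumes "open \<omega>" "\<omega> \<noteq> {}"
  obtains \<phi> where "\<And>n. \<phi> n \<in> test_functions \<omega>" "\<And>n. nrm lborel (\<phi> n) = 1"
    "\<And>n. grad_sq (\<phi> n) < rayleigh_inf \<omega> + 1 / real (Suc n)"
proof -
  let ?X = "grad_sq ` {\<phi> \<in> test_functions \<omega>. nrm lborel \<phi> = 1}"
  have ne: "?X \<noteq> {}" using ex_normalised_test_function[OF assms] by blast
  have "\<exists>\<phi>. \<phi> \<in> test_functions \<omega> \<and> nrm lborel \<phi> = 1 \<and> grad_sq \<phi> < rayleigh_inf \<omega> + 1 / real (Suc n)" for n
  proof -
    have "Inf ?X < rayleigh_inf \<omega> + 1 / real (Suc n)" by (simp add: rayleigh_inf_def)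
    then obtain x where "x \<in> ?X" "x < rayleigh_inf \<omega> + 1 / real (Suc n)"
      using cInf_lessD[OF ne] by blast
    then show ?thesis by blast
  qed
  then show ?thesis using that by metis
qed

text \<open>
  A minimising sequence is Cauchy for the gradient norm as well, by the parallelogram law for the
  nonnegative form \<open>\<parallel>\<nabla>\<phi>\<parallel>\<^sup>2 - \<lambda>\<parallel>\<phi>\<parallel>\<^sup>2\<close>; Cauchy-Schwarz for the same form yields the eigenvalue equation.
\<close>

lemma rayleigh_minimiser:
  fixes \<omega> :: "(real \<times> real) set"
  assumes \<omega>: "open \<omega>" "\<omega> \<noteq> {}" "bounded \<omega>"
  obtains u \<phi> where "u \<in> H10 \<omega>" "nrm (lebesgue_on \<omega>) u = 1" "\<And>n. \<phi> n \<in> test_functions \<omega>"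
    "(\<lambda>n. nrm (lebesgue_on \<omega>) (\<lambda>x. \<phi> n x - u x)) \<longlonglongrightarrow> 0"
    "\<forall>b\<in>Basis. (\<lambda>n. nrm (lebesgue_on \<omega>) (\<lambda>x. partial_deriv b (\<phi> n) x - weak_partial \<omega> b u x)) \<longlonglongrightarrow> 0"
    "(\<lambda>n. grad_sq (\<phi> n) - rayleigh_inf \<omega> * (nrm lborel (\<phi> n))\<^sup>2) \<longlonglongrightarrow> 0"
proof -
  define \<Lambda> where "\<Lambda> = rayleigh_inf \<omega>"
  have \<Lambda>0: "0 \<le> \<Lambda>" unfolding \<Lambda>_def by (rule rayleigh_inf_nonneg[OF \<omega>(1,2)])
  have S: "\<omega> \<in> sets lebesgue" using \<omega>(1) by simp
  obtain \<phi>0 where T0: "\<And>n. \<phi>0 n \<in> test_functions \<omega>" and N0: "\<And>n. nrm lborel (\<phi>0 n) = 1"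
    and G0: "\<And>n. grad_sq (\<phi>0 n) < \<Lambda> + 1 / real (Suc n)"
    unfolding \<Lambda>_def using rayleigh_minimising_sequence[OF \<omega>(1,2)] by blast
  have "grad_sq (\<phi>0 n) \<le> \<Lambda> + 1" for n
  proof -
    have "1 / real (Suc n) \<le> 1" by simp
    then show ?thesis using G0[of n] by linarith
  qed
  then have GB: "(\<Sum>b\<in>Basis. (nrm lborel (partial_deriv b (\<phi>0 n)))\<^sup>2) \<le> \<Lambda> + 1" for n
    by (simp add: grad_sq_def)
  have N1: "nrm lborel (\<phi>0 n) \<le> 1" for n using N0 by simp
  obtain r :: "nat \<Rightarrow> nat" where r: "strict_mono r" and rc: "\<And>e. e > 0 \<Longrightarrow>
      \<exists>N. \<forall>m\<ge>N. \<forall>n\<ge>N. nrm lborel (\<lambda>x. \<phi>0 (r m) x - \<phi>0 (r n) x) < e"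
  proof (rule rellich[OF \<omega>(3) T0 N1 GB])
    fix r :: "nat \<Rightarrow> nat"
    assume "strict_mono r" "\<And>e. e > 0 \<Longrightarrow>
      \<exists>N. \<forall>m\<ge>N. \<forall>n\<ge>N. nrm lborel (\<lambda>x. \<phi>0 (r m) x - \<phi>0 (r n) x) < e"
    then show thesis by (rule that)
  qed
  define \<phi> where "\<phi> n = \<phi>0 (r n)" for n
  have T: "\<phi> n \<in> test_functions \<omega>" and N: "nrm lborel (\<phi> n) = 1" for n
    using T0 N0 by (auto simp: \<phi>_def)
  have G: "grad_sq (\<phi> n) < \<Lambda> + 1 / real (Suc n)" for n
  proof -
    have "1 / real (Suc (r n)) \<le> 1 / real (Suc n)"
      using seq_suble[OF r, of n] by (intro divide_left_mono) auto
    then show ?thesis using G0[of "r n"] by (simp add: \<phi>_def)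
  qed
  have G1: "\<Lambda> \<le> grad_sq (\<phi> n)" for n using rayleigh_inf_le[OF T[of n]] N[of n] by (simp add: \<Lambda>_def)
  have par: "grad_sq (\<lambda>x. \<phi> m x - \<phi> n x) \<le>
     2 * (grad_sq (\<phi> m) - \<Lambda>) + 2 * (grad_sq (\<phi> n) - \<Lambda>) + \<Lambda> * (nrm lborel (\<lambda>x. \<phi> m x - \<phi> n x))\<^sup>2" for m n
  proof -
    note s = test_functions_sq_int_lborel[OF T]
    have g: "grad_sq (\<lambda>x. \<phi> m x + \<phi> n x) + grad_sq (\<lambda>x. \<phi> m x - \<phi> n x) = 2 * grad_sq (\<phi> m) + 2 * grad_sq (\<phi> n)"
      using grad_sq_add_scaled[OF T T, of m 1 n] grad_sq_add_scaled[OF T T, of m "-1" n] by simp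
    have h: "(nrm lborel (\<lambda>x. \<phi> m x + \<phi> n x))\<^sup>2 + (nrm lborel (\<lambda>x. \<phi> m x - \<phi> n x))\<^sup>2 = 4"
      using nrm_add_scaled_sq[OF s s, of m 1 n] nrm_add_scaled_sq[OF s s, of m "-1" n] N by simp
    have "\<Lambda> * (nrm lborel (\<lambda>x. \<phi> m x + \<phi> n x))\<^sup>2 \<le> grad_sq (\<lambda>x. \<phi> m x + \<phi> n x)"
      unfolding \<Lambda>_def by (rule rayleigh_inf_le[OF test_functions_add[OF T T]])
    moreover have "(nrm lborel (\<lambda>x. \<phi> m x + \<phi> n x))\<^sup>2 = 4 - (nrm lborel (\<lambda>x. \<phi> m x - \<phi> n x))\<^sup>2"
      using h by linarith
    ultimately have "\<Lambda> * (4 - (nrm lborel (\<lambda>x. \<phi> m x - \<phi> n x))\<^sup>2) \<le> grad_sq (\<lambda>x. \<phi> m x + \<phi> n x)" by simp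
    then show ?thesis using g by (simp add: algebra_simps)
  qed
  have cau: "\<exists>K. \<forall>m\<ge>K. \<forall>n\<ge>K. nrm lborel (\<lambda>x. \<phi> m x - \<phi> n x) < e \<and> grad_sq (\<lambda>x. \<phi> m x - \<phi> n x) < e\<^sup>2"
    if e: "e > 0" for e
  proof -
    \<comment> \<open>Forces \<open>\<Lambda> * c\<^sup>2 \<le> e\<^sup>2 / 4\<close>, with
      \<open>\<Lambda> + 1\<close> in the denominator to admit \<open>\<Lambda> = 0\<close>. The two
      excesses below \<open>e\<^sup>2 / 8\<close> add less than \<open>e\<^sup>2 / 2\<close>, so the
      total stays below \<open>e\<^sup>2\<close>.\<close>
    define c where "c = min e (e / (2 * (\<Lambda> + 1)))"
    have c: "c > 0" using e \<Lambda>0 by (simp add: c_def)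
    have c2: "\<Lambda> * c\<^sup>2 \<le> e\<^sup>2 / 4"
    proof -
      have "c \<le> e / (2 * (\<Lambda> + 1))" by (simp add: c_def)
      then have "c\<^sup>2 \<le> (e / (2 * (\<Lambda> + 1)))\<^sup>2" using c by (intro power_mono) auto
      then have "\<Lambda> * c\<^sup>2 \<le> \<Lambda> * (e / (2 * (\<Lambda> + 1)))\<^sup>2" using \<Lambda>0 by (rule mult_left_mono)
      also have "\<Lambda> * (e / (2 * k))\<^sup>2 = \<Lambda> / k\<^sup>2 * (e\<^sup>2 / 4)" for k
        by (simp add: power_divide power_mult_distrib)
      also have "\<Lambda> \<le> (\<Lambda> + 1)\<^sup>2" using \<Lambda>0 by (simp add: power2_sum)
      then have "(\<Lambda> / (\<Lambda> + 1)\<^sup>2) * (e\<^sup>2 / 4) \<le> 1 * (e\<^sup>2 / 4)" using \<Lambda>0 by (intro mult_right_mono) auto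
      finally show ?thesis by simp
    qed
    obtain K1 where K1: "\<And>m n. m \<ge> K1 \<Longrightarrow> n \<ge> K1 \<Longrightarrow> nrm lborel (\<lambda>x. \<phi> m x - \<phi> n x) < c"
      using rc[OF c] unfolding \<phi>_def by blast
    obtain K2 where K2: "8 / e\<^sup>2 < real K2" using reals_Archimedean2 by blast
    have "nrm lborel (\<lambda>x. \<phi> m x - \<phi> n x) < e \<and> grad_sq (\<lambda>x. \<phi> m x - \<phi> n x) < e\<^sup>2"
      if mn: "m \<ge> max K1 K2" "n \<ge> max K1 K2" for m n
    proof
      have d: "nrm lborel (\<lambda>x. \<phi> m x - \<phi> n x) < c" using K1 mn by simp
      then show "nrm lborel (\<lambda>x. \<phi> m x - \<phi> n x) < e" by (simp add: c_def)
      have "(nrm lborel (\<lambda>x. \<phi> m x - \<phi> n x))\<^sup>2 \<le> c\<^sup>2" using d by (intro power_mono) auto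
      then have "\<Lambda> * (nrm lborel (\<lambda>x. \<phi> m x - \<phi> n x))\<^sup>2 \<le> \<Lambda> * c\<^sup>2" using \<Lambda>0 by (rule mult_left_mono)
      moreover have "1 / real (Suc k) < e\<^sup>2 / 8" if "k \<ge> K2" for k
      proof -
        have "8 / e\<^sup>2 < real (Suc k)" using K2 that by simp
        then show ?thesis using e by (simp add: pos_divide_less_eq field_simps)
      qed
      then have "grad_sq (\<phi> m) - \<Lambda> < e\<^sup>2 / 8" "grad_sq (\<phi> n) - \<Lambda> < e\<^sup>2 / 8"
        using G[of m] G[of n] mn by fastforce+
      moreover have "x < E" if "x \<le> 2 * a + 2 * b + p" "p \<le> q" "a < E / 8" "b < E / 8" "q \<le> E / 4" "0 < E"
        for x a b p q E :: real using that by linarith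
      ultimately show "grad_sq (\<lambda>x. \<phi> m x - \<phi> n x) < e\<^sup>2"
        using par[of m n] c2 zero_less_power[OF e, of 2] by blast
    qed
    then show ?thesis by blast
  qed
  have pdd: "partial_deriv b (\<lambda>x. \<phi> m x - \<phi> n x) = (\<lambda>x. partial_deriv b (\<phi> m) x - partial_deriv b (\<phi> n) x)" for b m n
    by (rule ext) (rule partial_deriv_diff_test[OF T T])
  have Td: "(\<lambda>x. \<phi> m x - \<phi> n x) \<in> test_functions \<omega>" for m n by (intro test_functions_diff T)
  let ?L = "lebesgue_on \<omega>"
  have sq: "sq_int ?L (\<phi> n)" "b \<in> Basis \<Longrightarrow> sq_int ?L (partial_deriv b (\<phi> n))" for b n
    using test_functions_sq_int[OF T S] test_functions_sq_int[OF test_functions_partial_deriv[OF T] S] by blast+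
  obtain u where u: "sq_int ?L u" "(\<lambda>n. nrm ?L (\<lambda>x. \<phi> n x - u x)) \<longlonglongrightarrow> 0"
  proof (rule sq_int_complete[of ?L \<phi>])
    show "\<exists>K. \<forall>m\<ge>K. \<forall>n\<ge>K. nrm ?L (\<lambda>x. \<phi> m x - \<phi> n x) < e" if "e > 0" for e
      using cau[OF that] test_functions_nrm[OF Td S] by metis
  qed (use sq in auto)
  have "\<exists>g. sq_int ?L g \<and> (\<lambda>n. nrm ?L (\<lambda>x. partial_deriv b (\<phi> n) x - g x)) \<longlonglongrightarrow> 0" if b: "b \<in> Basis" for b
  proof -
    have c: "\<exists>K. \<forall>m\<ge>K. \<forall>n\<ge>K. nrm ?L (\<lambda>x. partial_deriv b (\<phi> m) x - partial_deriv b (\<phi> n) x) < e" if e: "e > 0" for e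
    proof -
      obtain K where K: "\<And>m n. m \<ge> K \<Longrightarrow> n \<ge> K \<Longrightarrow> grad_sq (\<lambda>x. \<phi> m x - \<phi> n x) < e\<^sup>2"
        using cau[OF e] by blast
      have "nrm ?L (\<lambda>x. partial_deriv b (\<phi> m) x - partial_deriv b (\<phi> n) x) < e" if "m \<ge> K" "n \<ge> K" for m n
      proof -
        have "(nrm lborel (partial_deriv b (\<lambda>x. \<phi> m x - \<phi> n x)))\<^sup>2 \<le> grad_sq (\<lambda>x. \<phi> m x - \<phi> n x)"
          unfolding grad_sq_def using b by (intro member_le_sum) auto
        then have "(nrm lborel (partial_deriv b (\<lambda>x. \<phi> m x - \<phi> n x)))\<^sup>2 < e\<^sup>2" using K[OF that] by linarith
        then have "nrm lborel (partial_deriv b (\<lambda>x. \<phi> m x - \<phi> n x)) < e"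
          by (rule power2_less_imp_less) (use e in simp)
        then show ?thesis using test_functions_nrm[OF test_functions_partial_deriv[OF Td b] S]
          unfolding pdd by simp
      qed
      then show ?thesis by blast
    qed
    show ?thesis by (rule sq_int_complete[of ?L "\<lambda>n. partial_deriv b (\<phi> n)"]) (use sq b c in blast)+
  qed
  then have "\<forall>b\<in>Basis. \<exists>g. sq_int ?L g \<and> (\<lambda>n. nrm ?L (\<lambda>x. partial_deriv b (\<phi> n) x - g x)) \<longlonglongrightarrow> 0"
    by (rule ballI)
  then obtain g where "\<forall>b\<in>Basis. sq_int ?L (g b) \<and> (\<lambda>n. nrm ?L (\<lambda>x. partial_deriv b (\<phi> n) x - g b x)) \<longlonglongrightarrow> 0"
    by (rule bchoice[THEN exE])
  then have g: "\<And>b. b \<in> Basis \<Longrightarrow> sq_int ?L (g b)"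
    "\<And>b. b \<in> Basis \<Longrightarrow> (\<lambda>n. nrm ?L (\<lambda>x. partial_deriv b (\<phi> n) x - g b x)) \<longlonglongrightarrow> 0"
    by (auto dest: bspec)
  have approx: "\<exists>\<eta>\<in>test_functions \<omega>. nrm ?L (\<lambda>x. u x - \<eta> x) < e \<and>
       (\<forall>b\<in>Basis. nrm ?L (\<lambda>x. g b x - partial_deriv b \<eta> x) < e)" if e: "e > 0" for e
  proof -
    have "\<forall>\<^sub>F n in sequentially. nrm ?L (\<lambda>x. \<phi> n x - u x) < e"
      using order_tendstoD(2)[OF u(2) e] .
    moreover have "\<forall>\<^sub>F n in sequentially. \<forall>b\<in>Basis. nrm ?L (\<lambda>x. partial_deriv b (\<phi> n) x - g b x) < e"
      using order_tendstoD(2)[OF g(2) e] by (intro eventually_ball_finite) auto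
    ultimately have "\<forall>\<^sub>F n in sequentially. nrm ?L (\<lambda>x. \<phi> n x - u x) < e \<and>
        (\<forall>b\<in>Basis. nrm ?L (\<lambda>x. partial_deriv b (\<phi> n) x - g b x) < e)" by eventually_elim simp
    then obtain n where "nrm ?L (\<lambda>x. \<phi> n x - u x) < e \<and>
        (\<forall>b\<in>Basis. nrm ?L (\<lambda>x. partial_deriv b (\<phi> n) x - g b x) < e)"
      using eventually_happens'[OF sequentially_bot] by blast
    then show ?thesis
      using nrm_diff_commute[of ?L u "\<phi> n"] nrm_diff_commute[of ?L "g _" "partial_deriv _ (\<phi> n)"]
      by (intro bexI[OF _ T[of n]]) auto
  qed
  have uH: "u \<in> H10 \<omega>" by (rule H10I(1)[OF \<omega>(1) u(1) g(1) approx])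
  have wp: "has_weak_partial \<omega> b u (g b)" if "b \<in> Basis" for b
    by (rule H10I(2)[OF \<omega>(1) u(1) g(1) approx that])
  have wl: "(\<lambda>n. nrm ?L (\<lambda>x. partial_deriv b (\<phi> n) x - weak_partial \<omega> b u x)) \<longlonglongrightarrow> 0" if b: "b \<in> Basis" for b
  proof -
    have w: "has_weak_partial \<omega> b u (weak_partial \<omega> b u)" by (rule H10_weak_partial[OF uH b])
    have sw: "sq_int ?L (weak_partial \<omega> b u)" by (rule has_weak_partial_sq_int[OF w])
    have ae: "AE x in ?L. weak_partial \<omega> b u x = g b x" by (rule has_weak_partial_unique[OF \<omega>(1) w wp[OF b]])
    have "nrm ?L (\<lambda>x. partial_deriv b (\<phi> n) x - weak_partial \<omega> b u x) = nrm ?L (\<lambda>x. partial_deriv b (\<phi> n) x - g b x)" for n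
    proof (rule nrm_AE_cong)
      show "AE x in ?L. partial_deriv b (\<phi> n) x - weak_partial \<omega> b u x = partial_deriv b (\<phi> n) x - g b x"
        using ae by eventually_elim simp
    qed (use sw g(1)[OF b] sq(2)[OF b, of n] in \<open>auto intro!: borel_measurable_diff sq_int_measurable\<close>)
    then show ?thesis using g(2)[OF b] by simp
  qed
  have un: "nrm ?L u = 1"
  proof -
    have "(\<lambda>n. nrm ?L (\<phi> n)) \<longlonglongrightarrow> nrm ?L u" by (rule nrm_tendsto[OF sq(1) u(1,2)])
    moreover have "nrm ?L (\<phi> n) = 1" for n using test_functions_nrm[OF T S] N by simp
    ultimately show ?thesis by (simp add: LIMSEQ_const_iff)
  qed
  have gl: "(\<lambda>n. grad_sq (\<phi> n) - rayleigh_inf \<omega> * (nrm lborel (\<phi> n))\<^sup>2) \<longlonglongrightarrow> 0"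
    unfolding N \<Lambda>_def[symmetric]
    by (rule tendsto_sandwich[OF _ _ tendsto_const LIMSEQ_Suc[OF lim_1_over_n]])
       (use G1 G in \<open>auto intro!: always_eventually simp: algebra_simps less_imp_le simp del: of_nat_Suc\<close>)
  have "\<forall>b\<in>Basis. (\<lambda>n. nrm ?L (\<lambda>x. partial_deriv b (\<phi> n) x - weak_partial \<omega> b u x)) \<longlonglongrightarrow> 0"
    using wl by (rule ballI)
  from that[OF uH un T u(2) this gl] show ?thesis .
qed

lemma rayleigh_eigenvalue:
  fixes \<omega> :: "(real \<times> real) set"
  assumes \<omega>: "open \<omega>" "\<omega> \<noteq> {}" "bounded \<omega>"
  shows "dirichlet_eigenvalue \<omega> (rayleigh_inf \<omega>)"
proof -
  define \<Lambda> where "\<Lambda> = rayleigh_inf \<omega>"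
  let ?L = "lebesgue_on \<omega>"
  have S: "\<omega> \<in> sets lebesgue" using \<omega>(1) by simp
  obtain u \<phi> where u: "u \<in> H10 \<omega>" "nrm ?L u = 1" and T: "\<And>n. \<phi> n \<in> test_functions \<omega>"
    and l0: "(\<lambda>n. nrm ?L (\<lambda>x. \<phi> n x - u x)) \<longlonglongrightarrow> 0"
    and l1': "\<forall>b\<in>Basis. (\<lambda>n. nrm ?L (\<lambda>x. partial_deriv b (\<phi> n) x - weak_partial \<omega> b u x)) \<longlonglongrightarrow> 0"
    and q0: "(\<lambda>n. grad_sq (\<phi> n) - \<Lambda> * (nrm lborel (\<phi> n))\<^sup>2) \<longlonglongrightarrow> 0"
    by (rule rayleigh_minimiser[OF \<omega>, folded \<Lambda>_def]) (rule that)
  note l1 = bspec[OF l1']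
  have su: "sq_int ?L u" by (rule H10_sq_int[OF u(1)])
  have sw: "sq_int ?L (weak_partial \<omega> b v)" if "b \<in> Basis" "v \<in> H10 \<omega>" for b v
    using has_weak_partial_sq_int(2)[OF H10_weak_partial[OF that(2,1)]] .
  have st: "sq_int ?L \<eta>" "b \<in> Basis \<Longrightarrow> sq_int ?L (partial_deriv b \<eta>)" if "\<eta> \<in> test_functions \<omega>" for b \<eta>
    using test_functions_sq_int[OF that S] test_functions_sq_int[OF test_functions_partial_deriv[OF that] S] by blast+
  define B where "B f g \<eta> = (\<Sum>b\<in>Basis. ip ?L (g b) (partial_deriv b \<eta>)) - complex_of_real \<Lambda> * ip ?L f \<eta>" for f g \<eta>
  have Blim: "(\<lambda>n. B (\<phi> n) (\<lambda>b. partial_deriv b (\<phi> n)) \<eta>) \<longlonglongrightarrow> B u (\<lambda>b. weak_partial \<omega> b u) \<eta>"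
    if \<eta>: "\<eta> \<in> test_functions \<omega>" for \<eta>
    unfolding B_def
    by (intro tendsto_diff tendsto_sum tendsto_mult tendsto_const ip_tendsto_left l0 l1 st T sw u(1) su \<eta>)
  have Re0: "Re (B u (\<lambda>b. weak_partial \<omega> b u) \<eta>) = 0" if \<eta>: "\<eta> \<in> test_functions \<omega>" for \<eta>
  proof -
    define q where "q \<psi> = grad_sq \<psi> - \<Lambda> * (nrm lborel \<psi>)\<^sup>2" for \<psi> :: "real \<times> real \<Rightarrow> complex"
    have qn: "0 \<le> q \<psi>" if "\<psi> \<in> test_functions \<omega>" for \<psi>
      using rayleigh_inf_le[OF that] by (simp add: q_def \<Lambda>_def)
    \<comment> \<open>Cauchy-Schwarz for the nonnegative form \<open>q\<close>, read off from its
      values at \<open>\<phi> n + t * \<eta>\<close>. As \<open>q (\<phi> n)\<close> tends to 0, the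
      limit satisfies the weak equation against \<open>\<eta>\<close>.\<close>
    have b2: "(Re (B (\<phi> n) (\<lambda>b. partial_deriv b (\<phi> n)) \<eta>))\<^sup>2 \<le> q (\<phi> n) * q \<eta>" for n
    proof (rule quadratic_nonneg_imp)
      fix t :: real
      have "0 \<le> q (\<lambda>x. \<phi> n x + complex_of_real t * \<eta> x)"
        by (intro qn test_functions_add test_functions_cmult T \<eta>)
      also have "\<dots> = q (\<phi> n) + 2 * t * Re (B (\<phi> n) (\<lambda>b. partial_deriv b (\<phi> n)) \<eta>) + t\<^sup>2 * q \<eta>"
      proof -
        have i: "(\<Sum>b\<in>Basis. ip ?L (partial_deriv b (\<phi> n)) (partial_deriv b \<eta>)) =
           (\<Sum>b\<in>Basis. ip lborel (partial_deriv b (\<phi> n)) (partial_deriv b \<eta>))" "ip ?L (\<phi> n) \<eta> = ip lborel (\<phi> n) \<eta>"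
          using ip_test_lebesgue_on[OF T \<eta> S] ip_test_lebesgue_on[OF test_functions_partial_deriv[OF T] test_functions_partial_deriv[OF \<eta>] S]
          by auto
        show ?thesis
          unfolding q_def B_def i grad_sq_add_scaled[OF T \<eta>]
            nrm_add_scaled_sq[OF test_functions_sq_int_lborel[OF T] test_functions_sq_int_lborel[OF \<eta>]]
          by (simp add: algebra_simps del: Re_sum)
      qed
      finally show "0 \<le> q (\<phi> n) + 2 * t * Re (B (\<phi> n) (\<lambda>b. partial_deriv b (\<phi> n)) \<eta>) + t\<^sup>2 * q \<eta>" .
    qed (use qn T \<eta> in auto)
    have "(\<lambda>n. q (\<phi> n) * q \<eta>) \<longlonglongrightarrow> 0 * q \<eta>"
      using q0 unfolding q_def by (intro tendsto_mult tendsto_const)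
    then have z: "(\<lambda>n. q (\<phi> n) * q \<eta>) \<longlonglongrightarrow> 0" by simp
    have "(\<lambda>n. (Re (B (\<phi> n) (\<lambda>b. partial_deriv b (\<phi> n)) \<eta>))\<^sup>2) \<longlonglongrightarrow> 0"
      by (rule tendsto_sandwich[OF _ _ tendsto_const z]) (use b2 in auto)
    moreover have "(\<lambda>n. (Re (B (\<phi> n) (\<lambda>b. partial_deriv b (\<phi> n)) \<eta>))\<^sup>2) \<longlonglongrightarrow> (Re (B u (\<lambda>b. weak_partial \<omega> b u) \<eta>))\<^sup>2"
      by (intro tendsto_power tendsto_Re Blim \<eta>)
    ultimately have "(Re (B u (\<lambda>b. weak_partial \<omega> b u) \<eta>))\<^sup>2 = 0" using LIMSEQ_unique by blast
    then show ?thesis by simp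
  qed
  \<comment> \<open>Real \<open>t\<close> only reaches the real part; replacing
    \<open>\<eta>\<close> by \<open>\<i> * \<eta>\<close> turns the imaginary part into a real
    one.\<close>
  have B0: "B u (\<lambda>b. weak_partial \<omega> b u) \<eta> = 0" if \<eta>: "\<eta> \<in> test_functions \<omega>" for \<eta>
  proof -
    have pd: "partial_deriv b (\<lambda>x. \<i> * \<eta> x) = (\<lambda>x. \<i> * partial_deriv b \<eta> x)" for b
      using partial_deriv_cmult[OF test_functions_differentiable[OF \<eta>]] by blast
    have ii: "ip ?L f (\<lambda>x. \<i> * g x) = - \<i> * ip ?L f g" for f g
      unfolding ip_def by (subst integral_mult_right_zero[symmetric]) (simp add: mult_ac)
    have "B u (\<lambda>b. weak_partial \<omega> b u) (\<lambda>x. \<i> * \<eta> x) = - \<i> * B u (\<lambda>b. weak_partial \<omega> b u) \<eta>"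
      unfolding B_def pd ii by (simp add: sum_distrib_left right_diff_distrib mult_ac sum_negf)
    then have "Im (B u (\<lambda>b. weak_partial \<omega> b u) \<eta>) = 0"
      using Re0[OF test_functions_cmult[OF \<eta>, of \<i>]] by simp
    then show ?thesis using Re0[OF \<eta>] by (simp add: complex_eq_iff)
  qed
  have eq: "(\<Sum>b\<in>Basis. ip ?L (weak_partial \<omega> b u) (weak_partial \<omega> b v)) = complex_of_real \<Lambda> * ip ?L u v" if v: "v \<in> H10 \<omega>" for v
  proof -
    obtain \<eta> where \<eta>: "\<And>n. \<eta> n \<in> test_functions \<omega>" and m0: "(\<lambda>n. nrm ?L (\<lambda>x. \<eta> n x - v x)) \<longlonglongrightarrow> 0"
      and m1': "\<forall>b\<in>Basis. (\<lambda>n. nrm ?L (\<lambda>x. partial_deriv b (\<eta> n) x - weak_partial \<omega> b v x)) \<longlonglongrightarrow> 0"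
      by (rule H10_approx_seq[OF \<omega>(1) v]) (rule that)
    note m1 = bspec[OF m1']
    have "(\<lambda>n. B u (\<lambda>b. weak_partial \<omega> b u) (\<eta> n)) \<longlonglongrightarrow>
       (\<Sum>b\<in>Basis. ip ?L (weak_partial \<omega> b u) (weak_partial \<omega> b v)) - complex_of_real \<Lambda> * ip ?L u v"
      unfolding B_def
      by (intro tendsto_diff tendsto_sum tendsto_mult tendsto_const ip_tendsto_right m0 m1 st \<eta> sw u(1) v su H10_sq_int)
    then show ?thesis unfolding B0[OF \<eta>] by (simp add: LIMSEQ_const_iff)
  qed
  have "dirichlet_laplacian \<omega> u (\<lambda>x. complex_of_real \<Lambda> * u x)"
    unfolding dirichlet_laplacian_def mem_L2_iff
  proof (intro conjI ballI u(1) sq_int_cmult su)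
    fix v assume "v \<in> H10 \<omega>"
    from eq[OF this] show "(\<Sum>b\<in>Basis. \<integral>x. weak_partial \<omega> b u x * cnj (weak_partial \<omega> b v x) \<partial>?L)
       = (\<integral>x. complex_of_real \<Lambda> * u x * cnj (v x) \<partial>?L)"
      by (simp add: ip_def mult.assoc)
  qed
  moreover have "\<not> L2_zero \<omega> u"
    using nrm_eq_0_iff[OF su] u(2) by (simp add: L2_zero_def)
  ultimately show ?thesis unfolding dirichlet_eigenvalue_def \<Lambda>_def by blast
qed

text \<open>Tested with \<open>u\<close> itself the eigenvalue equation says that the Rayleigh
  quotient of \<open>u\<close> is \<open>e\<close>; the Rayleigh bound extends from test functions
  to \<open>u\<close> by approximation.\<close>

lemma dirichlet_eigenvalue_ge:
  assumes \<omega>: "open \<omega>" and e: "dirichlet_eigenvalue \<omega> e"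
  shows "rayleigh_inf \<omega> \<le> e"
proof -
  let ?L = "lebesgue_on \<omega>"
  have S: "\<omega> \<in> sets lebesgue" using \<omega> by simp
  obtain u where u0: "\<not> L2_zero \<omega> u" and d: "dirichlet_laplacian \<omega> u (\<lambda>x. complex_of_real e * u x)"
    using e by (auto simp: dirichlet_eigenvalue_def)
  have u: "u \<in> H10 \<omega>" using d by (simp add: dirichlet_laplacian_def)
  have su: "sq_int ?L u" by (rule H10_sq_int[OF u])
  have sw: "sq_int ?L (weak_partial \<omega> b u)" if "b \<in> Basis" for b
    using has_weak_partial_sq_int(2)[OF H10_weak_partial[OF u that]] .
  have "(\<Sum>b\<in>Basis. ip ?L (weak_partial \<omega> b u) (weak_partial \<omega> b u)) = complex_of_real e * ip ?L u u"
    using d u by (simp add: dirichlet_laplacian_def ip_def mult.assoc)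
  then have "complex_of_real (\<Sum>b\<in>Basis. (nrm ?L (weak_partial \<omega> b u))\<^sup>2) = complex_of_real (e * (nrm ?L u)\<^sup>2)"
    by (simp add: ip_self)
  then have eq: "(\<Sum>b\<in>Basis. (nrm ?L (weak_partial \<omega> b u))\<^sup>2) = e * (nrm ?L u)\<^sup>2"
    by (simp only: of_real_eq_iff)
  obtain \<phi> where T: "\<And>n. \<phi> n \<in> test_functions \<omega>" and l0: "(\<lambda>n. nrm ?L (\<lambda>x. \<phi> n x - u x)) \<longlonglongrightarrow> 0"
    and l1': "\<forall>b\<in>Basis. (\<lambda>n. nrm ?L (\<lambda>x. partial_deriv b (\<phi> n) x - weak_partial \<omega> b u x)) \<longlonglongrightarrow> 0"
    by (rule H10_approx_seq[OF \<omega> u]) (rule that)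
  note l1 = bspec[OF l1']
  note st = test_functions_sq_int[OF T S] test_functions_sq_int[OF test_functions_partial_deriv[OF T] S]
  have "(\<lambda>n. rayleigh_inf \<omega> * (nrm ?L (\<phi> n))\<^sup>2) \<longlonglongrightarrow> rayleigh_inf \<omega> * (nrm ?L u)\<^sup>2"
    by (intro tendsto_intros nrm_tendsto st su l0)
  moreover have "(\<lambda>n. \<Sum>b\<in>Basis. (nrm ?L (partial_deriv b (\<phi> n)))\<^sup>2) \<longlonglongrightarrow> (\<Sum>b\<in>Basis. (nrm ?L (weak_partial \<omega> b u))\<^sup>2)"
    by (intro tendsto_intros nrm_tendsto st sw l1)
  moreover have "rayleigh_inf \<omega> * (nrm ?L (\<phi> n))\<^sup>2 \<le> (\<Sum>b\<in>Basis. (nrm ?L (partial_deriv b (\<phi> n)))\<^sup>2)" for n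
    using rayleigh_inf_le[OF T[of n]] test_functions_nrm[OF T[of n] S]
      test_functions_nrm[OF test_functions_partial_deriv[OF T[of n]] S] by (simp add: grad_sq_def)
  ultimately have "rayleigh_inf \<omega> * (nrm ?L u)\<^sup>2 \<le> e * (nrm ?L u)\<^sup>2"
    unfolding eq[symmetric] by (intro LIMSEQ_le) auto
  moreover have "nrm ?L u \<noteq> 0" using nrm_eq_0_iff[OF su] u0 by (simp add: L2_zero_def)
  ultimately show ?thesis by simp
qed

lemma first_dirichlet_eigenvalue_eq:
  fixes \<omega> :: "(real \<times> real) set"
  assumes "open \<omega>" "\<omega> \<noteq> {}" "bounded \<omega>"
  shows "first_dirichlet_eigenvalue \<omega> = rayleigh_inf \<omega>"
  unfolding first_dirichlet_eigenvalue_def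
  using rayleigh_eigenvalue[OF assms] dirichlet_eigenvalue_ge[OF assms(1)] by (rule Least_equality)

subsection \<open>The geometry of the tube\<close>

lemma nn_integral_translate:
  fixes f :: "real \<Rightarrow> ennreal"
  assumes "f \<in> borel_measurable borel"
  shows "(\<integral>\<^sup>+x. f (x + c) \<partial>lborel) = (\<integral>\<^sup>+x. f x \<partial>lborel)"
  using nn_integral_real_affine[OF assms, of 1 c] by (simp add: add.commute)

lemma borel_measurable_compose_continuous:
  assumes "f \<in> borel_measurable borel" "continuous_on UNIV g"
  shows "(\<lambda>x. f (g x)) \<in> borel_measurable borel"
  using measurable_compose[OF borel_measurable_continuous_onI[OF assms(2)] assms(1)] .

lemma nn_integral_shear1:
  fixes f :: "real \<times> real \<Rightarrow> ennreal"
  assumes f: "f \<in> borel_measurable borel"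
  shows "(\<integral>\<^sup>+y. f (fst y + t * snd y, snd y) \<partial>lborel) = (\<integral>\<^sup>+y. f y \<partial>lborel)"
proof -
  have "(\<lambda>y. f (fst y + t * snd y, snd y)) \<in> borel_measurable borel"
    by (rule borel_measurable_compose_continuous[OF f]) (intro continuous_intros)
  moreover have "(\<lambda>x. f (x, y)) \<in> borel_measurable borel" for y
    by (rule borel_measurable_compose_continuous[OF f]) (intro continuous_intros)
  ultimately show ?thesis
    by (simp add: nn_integral_lborel_pair_swap f nn_integral_translate[of "\<lambda>x. f (x, _)"])
qed

lemma nn_integral_shear2:
  fixes f :: "real \<times> real \<Rightarrow> ennreal"
  assumes f: "f \<in> borel_measurable borel"
  shows "(\<integral>\<^sup>+y. f (fst y, snd y + t * fst y) \<partial>lborel) = (\<integral>\<^sup>+y. f y \<partial>lborel)"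
proof -
  have "(\<lambda>y. f (fst y, snd y + t * fst y)) \<in> borel_measurable borel"
    by (rule borel_measurable_compose_continuous[OF f]) (intro continuous_intros)
  moreover have "(\<lambda>y. f (x, y)) \<in> borel_measurable borel" for x
    by (rule borel_measurable_compose_continuous[OF f]) (intro continuous_intros)
  ultimately show ?thesis
    by (simp add: nn_integral_lborel_pair f nn_integral_translate[of "\<lambda>y. f (_, y)"])
qed

text \<open>The rotation by a half turn, which the decomposition into shears does not reach because
  its sine is zero.\<close>

lemma nn_integral_uminus_pair:
  fixes f :: "real \<times> real \<Rightarrow> ennreal"
  assumes f: "f \<in> borel_measurable borel"
  shows "(\<integral>\<^sup>+y. f (- y) \<partial>lborel) = (\<integral>\<^sup>+y. f y \<partial>lborel)"
proof -
  have m: "(\<lambda>y. f (- y)) \<in> borel_measurable borel"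
    by (rule borel_measurable_compose_continuous[OF f]) (intro continuous_intros)
  have m1: "(\<lambda>y. f (x, y)) \<in> borel_measurable borel" for x
    by (rule borel_measurable_compose_continuous[OF f]) (intro continuous_intros)
  have m2: "(\<lambda>x. \<integral>\<^sup>+y. f (x, y) \<partial>lborel) \<in> borel_measurable borel"
    using lborel.borel_measurable_nn_integral_fst[of f lborel] f by (simp add: lborel_prod)
  have "(\<integral>\<^sup>+y. f (- y) \<partial>lborel) = (\<integral>\<^sup>+x. \<integral>\<^sup>+y. f (- x, - y) \<partial>lborel \<partial>lborel)"
    by (simp add: nn_integral_lborel_pair m)
  also have "\<dots> = (\<integral>\<^sup>+x. \<integral>\<^sup>+y. f (- x, y) \<partial>lborel \<partial>lborel)"
    using nn_integral_real_affine[OF m1, where c = "-1" and t = 0] by simp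
  also have "\<dots> = (\<integral>\<^sup>+x. \<integral>\<^sup>+y. f (x, y) \<partial>lborel \<partial>lborel)"
    using nn_integral_real_affine[OF m2, where c = "-1" and t = 0] by simp
  finally show ?thesis by (simp add: nn_integral_lborel_pair f)
qed

text \<open>A rotation with \<open>s \<noteq> 0\<close> is the product of three shears, with parameter \<open>p = (1 - c) / s\<close> for the outer two.\<close>

lemma nn_integral_rotation:
  fixes f :: "real \<times> real \<Rightarrow> ennreal"
  assumes f: "f \<in> borel_measurable borel" and cs: "c\<^sup>2 + s\<^sup>2 = 1"
  shows "(\<integral>\<^sup>+y. f (fst y * c + snd y * s, - fst y * s + snd y * c) \<partial>lborel) = (\<integral>\<^sup>+y. f y \<partial>lborel)"
proof (cases "s = 0")
  case True
  then have "c = 1 \<or> c = - 1" using cs by (simp add: power2_eq_1_iff)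
  then show ?thesis
  proof
    assume "c = - 1"
    then show ?thesis using nn_integral_uminus_pair[OF f] True by (simp add: uminus_prod_def)
  qed (use True in simp)
next
  case False
  define p where "p = (1 - c) / s"
  have p: "p * s = 1 - c" using False by (simp add: p_def)
  have p2: "p + p * c = s"
  proof -
    have "s * (p + p * c) = (p * s) * (1 + c)" by (simp add: algebra_simps)
    also have "\<dots> = s * s" unfolding p using cs by (simp add: algebra_simps power2_eq_square)
    finally show ?thesis using False by simp
  qed
  define g where "g = (\<lambda>y::real\<times>real. f (fst y + p * snd y, snd y))"
  define h where "h = (\<lambda>y::real\<times>real. g (fst y, snd y + (- s) * fst y))"
  have g: "g \<in> borel_measurable borel" unfolding g_def
    by (rule borel_measurable_compose_continuous[OF f]) (intro continuous_intros)
  have h: "h \<in> borel_measurable borel" unfolding h_def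
    by (rule borel_measurable_compose_continuous[OF g]) (intro continuous_intros)
  have "f (fst y * c + snd y * s, - fst y * s + snd y * c) = h (fst y + p * snd y, snd y)" for y
  proof -
    have "fst y * c + snd y * s = fst y + p * snd y + p * (snd y + - s * (fst y + p * snd y))"
    proof -
      have "fst y + p * snd y + p * (snd y + - s * (fst y + p * snd y))
         = fst y * (1 - p * s) + snd y * (p + p * (1 - p * s))" by (simp add: algebra_simps)
      then show ?thesis by (simp add: p p2)
    qed
    moreover have "- fst y * s + snd y * c = snd y + - s * (fst y + p * snd y)"
    proof -
      have "snd y + - s * (fst y + p * snd y) = - fst y * s + snd y * (1 - p * s)" by (simp add: algebra_simps)
      then show ?thesis by (simp add: p)
    qed
    ultimately show ?thesis by (simp add: h_def g_def)
  qed
  then have "(\<integral>\<^sup>+y. f (fst y * c + snd y * s, - fst y * s + snd y * c) \<partial>lborel) = (\<integral>\<^sup>+y. h (fst y + p * snd y, snd y) \<partial>lborel)"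
    by simp
  also have "\<dots> = (\<integral>\<^sup>+y. h y \<partial>lborel)" by (rule nn_integral_shear1[OF h])
  also have "\<dots> = (\<integral>\<^sup>+y. g y \<partial>lborel)" unfolding h_def by (rule nn_integral_shear2[OF g])
  also have "\<dots> = (\<integral>\<^sup>+y. f y \<partial>lborel)" unfolding g_def by (rule nn_integral_shear1[OF f])
  finally show ?thesis .
qed

section \<open>The twist map and its inverse\<close>

lemma twist_map_eq:
  "twist_map \<theta> (x, y) = (x, fst y * cos (\<theta> x) + snd y * sin (\<theta> x), - fst y * sin (\<theta> x) + snd y * cos (\<theta> x))"
  by (cases y) (simp add: twist_map_def)

lemma continuous_twist_map:
  assumes "continuous_on UNIV \<theta>" shows "continuous_on UNIV (twist_map \<theta>)"
proof -
  have "twist_map \<theta> = (\<lambda>z. (fst z, fst (snd z) * cos (\<theta> (fst z)) + snd (snd z) * sin (\<theta> (fst z)),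
     - fst (snd z) * sin (\<theta> (fst z)) + snd (snd z) * cos (\<theta> (fst z))))"
    by (auto simp: twist_map_def)
  moreover have "continuous_on UNIV (\<lambda>z :: real \<times> real \<times> real. \<theta> (fst z))"
    by (rule continuous_on_compose2[OF assms]) (auto intro: continuous_intros)
  ultimately show ?thesis by (auto intro!: continuous_intros)
qed

text \<open>The first coordinate is preserved, so both maps rotate the same cross-section, by
  opposite angles.\<close>

lemma twist_map_inverse:
  "twist_map \<theta> (twist_map (\<lambda>x. - \<theta> x) z) = z" "twist_map (\<lambda>x. - \<theta> x) (twist_map \<theta> z) = z"
proof -
  obtain x a b where z: "z = (x, a, b)" by (cases z)
  define c s where "c = cos (\<theta> x)" and "s = sin (\<theta> x)"
  have 1: "c * c + s * s = 1" by (simp add: c_def s_def sin_cos_squared_add3)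
  have "(a * c + b * - s) * c + (- a * - s + b * c) * s = a * (c * c + s * s)"
    "- (a * c + b * - s) * s + (- a * - s + b * c) * c = b * (c * c + s * s)"
    "(a * c + b * s) * c + (- a * s + b * c) * - s = a * (c * c + s * s)"
    "- (a * c + b * s) * - s + (- a * s + b * c) * c = b * (c * c + s * s)"
    by (simp_all add: algebra_simps)
  then show "twist_map \<theta> (twist_map (\<lambda>x. - \<theta> x) z) = z" "twist_map (\<lambda>x. - \<theta> x) (twist_map \<theta> z) = z"
    unfolding z 1 mult_1_right twist_map_def prod.case cos_minus sin_minus c_def[symmetric] s_def[symmetric]
    by (simp_all only:)
qed

lemma tube_eq_vimage: "tube \<theta> \<omega> = twist_map (\<lambda>x. - \<theta> x) -` (UNIV \<times> \<omega>)"
proof (intro set_eqI iffI)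
  fix z assume "z \<in> tube \<theta> \<omega>"
  then show "z \<in> twist_map (\<lambda>x. - \<theta> x) -` (UNIV \<times> \<omega>)"
    unfolding tube_def by (auto simp: twist_map_inverse)
next
  fix z assume "z \<in> twist_map (\<lambda>x. - \<theta> x) -` (UNIV \<times> \<omega>)"
  then show "z \<in> tube \<theta> \<omega>"
    unfolding tube_def using twist_map_inverse(1)[of \<theta> z] by (metis image_eqI vimage_eq)
qed

lemma twist_map_in_tube_iff: "twist_map \<theta> (x, y) \<in> tube \<theta> \<omega> \<longleftrightarrow> y \<in> \<omega>"
  by (simp add: tube_eq_vimage twist_map_inverse)

lemma open_tube:
  assumes "continuous_on UNIV \<theta>" "open \<omega>" shows "open (tube \<theta> \<omega>)"
  unfolding tube_eq_vimage
  by (rule open_vimage) (use assms in \<open>auto intro!: open_Times continuous_twist_map continuous_intros\<close>)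

text \<open>The twist rotates each cross-section, so integrating slice by slice shows that it
  preserves volume, for every continuous angle and without a Jacobian. The second form integrates
  along the fibres first.\<close>

lemma nn_integral_twist:
  fixes f :: "real \<times> real \<times> real \<Rightarrow> ennreal"
  assumes \<theta>: "continuous_on UNIV \<theta>" and f: "f \<in> borel_measurable borel"
  shows "(\<integral>\<^sup>+x. \<integral>\<^sup>+y. f (twist_map \<theta> (x, y)) \<partial>lborel \<partial>lborel) = (\<integral>\<^sup>+z. f z \<partial>lborel)"
    and nn_integral_twist_swap: "(\<integral>\<^sup>+y. \<integral>\<^sup>+x. f (twist_map \<theta> (x, y)) \<partial>lborel \<partial>lborel) = (\<integral>\<^sup>+z. f z \<partial>lborel)"
proof -
  have m: "(\<lambda>y. f (x, y)) \<in> borel_measurable borel" for x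
    by (rule borel_measurable_compose_continuous[OF f]) (intro continuous_intros)
  have "(\<integral>\<^sup>+y. f (twist_map \<theta> (x, y)) \<partial>lborel) = (\<integral>\<^sup>+y. f (x, y) \<partial>lborel)" for x
    unfolding twist_map_eq
    by (rule nn_integral_rotation[OF m]) simp
  then show 1: "(\<integral>\<^sup>+x. \<integral>\<^sup>+y. f (twist_map \<theta> (x, y)) \<partial>lborel \<partial>lborel) = (\<integral>\<^sup>+z. f z \<partial>lborel)"
    by (simp add: nn_integral_lborel_pair f)
  have m2: "(\<lambda>z. f (twist_map \<theta> z)) \<in> borel_measurable borel"
    by (rule borel_measurable_compose_continuous[OF f continuous_twist_map[OF \<theta>]])
  show "(\<integral>\<^sup>+y. \<integral>\<^sup>+x. f (twist_map \<theta> (x, y)) \<partial>lborel \<partial>lborel) = (\<integral>\<^sup>+z. f z \<partial>lborel)"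
    using nn_integral_lborel_pair_swap[OF m2] nn_integral_lborel_pair[OF m2] 1 by simp
qed

subsection \<open>Interval estimates\<close>

lemma absorb_quarter:
  fixes K X P D Z :: real
  assumes "P \<le> K / 4 + X" "K / 2 \<le> P + (D + Z)" shows "K \<le> 4 * (X + D + Z)"
proof -
  have "K / 4 \<le> X + (D + Z)" using assms by (simp add: field_simps)
  then show ?thesis by (simp add: field_simps)
qed

text \<open>
  Poincare on an interval in a form that survives the passage from test functions \<open>u\<close> to their
  limit \<open>v\<close>, for which only the \<open>L\<^sup>1\<close> norm is used.
\<close>

lemma interval_estimate:
  fixes u v :: "real \<Rightarrow> complex" and a l :: real
  assumes u: "\<And>s. (u has_vector_derivative u' s) (at s)" and c: "continuous_on UNIV u'"
    and v[measurable]: "v \<in> borel_measurable borel" and l: "l > 0"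
  defines "I \<equiv> {a..<a+l}"
  shows "(\<integral>\<^sup>+x\<in>I. ennreal ((cmod (u x))\<^sup>2) \<partial>lborel) \<le>
     4 * (ennreal (1 / l) * (\<integral>\<^sup>+t\<in>I. ennreal (cmod (v t)) \<partial>lborel)\<^sup>2
        + (\<integral>\<^sup>+t\<in>I. ennreal ((cmod (u t - v t))\<^sup>2) \<partial>lborel)
        + ennreal (l\<^sup>2) * (\<integral>\<^sup>+t\<in>I. ennreal ((cmod (u' t))\<^sup>2) \<partial>lborel))"
    (is "_ \<le> ?R")
proof -
  define V d W where "V = (\<integral>\<^sup>+t\<in>I. ennreal (cmod (v t)) \<partial>lborel)"
    and "d = (\<integral>\<^sup>+t\<in>I. ennreal ((cmod (u t - v t))\<^sup>2) \<partial>lborel)"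
    and "W = (\<integral>\<^sup>+t\<in>I. ennreal ((cmod (u' t))\<^sup>2) \<partial>lborel)"
  have I[measurable]: "I \<in> sets borel" by (simp add: I_def)
  have eI: "emeasure lborel I = ennreal l" using l by (simp add: I_def)
  have cu: "continuous_on UNIV u"
    using u by (metis continuous_at_imp_continuous_on has_vector_derivative_continuous)
  have [measurable]: "u \<in> borel_measurable borel" "u' \<in> borel_measurable borel"
    using cu c by (auto intro: borel_measurable_continuous_onI)
  have pt: "ennreal l * ennreal ((cmod (u x))\<^sup>2) \<le>
      4 * (ennreal (1 / l) * V\<^sup>2 + d + ennreal (l\<^sup>2) * W)" if x: "x \<in> I" for x
  proof -
    define k where "k = cmod (u x)"
    have k: "k \<ge> 0" by (simp add: k_def)
    \<comment> \<open>Only one of the two factors \<open>k\<close> is split, so \<open>v\<close>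
      enters linearly and is later seen through its L1 norm alone. The product \<open>k * e\<close>
      costs \<open>k\<^sup>2 / 2\<close>, which is moved to the left.\<close>
    have p1: "ennreal (k\<^sup>2 / 2) \<le> ennreal k * ennreal (cmod (v t)) + (ennreal ((cmod (u t - v t))\<^sup>2) + ennreal l * W)"
      if t: "t \<in> I" for t
    proof -
      have inc: "ennreal ((cmod (u x - u t))\<^sup>2) \<le> ennreal l * W"
        using increment_sq_le[OF u c, of x a "a + l" t] x t by (simp add: W_def I_def)
      define e where "e = cmod (u t - v t) + cmod (u x - u t)"
      have "k \<le> cmod (v t) + e"
      proof -
        have "u x = v t + (u t - v t) + (u x - u t)" by simp
        then show ?thesis unfolding k_def e_def
          by (metis add.assoc add_left_mono norm_triangle_ineq norm_triangle_mono order_refl)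
      qed
      then have "k * k \<le> k * (cmod (v t) + e)" using k by (rule mult_left_mono)
      moreover have "2 * k * e \<le> k\<^sup>2 + e\<^sup>2" by (rule sum_squares_bound)
      moreover have "e\<^sup>2 \<le> 2 * (cmod (u t - v t))\<^sup>2 + 2 * (cmod (u x - u t))\<^sup>2"
        unfolding e_def using sum_squares_bound[of "cmod (u t - v t)" "cmod (u x - u t)"] by (simp add: power2_sum)
      ultimately have "k\<^sup>2 / 2 \<le> k * cmod (v t) + ((cmod (u t - v t))\<^sup>2 + (cmod (u x - u t))\<^sup>2)"
        by (simp add: power2_eq_square algebra_simps)
      then have "ennreal (k\<^sup>2 / 2) \<le> ennreal (k * cmod (v t) + ((cmod (u t - v t))\<^sup>2 + (cmod (u x - u t))\<^sup>2))"
        by (rule ennreal_leI)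
      also have "\<dots> = ennreal k * ennreal (cmod (v t)) + (ennreal ((cmod (u t - v t))\<^sup>2) + ennreal ((cmod (u x - u t))\<^sup>2))"
        using k by (simp add: ennreal_mult)
      also have "\<dots> \<le> ennreal k * ennreal (cmod (v t)) + (ennreal ((cmod (u t - v t))\<^sup>2) + ennreal l * W)"
        using inc by (intro add_mono order_refl)
      finally show ?thesis .
    qed
    have "ennreal (k\<^sup>2 / 2) * ennreal l = (\<integral>\<^sup>+t\<in>I. ennreal (k\<^sup>2 / 2) \<partial>lborel)"
      by (simp add: nn_integral_cmult_indicator eI)
    also have "\<dots> \<le> (\<integral>\<^sup>+t. ennreal k * (ennreal (cmod (v t)) * indicator I t)
         + (ennreal ((cmod (u t - v t))\<^sup>2) * indicator I t + ennreal l * W * indicator I t) \<partial>lborel)"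
      using p1 by (intro nn_integral_mono) (auto simp: indicator_def)
    also have "\<dots> = ennreal k * V + (d + ennreal l * W * ennreal l)"
      by (simp add: nn_integral_add nn_integral_cmult nn_integral_cmult_indicator eI V_def d_def)
    finally have main: "ennreal (k\<^sup>2 / 2) * ennreal l \<le> ennreal k * V + (d + ennreal l * W * ennreal l)" .
    \<comment> \<open>An infinite quantity makes the right-hand side infinite, since its
      coefficients are positive; otherwise the inequality is one between real numbers.\<close>
    show ?thesis
    proof (cases "V = \<infinity> \<or> d = \<infinity> \<or> W = \<infinity>")
      case True
      then have "ennreal (1 / l) * V\<^sup>2 + d + ennreal (l\<^sup>2) * W = \<infinity>"
        using l by (auto simp: ennreal_mult_eq_top_iff power2_eq_square ennreal_mult_top)
      moreover have "4 * y = \<infinity>" if "y = \<infinity>" for y :: ennreal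
        using that by (simp add: ennreal_mult_eq_top_iff)
      ultimately have "4 * (ennreal (1 / l) * V\<^sup>2 + d + ennreal (l\<^sup>2) * W) = \<infinity>" by blast
      then show ?thesis by (simp only: infinity_ennreal_def top_greatest)
    next
      case False
      then obtain V' d' W' where r: "V = ennreal V'" "d = ennreal d'" "W = ennreal W'" "V' \<ge> 0" "d' \<ge> 0" "W' \<ge> 0"
        by (metis ennreal_cases infinity_ennreal_def)
      have "ennreal (k\<^sup>2 / 2 * l) = ennreal (k\<^sup>2 / 2) * ennreal l"
        using l by (intro ennreal_mult) auto
      also note main
      also have "ennreal k * V + (d + ennreal l * W * ennreal l) = ennreal (k * V' + (d' + l * W' * l))"
        using r k l by (simp add: ennreal_mult)
      finally have "ennreal (k\<^sup>2 / 2 * l) \<le> ennreal (k * V' + (d' + l * W' * l))" .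
      then have m: "k\<^sup>2 / 2 * l \<le> k * V' + (d' + l * W' * l)"
        using r k l by (subst (asm) ennreal_le_iff) auto
      \<comment> \<open>Young's inequality with the weight that spends a quarter of
        \<open>l * k\<^sup>2\<close>, leaving a quarter of the available half.\<close>
      have "2 * (k * l / 2) * V' \<le> (k * l / 2)\<^sup>2 + V'\<^sup>2" by (rule sum_squares_bound)
      then have "l * (k * V') \<le> l * (l * k\<^sup>2 / 4 + V'\<^sup>2 / l)" using l by (simp add: power2_eq_square algebra_simps)
      then have "k * V' \<le> l * k\<^sup>2 / 4 + V'\<^sup>2 / l" using l by simp
      moreover have "k\<^sup>2 / 2 * l = l * k\<^sup>2 / 2" "l * W' * l = l\<^sup>2 * W'" "1 / l * V'\<^sup>2 = V'\<^sup>2 / l"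
        by (simp_all add: power2_eq_square)
      ultimately have "l * k\<^sup>2 \<le> 4 * (1 / l * V'\<^sup>2 + d' + l\<^sup>2 * W')"
        using m absorb_quarter[of "k * V'" "l * k\<^sup>2" "V'\<^sup>2 / l" d' "l\<^sup>2 * W'"] by metis
      then have "ennreal (l * k\<^sup>2) \<le> ennreal (4 * (1 / l * V'\<^sup>2 + d' + l\<^sup>2 * W'))" by (rule ennreal_leI)
      also have "\<dots> = 4 * (ennreal (1 / l) * V\<^sup>2 + d + ennreal (l\<^sup>2) * W)"
      proof -
        have "ennreal (4 * (i * V'\<^sup>2 + d' + l\<^sup>2 * W')) = 4 * (ennreal i * V\<^sup>2 + d + ennreal (l\<^sup>2) * W)" if "i \<ge> 0" for i
          using r that by (simp add: ennreal_mult ennreal_power)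
        from this[of "1 / l"] show ?thesis using l by simp
      qed
      finally show ?thesis using l by (simp add: ennreal_mult k_def)
    qed
  qed
  have "ennreal l * (\<integral>\<^sup>+x\<in>I. ennreal ((cmod (u x))\<^sup>2) \<partial>lborel)
      = (\<integral>\<^sup>+x\<in>I. ennreal l * ennreal ((cmod (u x))\<^sup>2) \<partial>lborel)"
    by (simp add: nn_integral_cmult mult.assoc)
  also have "\<dots> \<le> (\<integral>\<^sup>+x\<in>I. 4 * (ennreal (1 / l) * V\<^sup>2 + d + ennreal (l\<^sup>2) * W) \<partial>lborel)"
    using pt by (intro nn_integral_mono) (auto simp: indicator_def)
  also have "\<dots> = ennreal l * (4 * (ennreal (1 / l) * V\<^sup>2 + d + ennreal (l\<^sup>2) * W))"
    by (subst nn_integral_cmult_indicator) (simp_all only: eI I sets_lborel mult.commute)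
  finally have "ennreal l * (\<integral>\<^sup>+x\<in>I. ennreal ((cmod (u x))\<^sup>2) \<partial>lborel) \<le> ennreal l * ?R"
    by (simp add: V_def d_def W_def)
  then show ?thesis using l by (simp add: ennreal_mult_le_mult_iff)
qed

text \<open>Each term is bounded by the whole sum. This is what merges the squared L1 norms on
  separate intervals into the one on their union.\<close>

lemma ennreal_suminf_sq_le:
  fixes f :: "nat \<Rightarrow> ennreal"
  shows "(\<Sum>k. (f k)\<^sup>2) \<le> (\<Sum>k. f k)\<^sup>2"
proof -
  have "f k \<le> (\<Sum>k. f k)" for k
    using sum_le_suminf[of f "{k}"] by (simp add: summableI)
  then have "(\<Sum>k. (f k)\<^sup>2) \<le> (\<Sum>k. f k * (\<Sum>k. f k))"
    by (intro suminf_le summableI) (simp add: power2_eq_square mult_left_mono)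
  then show ?thesis by (simp add: ennreal_suminf_multc power2_eq_square)
qed

text \<open>The constant is that of a single interval, however many there are: the quadratic terms
  add up exactly and the L1 terms by \<open>ennreal_suminf_sq_le\<close>.\<close>

lemma interval_family_estimate:
  fixes u v :: "real \<Rightarrow> complex" and b :: "nat \<Rightarrow> real" and l :: real
  assumes u: "\<And>s. (u has_vector_derivative u' s) (at s)" and c: "continuous_on UNIV u'"
    and v[measurable]: "v \<in> borel_measurable borel" and l: "l > 0"
    and dis: "disjoint_family (\<lambda>k::nat. {b k..<b k + l})"
  defines "J \<equiv> (\<Union>k. {b k..<b k + l})"
  shows "(\<integral>\<^sup>+x\<in>J. ennreal ((cmod (u x))\<^sup>2) \<partial>lborel) \<le>
     4 * (ennreal (1 / l) * (\<integral>\<^sup>+t\<in>J. ennreal (cmod (v t)) \<partial>lborel)\<^sup>2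
        + (\<integral>\<^sup>+t\<in>J. ennreal ((cmod (u t - v t))\<^sup>2) \<partial>lborel)
        + ennreal (l\<^sup>2) * (\<integral>\<^sup>+t\<in>J. ennreal ((cmod (u' t))\<^sup>2) \<partial>lborel))"
proof -
  have cu: "continuous_on UNIV u"
    using u by (metis continuous_at_imp_continuous_on has_vector_derivative_continuous)
  have [measurable]: "u \<in> borel_measurable borel" "u' \<in> borel_measurable borel"
    using cu c by (auto intro: borel_measurable_continuous_onI)
  have split: "(\<integral>\<^sup>+x\<in>J. f x \<partial>lborel) = (\<Sum>k. \<integral>\<^sup>+x\<in>{b k..<b k + l}. f x \<partial>lborel)"
    if "f \<in> borel_measurable borel" for f :: "real \<Rightarrow> ennreal"
    unfolding J_def using that dis by (intro nn_integral_disjoint_family) auto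
  let ?V = "\<lambda>k. \<integral>\<^sup>+t\<in>{b k..<b k + l}. ennreal (cmod (v t)) \<partial>lborel"
  let ?d = "\<lambda>k. \<integral>\<^sup>+t\<in>{b k..<b k + l}. ennreal ((cmod (u t - v t))\<^sup>2) \<partial>lborel"
  let ?W = "\<lambda>k. \<integral>\<^sup>+t\<in>{b k..<b k + l}. ennreal ((cmod (u' t))\<^sup>2) \<partial>lborel"
  have "(\<integral>\<^sup>+x\<in>J. ennreal ((cmod (u x))\<^sup>2) \<partial>lborel) = (\<Sum>k. \<integral>\<^sup>+x\<in>{b k..<b k + l}. ennreal ((cmod (u x))\<^sup>2) \<partial>lborel)"
    by (rule split) measurable
  also have "\<dots> \<le> (\<Sum>k. 4 * (ennreal (1 / l) * (?V k)\<^sup>2 + ?d k + ennreal (l\<^sup>2) * ?W k))"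
    by (intro suminf_le summableI interval_estimate u c v l)
  also have "\<dots> = 4 * (ennreal (1 / l) * (\<Sum>k. (?V k)\<^sup>2) + (\<Sum>k. ?d k) + ennreal (l\<^sup>2) * (\<Sum>k. ?W k))"
    by (simp add: suminf_add[symmetric] summableI)
  also have "\<dots> \<le> 4 * (ennreal (1 / l) * (\<Sum>k. ?V k)\<^sup>2 + (\<Sum>k. ?d k) + ennreal (l\<^sup>2) * (\<Sum>k. ?W k))"
    by (intro mult_left_mono add_mono ennreal_suminf_sq_le order_refl) auto
  also have "(\<Sum>k. ?V k) = (\<integral>\<^sup>+t\<in>J. ennreal (cmod (v t)) \<partial>lborel)"
    by (rule split[symmetric]) measurable
  also have "(\<Sum>k. ?d k) = (\<integral>\<^sup>+t\<in>J. ennreal ((cmod (u t - v t))\<^sup>2) \<partial>lborel)"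
    by (rule split[symmetric]) measurable
  also have "(\<Sum>k. ?W k) = (\<integral>\<^sup>+t\<in>J. ennreal ((cmod (u' t))\<^sup>2) \<partial>lborel)"
    by (rule split[symmetric]) measurable
  finally show ?thesis .
qed

text \<open>Floors number the intervals going right from \<open>r\<close>, ceilings those going left
  from \<open>q\<close>; \<open>Suc k\<close> is there so that the interval with
  \<open>k = 0\<close> ends at \<open>q\<close>.\<close>

lemma half_line_families:
  assumes "(l::real) > 0"
  shows "disjoint_family (\<lambda>k::nat. {r + real k * l..<r + real k * l + l})"
    "(\<Union>k::nat. {r + real k * l..<r + real k * l + l}) = {r..}"
    "disjoint_family (\<lambda>k::nat. {q - real (Suc k) * l..<q - real (Suc k) * l + l})"
    "(\<Union>k::nat. {q - real (Suc k) * l..<q - real (Suc k) * l + l}) = {..<q}"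
proof -
  have A: "x \<in> {r + real k * l..<r + real k * l + l} \<longleftrightarrow> \<lfloor>(x - r) / l\<rfloor> = int k" for x k
    using assms by (auto simp: floor_eq_iff field_simps)
  have B: "x \<in> {q - real (Suc k) * l..<q - real (Suc k) * l + l} \<longleftrightarrow> \<lceil>(q - x) / l\<rceil> = int (Suc k)" for x k
    using assms by (auto simp: ceiling_eq_iff field_simps)
  show "disjoint_family (\<lambda>k::nat. {r + real k * l..<r + real k * l + l})"
    unfolding disjoint_family_on_def
  proof (intro ballI impI equals0I)
    fix m n :: nat and x
    assume "m \<noteq> n" "x \<in> {r + real m * l..<r + real m * l + l} \<inter> {r + real n * l..<r + real n * l + l}"
    then show False using A[of x m] A[of x n] by (metis IntD1 IntD2 of_nat_eq_iff)
  qed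
  show "disjoint_family (\<lambda>k::nat. {q - real (Suc k) * l..<q - real (Suc k) * l + l})"
    unfolding disjoint_family_on_def
  proof (intro ballI impI equals0I)
    fix m n :: nat and x
    assume "m \<noteq> n" "x \<in> {q - real (Suc m) * l..<q - real (Suc m) * l + l} \<inter> {q - real (Suc n) * l..<q - real (Suc n) * l + l}"
    then show False using B[of x m] B[of x n] by (metis IntD1 IntD2 of_nat_eq_iff nat.inject)
  qed
  show "(\<Union>k::nat. {r + real k * l..<r + real k * l + l}) = {r..}"
  proof (intro set_eqI iffI)
    fix x assume "x \<in> {r..}"
    then have "0 \<le> \<lfloor>(x - r) / l\<rfloor>" using assms by simp
    then have "\<lfloor>(x - r) / l\<rfloor> = int (nat \<lfloor>(x - r) / l\<rfloor>)" by simp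
    then show "x \<in> (\<Union>k::nat. {r + real k * l..<r + real k * l + l})" using A by blast
  next
    fix x assume "x \<in> (\<Union>k::nat. {r + real k * l..<r + real k * l + l})"
    then obtain k :: nat where "r + real k * l \<le> x" by auto
    moreover have "0 \<le> real k * l" using assms by simp
    ultimately show "x \<in> {r..}" by simp
  qed
  show "(\<Union>k::nat. {q - real (Suc k) * l..<q - real (Suc k) * l + l}) = {..<q}"
  proof (intro set_eqI iffI)
    fix x assume "x \<in> {..<q}"
    then have "0 < \<lceil>(q - x) / l\<rceil>" using assms by simp
    then have "\<lceil>(q - x) / l\<rceil> = int (Suc (nat (\<lceil>(q - x) / l\<rceil> - 1)))" by simp
    then show "x \<in> (\<Union>k::nat. {q - real (Suc k) * l..<q - real (Suc k) * l + l})" using B by blast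
  next
    fix x assume "x \<in> (\<Union>k::nat. {q - real (Suc k) * l..<q - real (Suc k) * l + l})"
    then obtain k :: nat where "x < q - real (Suc k) * l + l" by auto
    moreover have "0 \<le> real k * l" using assms by simp
    ultimately show "x \<in> {..<q}" by (simp add: algebra_simps)
  qed
qed

text \<open>The ends are half-open so that the complement of \<open>outer R\<close> is exactly
  \<open>{-R..<R}\<close> for positive \<open>R\<close>, and \<open>outer 0\<close> is the whole
  line.\<close>

definition outer :: "real \<Rightarrow> real set" where "outer r = {r..} \<union> {..<-r}"

lemma outer_sets [measurable]: "outer r \<in> sets borel"
  by (simp add: outer_def)

text \<open>A half-line is tiled by intervals of any length \<open>l\<close>, however large compared
  with \<open>r\<close>. A bounded piece admits no such tiling, which is why the middle of the tube
  is treated separately.\<close>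

lemma outer_estimate:
  fixes u v :: "real \<Rightarrow> complex"
  assumes u: "\<And>s. (u has_vector_derivative u' s) (at s)" and c: "continuous_on UNIV u'"
    and v[measurable]: "v \<in> borel_measurable borel" and l: "l > 0" and r: "r \<ge> 0"
  shows "(\<integral>\<^sup>+x\<in>outer r. ennreal ((cmod (u x))\<^sup>2) \<partial>lborel) \<le>
     4 * (ennreal (1 / l) * (\<integral>\<^sup>+t. ennreal (cmod (v t)) \<partial>lborel)\<^sup>2
        + (\<integral>\<^sup>+t. ennreal ((cmod (u t - v t))\<^sup>2) \<partial>lborel)
        + ennreal (l\<^sup>2) * (\<integral>\<^sup>+t\<in>outer r. ennreal ((cmod (u' t))\<^sup>2) \<partial>lborel))"
proof -
  have cu: "continuous_on UNIV u"
    using u by (metis continuous_at_imp_continuous_on has_vector_derivative_continuous)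
  have [measurable]: "u \<in> borel_measurable borel" "u' \<in> borel_measurable borel"
    using cu c by (auto intro: borel_measurable_continuous_onI)
  let ?P = "{r..}" and ?N = "{..<-r}"
  have sp: "(\<integral>\<^sup>+x\<in>outer r. f x \<partial>lborel) = (\<integral>\<^sup>+x\<in>?P. f x \<partial>lborel) + (\<integral>\<^sup>+x\<in>?N. f x \<partial>lborel)"
    if [measurable]: "f \<in> borel_measurable borel" for f :: "real \<Rightarrow> ennreal"
  proof -
    have "(\<integral>\<^sup>+x\<in>outer r. f x \<partial>lborel) = (\<integral>\<^sup>+x. f x * indicator ?P x + f x * indicator ?N x \<partial>lborel)"
      using r by (intro nn_integral_cong) (auto simp: outer_def indicator_def)
    also have "\<dots> = (\<integral>\<^sup>+x\<in>?P. f x \<partial>lborel) + (\<integral>\<^sup>+x\<in>?N. f x \<partial>lborel)"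
      by (rule nn_integral_add) measurable
    finally show ?thesis .
  qed
  have le: "(\<integral>\<^sup>+x\<in>?P. f x \<partial>lborel) + (\<integral>\<^sup>+x\<in>?N. f x \<partial>lborel) \<le> (\<integral>\<^sup>+x. f x \<partial>lborel)"
    if [measurable]: "f \<in> borel_measurable borel" for f :: "real \<Rightarrow> ennreal"
    unfolding sp[OF that, symmetric] by (intro nn_integral_mono) (auto simp: indicator_def)
  let ?V = "\<lambda>J. \<integral>\<^sup>+t\<in>J. ennreal (cmod (v t)) \<partial>lborel"
  let ?d = "\<lambda>J. \<integral>\<^sup>+t\<in>J. ennreal ((cmod (u t - v t))\<^sup>2) \<partial>lborel"
  let ?W = "\<lambda>J. \<integral>\<^sup>+t\<in>J. ennreal ((cmod (u' t))\<^sup>2) \<partial>lborel"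
  note fam = half_line_families[OF l]
  have "(\<integral>\<^sup>+x\<in>outer r. ennreal ((cmod (u x))\<^sup>2) \<partial>lborel) =
     (\<integral>\<^sup>+x\<in>?P. ennreal ((cmod (u x))\<^sup>2) \<partial>lborel) + (\<integral>\<^sup>+x\<in>?N. ennreal ((cmod (u x))\<^sup>2) \<partial>lborel)"
    by (rule sp) measurable
  also have "\<dots> \<le> 4 * (ennreal (1 / l) * (?V ?P)\<^sup>2 + ?d ?P + ennreal (l\<^sup>2) * ?W ?P)
     + 4 * (ennreal (1 / l) * (?V ?N)\<^sup>2 + ?d ?N + ennreal (l\<^sup>2) * ?W ?N)"
    using interval_family_estimate[OF u c v l fam(1)[of r]] interval_family_estimate[OF u c v l fam(3)[of "-r"]]
    unfolding fam(2,4) by (rule add_mono)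
  also have "\<dots> = 4 * (ennreal (1 / l) * ((?V ?P)\<^sup>2 + (?V ?N)\<^sup>2) + (?d ?P + ?d ?N) + ennreal (l\<^sup>2) * (?W ?P + ?W ?N))"
    by (simp add: algebra_simps)
  also have "\<dots> \<le> 4 * (ennreal (1 / l) * (\<integral>\<^sup>+t. ennreal (cmod (v t)) \<partial>lborel)\<^sup>2
        + (\<integral>\<^sup>+t. ennreal ((cmod (u t - v t))\<^sup>2) \<partial>lborel) + ennreal (l\<^sup>2) * ?W (outer r))"
  proof (intro mult_left_mono add_mono)
    have "(?V ?P)\<^sup>2 + (?V ?N)\<^sup>2 \<le> (?V ?P + ?V ?N)\<^sup>2"
      by (simp add: power2_eq_square algebra_simps)
    also have "\<dots> \<le> (\<integral>\<^sup>+t. ennreal (cmod (v t)) \<partial>lborel)\<^sup>2"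
      by (intro power_mono le) auto
    finally show "(?V ?P)\<^sup>2 + (?V ?N)\<^sup>2 \<le> (\<integral>\<^sup>+t. ennreal (cmod (v t)) \<partial>lborel)\<^sup>2" .
    show "?d ?P + ?d ?N \<le> (\<integral>\<^sup>+t. ennreal ((cmod (u t - v t))\<^sup>2) \<partial>lborel)" by (rule le) measurable
    show "?W ?P + ?W ?N \<le> ?W (outer r)" by (rule eq_refl, rule sp[symmetric]) measurable
  qed auto
  finally show ?thesis .
qed

subsection \<open>Estimates for test functions on the tube\<close>

abbreviation d1 :: "real \<times> real \<times> real" where "d1 \<equiv> (1, 0, 0)"
abbreviation d2 :: "real \<times> real \<times> real" where "d2 \<equiv> (0, 1, 0)"
abbreviation d3 :: "real \<times> real \<times> real" where "d3 \<equiv> (0, 0, 1)"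

section \<open>Derivatives along the fibres\<close>

lemma Basis_real_triple: "(Basis :: (real \<times> real \<times> real) set) = {d1, d2, d3}"
  by (auto simp: Basis_prod_def zero_prod_def)

lemma sum_Basis_real_triple: "(\<Sum>b\<in>(Basis :: (real \<times> real \<times> real) set). f b) = f d1 + f d2 + f d3"
  by (simp add: Basis_real_triple add.assoc)

lemma borel_measurable_nn_integral_fst_arg:
  fixes f :: "real \<times> 'b::euclidean_space \<Rightarrow> ennreal"
  assumes "f \<in> borel_measurable borel"
  shows "(\<lambda>y. \<integral>\<^sup>+x. f (x, y) \<partial>lborel) \<in> borel_measurable borel"
proof -
  have "(\<lambda>z. f (snd z, fst z)) \<in> borel_measurable (borel :: ('b \<times> real) measure)"
    by (rule borel_measurable_compose_continuous[OF assms]) (intro continuous_intros)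
  then have "(\<lambda>z. f (snd z, fst z)) \<in> borel_measurable (lborel \<Otimes>\<^sub>M (lborel :: real measure))"
    by (simp add: lborel_prod)
  from lborel.borel_measurable_nn_integral_fst[OF this] show ?thesis by simp
qed

text \<open>The longitudinal derivative plus \<theta>' times the angular derivative
  \<open>z3 \<partial>2 - z2 \<partial>3\<close>, at the twisted point. Where \<theta>' vanishes
  only the longitudinal one is left.\<close>

definition fibre_deriv :: "(real \<Rightarrow> real) \<Rightarrow> (real \<Rightarrow> real) \<Rightarrow> (real \<times> real \<times> real \<Rightarrow> complex) \<Rightarrow> real \<times> real \<Rightarrow> real \<Rightarrow> complex" where
  "fibre_deriv \<theta> \<theta>' \<phi> y x = partial_deriv d1 \<phi> (twist_map \<theta> (x, y))
     + complex_of_real (\<theta>' x * snd (snd (twist_map \<theta> (x, y)))) * partial_deriv d2 \<phi> (twist_map \<theta> (x, y))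
     + complex_of_real (- \<theta>' x * fst (snd (twist_map \<theta> (x, y)))) * partial_deriv d3 \<phi> (twist_map \<theta> (x, y))"

lemma fibre_has_derivative:
  assumes \<phi>: "\<phi> \<in> test_functions \<Omega>" and \<theta>: "(\<theta> has_real_derivative \<theta>' x) (at x)"
  shows "((\<lambda>s. \<phi> (twist_map \<theta> (s, y))) has_vector_derivative fibre_deriv \<theta> \<theta>' \<phi> y x) (at x)"
proof -
  have a: "((\<lambda>s. fst y * cos (\<theta> s) + snd y * sin (\<theta> s)) has_vector_derivative
      \<theta>' x * (- fst y * sin (\<theta> x) + snd y * cos (\<theta> x))) (at x)"
    unfolding has_real_derivative_iff_has_vector_derivative[symmetric]
    by (auto intro!: derivative_eq_intros \<theta> simp: algebra_simps)
  have b: "((\<lambda>s. - fst y * sin (\<theta> s) + snd y * cos (\<theta> s)) has_vector_derivative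
      - \<theta>' x * (fst y * cos (\<theta> x) + snd y * sin (\<theta> x))) (at x)"
    unfolding has_real_derivative_iff_has_vector_derivative[symmetric]
    by (auto intro!: derivative_eq_intros \<theta> simp: algebra_simps)
  have "((\<lambda>s. twist_map \<theta> (s, y)) has_vector_derivative
     (1, \<theta>' x * snd (snd (twist_map \<theta> (x, y))), - \<theta>' x * fst (snd (twist_map \<theta> (x, y))))) (at x)"
    unfolding twist_map_eq fst_conv snd_conv
    by (intro has_vector_derivative_Pair a b) (auto intro!: derivative_eq_intros)
  from test_functions_chain[OF \<phi> this] show ?thesis
    by (simp add: sum_Basis_real_triple fibre_deriv_def)
qed

lemma continuous_fibre_deriv:
  assumes \<phi>: "\<phi> \<in> test_functions \<Omega>" and \<theta>: "continuous_on UNIV \<theta>" and \<theta>': "continuous_on UNIV \<theta>'"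
  shows "continuous_on UNIV (fibre_deriv \<theta> \<theta>' \<phi> y)"
proof -
  have t: "continuous_on UNIV (\<lambda>x. twist_map \<theta> (x, y))"
    by (rule continuous_on_compose2[OF continuous_twist_map[OF \<theta>]]) (auto intro: continuous_intros)
  have p: "continuous_on UNIV (\<lambda>x. partial_deriv b \<phi> (twist_map \<theta> (x, y)))" if "b \<in> Basis" for b
    by (rule continuous_on_compose2[OF test_functions_continuous[OF test_functions_partial_deriv[OF \<phi> that]] t]) simp
  have "fibre_deriv \<theta> \<theta>' \<phi> y = (\<lambda>x. partial_deriv d1 \<phi> (twist_map \<theta> (x, y))
     + complex_of_real (\<theta>' x * snd (snd (twist_map \<theta> (x, y)))) * partial_deriv d2 \<phi> (twist_map \<theta> (x, y))
     + complex_of_real (- \<theta>' x * fst (snd (twist_map \<theta> (x, y)))) * partial_deriv d3 \<phi> (twist_map \<theta> (x, y)))"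
    by (rule ext) (simp only: fibre_deriv_def)
  then show ?thesis
    using p t \<theta>' by (auto intro!: continuous_intros simp: Basis_real_triple)
qed

text \<open>\<open>outer_estimate\<close> on each fibre, integrated over the fibres. The term with
  \<open>g\<close> stays in fibre form because it becomes the mixed norm. The majorant
  \<open>D\<close> is left open for two uses: with transversal derivatives on the whole tube, and
  without them where the fibres are straight.\<close>

lemma tube_outer_estimate:
  assumes \<theta>: "\<And>x. (\<theta> has_real_derivative \<theta>' x) (at x)" and c\<theta>': "continuous_on UNIV \<theta>'"
    and \<phi>: "\<phi> \<in> test_functions \<Omega>" and g: "g \<in> borel_measurable borel" and l: "l > 0" and r: "r \<ge> 0"
    and D: "D \<in> borel_measurable borel"
    and bound: "\<And>x y. x \<in> outer r \<Longrightarrow> ennreal ((cmod (fibre_deriv \<theta> \<theta>' \<phi> y x))\<^sup>2) \<le> D (twist_map \<theta> (x, y))"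
  shows "(\<integral>\<^sup>+z. ennreal ((cmod (\<phi> z))\<^sup>2) * indicator (outer r) (fst z) \<partial>lborel) \<le>
     4 * (ennreal (1 / l) * (\<integral>\<^sup>+y. (\<integral>\<^sup>+x. ennreal (cmod (g (twist_map \<theta> (x, y)))) \<partial>lborel)\<^sup>2 \<partial>lborel)
        + (\<integral>\<^sup>+z. ennreal ((cmod (\<phi> z - g z))\<^sup>2) \<partial>lborel)
        + ennreal (l\<^sup>2) * (\<integral>\<^sup>+z. D z * indicator (outer r) (fst z) \<partial>lborel))"
proof -
  have c\<theta>: "continuous_on UNIV \<theta>"
    using \<theta> DERIV_isCont continuous_at_imp_continuous_on by blast
  note ct = continuous_twist_map[OF c\<theta>]
  have cty: "continuous_on UNIV (\<lambda>x. twist_map \<theta> (x, y))" for y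
    by (rule continuous_on_compose2[OF ct]) (auto intro: continuous_intros)
  have fst_tw: "fst (twist_map \<theta> (x, y)) = x" for x y by (simp add: twist_map_eq)
  have mi: "(\<lambda>z::real\<times>real\<times>real. indicator (outer r) (fst z) :: ennreal) \<in> borel_measurable borel"
    by (rule borel_measurable_compose_continuous[OF borel_measurable_indicator]) (auto intro: continuous_intros simp: outer_sets)
  have m\<phi>[measurable]: "\<phi> \<in> borel_measurable borel" by (rule test_functions_measurable[OF \<phi>])
  note [measurable] = g D mi
  let ?V = "\<lambda>y. \<integral>\<^sup>+x. ennreal (cmod (g (twist_map \<theta> (x, y)))) \<partial>lborel"
  let ?d = "\<lambda>y. \<integral>\<^sup>+x. ennreal ((cmod (\<phi> (twist_map \<theta> (x, y)) - g (twist_map \<theta> (x, y))))\<^sup>2) \<partial>lborel"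
  let ?W = "\<lambda>y. \<integral>\<^sup>+x. D (twist_map \<theta> (x, y)) * indicator (outer r) x \<partial>lborel"
  have mm: "(\<lambda>y. \<integral>\<^sup>+x. h (twist_map \<theta> (x, y)) \<partial>lborel) \<in> borel_measurable borel"
    if "h \<in> borel_measurable borel" for h :: "real \<times> real \<times> real \<Rightarrow> ennreal"
    by (rule borel_measurable_nn_integral_fst_arg[OF borel_measurable_compose_continuous[OF that ct]])
  have mV[measurable]: "?V \<in> borel_measurable borel"
    by (rule mm[of "\<lambda>z. ennreal (cmod (g z))"]) measurable
  have md[measurable]: "?d \<in> borel_measurable borel"
    by (rule mm[of "\<lambda>z. ennreal ((cmod (\<phi> z - g z))\<^sup>2)"]) measurable
  have mW[measurable]: "?W \<in> borel_measurable borel"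
    using mm[of "\<lambda>z. D z * indicator (outer r) (fst z)"] by (simp add: fst_tw)
  have fib: "(\<integral>\<^sup>+x\<in>outer r. ennreal ((cmod (\<phi> (twist_map \<theta> (x, y))))\<^sup>2) \<partial>lborel)
     \<le> 4 * (ennreal (1 / l) * (?V y)\<^sup>2 + ?d y + ennreal (l\<^sup>2) * ?W y)" for y
  proof -
    have mg: "(\<lambda>x. g (twist_map \<theta> (x, y))) \<in> borel_measurable borel"
      by (rule borel_measurable_compose_continuous[OF g cty])
    have "(\<integral>\<^sup>+x\<in>outer r. ennreal ((cmod (\<phi> (twist_map \<theta> (x, y))))\<^sup>2) \<partial>lborel)
       \<le> 4 * (ennreal (1 / l) * (?V y)\<^sup>2 + ?d y
          + ennreal (l\<^sup>2) * (\<integral>\<^sup>+x\<in>outer r. ennreal ((cmod (fibre_deriv \<theta> \<theta>' \<phi> y x))\<^sup>2) \<partial>lborel))"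
      by (rule outer_estimate[OF fibre_has_derivative[OF \<phi> \<theta>] continuous_fibre_deriv[OF \<phi> c\<theta> c\<theta>'] mg l r])
    also have "\<dots> \<le> 4 * (ennreal (1 / l) * (?V y)\<^sup>2 + ?d y + ennreal (l\<^sup>2) * ?W y)"
      using bound by (intro mult_left_mono add_mono order_refl nn_integral_mono) (auto simp: indicator_def)
    finally show ?thesis .
  qed
  have "(\<integral>\<^sup>+z. ennreal ((cmod (\<phi> z))\<^sup>2) * indicator (outer r) (fst z) \<partial>lborel)
     = (\<integral>\<^sup>+y. (\<integral>\<^sup>+x\<in>outer r. ennreal ((cmod (\<phi> (twist_map \<theta> (x, y))))\<^sup>2) \<partial>lborel) \<partial>lborel)"
    by (subst nn_integral_twist_swap[OF c\<theta>, symmetric]) (simp_all add: fst_tw)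
  also have "\<dots> \<le> (\<integral>\<^sup>+y. 4 * (ennreal (1 / l) * (?V y)\<^sup>2 + ?d y + ennreal (l\<^sup>2) * ?W y) \<partial>lborel)"
    by (rule nn_integral_mono) (rule fib)
  also have "\<dots> = 4 * (ennreal (1 / l) * (\<integral>\<^sup>+y. (?V y)\<^sup>2 \<partial>lborel) + (\<integral>\<^sup>+y. ?d y \<partial>lborel) + ennreal (l\<^sup>2) * (\<integral>\<^sup>+y. ?W y \<partial>lborel))"
    by (simp add: nn_integral_cmult nn_integral_add)
  also have "(\<integral>\<^sup>+y. ?d y \<partial>lborel) = (\<integral>\<^sup>+z. ennreal ((cmod (\<phi> z - g z))\<^sup>2) \<partial>lborel)"
    by (rule nn_integral_twist_swap[OF c\<theta>]) measurable
  also have "(\<integral>\<^sup>+y. ?W y \<partial>lborel) = (\<integral>\<^sup>+z. D z * indicator (outer r) (fst z) \<partial>lborel)"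
    using nn_integral_twist_swap[OF c\<theta>, of "\<lambda>z. D z * indicator (outer r) (fst z)"] by (simp add: fst_tw)
  finally show ?thesis .
qed

lemma cmod_sum3_sq_le: "(cmod (a + b + c))\<^sup>2 \<le> 3 * ((cmod a)\<^sup>2 + (cmod b)\<^sup>2 + (cmod c)\<^sup>2)"
proof -
  have "(cmod (a + b + c))\<^sup>2 \<le> (cmod a + cmod b + cmod c)\<^sup>2"
    by (intro power_mono norm_triangle_le add_right_mono norm_triangle_ineq) auto
  also have "\<dots> \<le> 3 * ((cmod a)\<^sup>2 + (cmod b)\<^sup>2 + (cmod c)\<^sup>2)"
    using sum_squares_bound[of "cmod a" "cmod b"] sum_squares_bound[of "cmod a" "cmod c"] sum_squares_bound[of "cmod b" "cmod c"]
    by (simp add: power2_eq_square algebra_simps)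
  finally show ?thesis .
qed

text \<open>Rotations preserve the norm of \<open>y\<close>, so the coefficients of the transversal
  derivatives are at most \<open>M * a\<close> in modulus; for \<open>y\<close> outside
  \<open>\<omega>\<close> both sides vanish. The factor 3 is for the square of a sum of three
  terms.\<close>

lemma fibre_deriv_bound:
  assumes \<phi>: "\<phi> \<in> test_functions (tube \<theta> \<omega>)" and a: "\<And>y. y \<in> \<omega> \<Longrightarrow> norm y \<le> a" and M: "\<bar>\<theta>' x\<bar> \<le> M" and a0: "0 \<le> a"
  shows "(cmod (fibre_deriv \<theta> \<theta>' \<phi> y x))\<^sup>2 \<le> 3 * ((cmod (partial_deriv d1 \<phi> (twist_map \<theta> (x, y))))\<^sup>2
     + (M * a)\<^sup>2 * ((cmod (partial_deriv d2 \<phi> (twist_map \<theta> (x, y))))\<^sup>2 + (cmod (partial_deriv d3 \<phi> (twist_map \<theta> (x, y))))\<^sup>2))"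
proof (cases "y \<in> \<omega>")
  case True
  let ?z = "twist_map \<theta> (x, y)"
  have n: "(fst (snd ?z))\<^sup>2 + (snd (snd ?z))\<^sup>2 = (fst y)\<^sup>2 + (snd y)\<^sup>2"
  proof -
    have "(p * c + q * s)\<^sup>2 + (- p * s + q * c)\<^sup>2 = (p\<^sup>2 + q\<^sup>2) * (c\<^sup>2 + s\<^sup>2)" for p q c s :: real
      by (simp add: power2_eq_square algebra_simps)
    from this[of "fst y" "cos (\<theta> x)" "snd y" "sin (\<theta> x)"] show ?thesis
      unfolding twist_map_eq by simp
  qed
  have "(fst y)\<^sup>2 + (snd y)\<^sup>2 \<le> a\<^sup>2"
    using power_mono[OF a[OF True] norm_ge_zero, of 2] by (simp add: norm_prod_def)
  then have L: "(fst (snd ?z))\<^sup>2 \<le> a\<^sup>2" "(snd (snd ?z))\<^sup>2 \<le> a\<^sup>2"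
    using n zero_le_power2[of "fst (snd ?z)"] zero_le_power2[of "snd (snd ?z)"] by linarith+
  have M2: "(\<theta>' x)\<^sup>2 \<le> M\<^sup>2" using power_mono[OF M abs_ge_zero, of 2] by simp
  have b: "(cmod (complex_of_real (\<theta>' x * t) * p))\<^sup>2 \<le> (M * a)\<^sup>2 * (cmod p)\<^sup>2"
    "(cmod (complex_of_real (- \<theta>' x * t) * p))\<^sup>2 \<le> (M * a)\<^sup>2 * (cmod p)\<^sup>2" if "t\<^sup>2 \<le> a\<^sup>2" for t p
  proof -
    have "(\<theta>' x)\<^sup>2 * t\<^sup>2 * (cmod p)\<^sup>2 \<le> M\<^sup>2 * a\<^sup>2 * (cmod p)\<^sup>2"
      using M2 that by (intro mult_right_mono mult_mono) auto
    then show "(cmod (complex_of_real (\<theta>' x * t) * p))\<^sup>2 \<le> (M * a)\<^sup>2 * (cmod p)\<^sup>2"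
      "(cmod (complex_of_real (- \<theta>' x * t) * p))\<^sup>2 \<le> (M * a)\<^sup>2 * (cmod p)\<^sup>2"
      by (simp_all add: norm_mult power_mult_distrib)
  qed
  show ?thesis
    unfolding fibre_deriv_def
    by (rule order_trans[OF cmod_sum3_sq_le])
       (use b(1)[OF L(2), of "partial_deriv d2 \<phi> ?z"] b(2)[OF L(1), of "partial_deriv d3 \<phi> ?z"] in \<open>simp add: distrib_left\<close>)
next
  case False
  have "partial_deriv b \<phi> (twist_map \<theta> (x, y)) = 0" if "b \<in> Basis" for b
    by (rule test_functions_outside[OF test_functions_partial_deriv[OF \<phi> that]]) (simp add: twist_map_in_tube_iff False)
  then show ?thesis by (simp add: fibre_deriv_def Basis_real_triple)
qed

text \<open>A value in the middle is compared with those on the window \<open>{R..<R+1}\<close> of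
  the same straight line. The line may leave the tube, where \<open>\<phi>\<close> is zero and still
  smooth, so only the longitudinal derivative appears.\<close>

lemma tube_middle_estimate:
  assumes \<phi>: "\<phi> \<in> test_functions \<Omega>" and R: "R > 0"
  shows "(\<integral>\<^sup>+z. ennreal ((cmod (\<phi> z))\<^sup>2) * indicator {-R..<R} (fst z) \<partial>lborel) \<le>
     ennreal (4 * R) * (\<integral>\<^sup>+z. ennreal ((cmod (\<phi> z))\<^sup>2) * indicator (outer R) (fst z) \<partial>lborel)
      + ennreal (4 * R * (2 * R + 1)) * (\<integral>\<^sup>+z. ennreal ((cmod (partial_deriv d1 \<phi> z))\<^sup>2) \<partial>lborel)"
proof -
  have d1B: "d1 \<in> Basis" by (simp add: Basis_real_triple)
  have dT: "partial_deriv d1 \<phi> \<in> test_functions \<Omega>" by (rule test_functions_partial_deriv[OF \<phi> d1B])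
  note [measurable] = test_functions_measurable[OF \<phi>] test_functions_measurable[OF dT]
  have mi: "(\<lambda>z::real\<times>real\<times>real. indicator A (fst z) :: ennreal) \<in> borel_measurable borel" if "A \<in> sets borel" for A
    using that by (intro borel_measurable_compose_continuous[OF borel_measurable_indicator]) (auto intro: continuous_intros)
  have pair_c: "continuous_on UNIV (\<lambda>x::real. (x, y))" for y :: "real \<times> real" by (intro continuous_intros)
  define O' where "O' y = (\<integral>\<^sup>+x\<in>outer R. ennreal ((cmod (\<phi> (x, y)))\<^sup>2) \<partial>lborel)" for y
  define K where "K y = (\<integral>\<^sup>+x. ennreal ((cmod (partial_deriv d1 \<phi> (x, y)))\<^sup>2) \<partial>lborel)" for y
  have mf: "(\<lambda>z. ennreal ((cmod (\<phi> z))\<^sup>2) * indicator A (fst z)) \<in> borel_measurable borel" if "A \<in> sets borel" for A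
    using mi[OF that] by measurable
  have mO[measurable]: "O' \<in> borel_measurable borel"
    unfolding O'_def using borel_measurable_nn_integral_fst_arg[OF mf[OF outer_sets[of R]]] by simp
  have mK[measurable]: "K \<in> borel_measurable borel"
    unfolding K_def by (rule borel_measurable_nn_integral_fst_arg) measurable
  \<comment> \<open>\<open>2 * R + 1\<close> is the length of the segment from \<open>- R\<close> to
    \<open>R + 1\<close>; \<open>4 * R\<close> is the length \<open>2 * R\<close> of the middle
    times the 2 from squaring a sum. The window has length 1 and costs nothing.\<close>
  have fib: "(\<integral>\<^sup>+x\<in>{-R..<R}. ennreal ((cmod (\<phi> (x, y)))\<^sup>2) \<partial>lborel) \<le> ennreal (4 * R) * O' y + ennreal (4 * R * (2 * R + 1)) * K y" for y
  proof -
    have h: "((\<lambda>s. \<phi> (s, y)) has_vector_derivative partial_deriv d1 \<phi> (s, y)) (at s)" for s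
    proof -
      have "((\<lambda>s. (s, y)) has_vector_derivative (1, 0)) (at s)"
        by (auto intro!: derivative_eq_intros has_vector_derivative_Pair)
      then have "((\<lambda>s. (s, y)) has_vector_derivative d1) (at s)" by (simp add: zero_prod_def)
      from test_functions_chain[OF \<phi> this] show ?thesis by (simp add: sum_Basis_real_triple)
    qed
    have c: "continuous_on UNIV (\<lambda>s. partial_deriv d1 \<phi> (s, y))"
      by (rule continuous_on_compose2[OF test_functions_continuous[OF dT] pair_c]) simp
    have m\<phi>: "(\<lambda>x. \<phi> (x, y)) \<in> borel_measurable borel"
      by (rule borel_measurable_compose_continuous[OF test_functions_measurable[OF \<phi>] pair_c])
    note [measurable] = m\<phi>
    have p1: "ennreal ((cmod (\<phi> (x, y)))\<^sup>2) \<le> 2 * ennreal ((cmod (\<phi> (t, y)))\<^sup>2) + 2 * (ennreal (2 * R + 1) * K y)"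
      if x: "x \<in> {-R..<R}" and t: "t \<in> {R..<R+1}" for x t
    proof -
      have "ennreal ((cmod (\<phi> (x, y) - \<phi> (t, y)))\<^sup>2) \<le>
          ennreal (R + 1 - (- R)) * (\<integral>\<^sup>+s\<in>{-R..<R+1}. ennreal ((cmod (partial_deriv d1 \<phi> (s, y)))\<^sup>2) \<partial>lborel)"
        by (rule increment_sq_le[OF h c]) (use x t in auto)
      also have "\<dots> \<le> ennreal (2 * R + 1) * K y"
        unfolding K_def by (intro mult_mono nn_integral_mono) (auto simp: indicator_def)
      finally have inc: "ennreal ((cmod (\<phi> (x, y) - \<phi> (t, y)))\<^sup>2) \<le> ennreal (2 * R + 1) * K y" .
      have "(cmod (\<phi> (x, y)))\<^sup>2 \<le> 2 * (cmod (\<phi> (t, y)))\<^sup>2 + 2 * (cmod (\<phi> (x, y) - \<phi> (t, y)))\<^sup>2"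
        using cmod_add_sq_le[of "\<phi> (t, y)" "\<phi> (x, y) - \<phi> (t, y)"] by simp
      then have "ennreal ((cmod (\<phi> (x, y)))\<^sup>2) \<le> ennreal (2 * (cmod (\<phi> (t, y)))\<^sup>2 + 2 * (cmod (\<phi> (x, y) - \<phi> (t, y)))\<^sup>2)"
        by (rule ennreal_leI)
      also have "\<dots> = 2 * ennreal ((cmod (\<phi> (t, y)))\<^sup>2) + 2 * ennreal ((cmod (\<phi> (x, y) - \<phi> (t, y)))\<^sup>2)"
        by (simp add: ennreal_mult)
      also have "\<dots> \<le> 2 * ennreal ((cmod (\<phi> (t, y)))\<^sup>2) + 2 * (ennreal (2 * R + 1) * K y)"
        using inc by (intro add_mono mult_left_mono) auto
      finally show ?thesis .
    qed
    have p2: "ennreal ((cmod (\<phi> (x, y)))\<^sup>2) \<le> 2 * O' y + 2 * (ennreal (2 * R + 1) * K y)" if x: "x \<in> {-R..<R}" for x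
    proof -
      have e1: "emeasure lborel {R..<R+1} = 1" by simp
      have "ennreal ((cmod (\<phi> (x, y)))\<^sup>2) = (\<integral>\<^sup>+t\<in>{R..<R+1}. ennreal ((cmod (\<phi> (x, y)))\<^sup>2) \<partial>lborel)"
        by (subst nn_integral_cmult_indicator) simp_all
      also have "\<dots> \<le> (\<integral>\<^sup>+t. 2 * (ennreal ((cmod (\<phi> (t, y)))\<^sup>2) * indicator (outer R) t) + 2 * (ennreal (2 * R + 1) * K y) * indicator {R..<R+1} t \<partial>lborel)"
        using p1[OF x] by (intro nn_integral_mono) (auto simp: indicator_def outer_def)
      also have "\<dots> = 2 * O' y + 2 * (ennreal (2 * R + 1) * K y) * emeasure lborel {R..<R+1}"
        by (subst nn_integral_add) (simp_all add: nn_integral_cmult nn_integral_cmult_indicator O'_def del: emeasure_lborel_Ico)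
      finally show ?thesis by (simp add: e1)
    qed
    have "(\<integral>\<^sup>+x\<in>{-R..<R}. ennreal ((cmod (\<phi> (x, y)))\<^sup>2) \<partial>lborel) \<le> (\<integral>\<^sup>+x\<in>{-R..<R}. 2 * O' y + 2 * (ennreal (2 * R + 1) * K y) \<partial>lborel)"
      using p2 by (intro nn_integral_mono) (auto simp: indicator_def)
    also have "\<dots> = (2 * O' y + 2 * (ennreal (2 * R + 1) * K y)) * ennreal (2 * R)"
      using R by (subst nn_integral_cmult_indicator) simp_all
    also have "\<dots> = (2 * ennreal (2 * R)) * O' y + (2 * ennreal (2 * R) * ennreal (2 * R + 1)) * K y"
      by (simp add: algebra_simps)
    also have "2 * ennreal (2 * R) = ennreal (4 * R)" using R by (subst ennreal_numeral[symmetric], subst ennreal_mult[symmetric]) auto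
    also have "ennreal (4 * R) * ennreal (2 * R + 1) = ennreal (4 * R * (2 * R + 1))" using R by (simp add: ennreal_mult)
    finally show ?thesis .
  qed
  have "(\<integral>\<^sup>+z. ennreal ((cmod (\<phi> z))\<^sup>2) * indicator {-R..<R} (fst z) \<partial>lborel)
     = (\<integral>\<^sup>+y. (\<integral>\<^sup>+x\<in>{-R..<R}. ennreal ((cmod (\<phi> (x, y)))\<^sup>2) \<partial>lborel) \<partial>lborel)"
    by (subst nn_integral_lborel_pair_swap[OF mf]) simp_all
  also have "\<dots> \<le> (\<integral>\<^sup>+y. ennreal (4 * R) * O' y + ennreal (4 * R * (2 * R + 1)) * K y \<partial>lborel)"
    by (rule nn_integral_mono) (rule fib)
  also have "\<dots> = ennreal (4 * R) * (\<integral>\<^sup>+y. O' y \<partial>lborel) + ennreal (4 * R * (2 * R + 1)) * (\<integral>\<^sup>+y. K y \<partial>lborel)"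
    by (simp add: nn_integral_add nn_integral_cmult)
  also have "(\<integral>\<^sup>+y. O' y \<partial>lborel) = (\<integral>\<^sup>+z. ennreal ((cmod (\<phi> z))\<^sup>2) * indicator (outer R) (fst z) \<partial>lborel)"
    unfolding O'_def by (subst nn_integral_lborel_pair_swap[OF mf]) simp_all
  also have "(\<integral>\<^sup>+y. K y \<partial>lborel) = (\<integral>\<^sup>+z. ennreal ((cmod (partial_deriv d1 \<phi> z))\<^sup>2) \<partial>lborel)"
    unfolding K_def by (subst nn_integral_lborel_pair_swap) simp_all
  finally show ?thesis .
qed

section \<open>Cross-sections of the tube\<close>

lemma twist_slice_linear: "bounded_linear (\<lambda>y::real\<times>real. (0::real, fst y * c + snd y * s, - fst y * s + snd y * c))"
  by (intro bounded_linear_Pair bounded_linear_zero bounded_linear_add bounded_linear_mult_left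
      bounded_linear_minus bounded_linear_fst bounded_linear_snd
      bounded_linear_compose[OF bounded_linear_mult_left])

lemma twist_map_slice:
  "twist_map \<theta> (x, y) = (x, 0, 0) + (0, fst y * cos (\<theta> x) + snd y * sin (\<theta> x), - fst y * sin (\<theta> x) + snd y * cos (\<theta> x))"
  by (simp add: twist_map_eq)

text \<open>At fixed \<open>x\<close> the twist is affine in \<open>y\<close>, so smoothness
  survives although the angle is merely continuous in \<open>x\<close>. The support lies in the
  projection of the untwisted \<open>K\<close>, which is compact in \<open>\<omega>\<close>.\<close>

lemma slice_test_function:
  assumes \<phi>: "\<phi> \<in> test_functions (tube \<theta> \<omega>)" and \<theta>: "continuous_on UNIV \<theta>"
  shows "(\<lambda>y. \<phi> (twist_map \<theta> (x, y))) \<in> test_functions \<omega>"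
proof -
  obtain K where K: "compact K" "K \<subseteq> tube \<theta> \<omega>" "\<And>z. z \<notin> K \<Longrightarrow> \<phi> z = 0"
    using test_functionsE[OF \<phi>] by blast
  have ct: "continuous_on UNIV (twist_map (\<lambda>x. - \<theta> x))"
    by (intro continuous_twist_map continuous_intros \<theta>)
  define K' where "K' = (\<lambda>z. snd (twist_map (\<lambda>x. - \<theta> x) z)) ` K"
  show ?thesis
  proof (rule test_functionsI[of _ K'])
    show "C_k k (\<lambda>y. \<phi> (twist_map \<theta> (x, y)))" for k
      unfolding twist_map_slice by (rule C_k_affine(1)[OF twist_slice_linear test_functions_C_k[OF \<phi>]])
    have "continuous_on K (\<lambda>z. snd (twist_map (\<lambda>x. - \<theta> x) z))"
      using continuous_on_subset[OF ct] by (intro continuous_on_snd) auto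
    then show "compact K'" unfolding K'_def using K(1) by (rule compact_continuous_image)
    show "K' \<subseteq> \<omega>" using K(2) unfolding K'_def tube_eq_vimage by (auto simp: mem_Times_iff)
    show "\<phi> (twist_map \<theta> (x, y)) = 0" if "y \<notin> K'" for y
    proof (rule K(3))
      show "twist_map \<theta> (x, y) \<notin> K"
      proof
        assume "twist_map \<theta> (x, y) \<in> K"
        then have "snd (twist_map (\<lambda>x. - \<theta> x) (twist_map \<theta> (x, y))) \<in> K'" unfolding K'_def by (rule imageI)
        then show False using that by (simp add: twist_map_inverse)
      qed
    qed
  qed
qed

text \<open>The two derivatives of the slice are the rotated transversal derivatives, and rotations
  preserve length.\<close>

lemma slice_gradient:
  assumes \<phi>: "\<phi> \<in> test_functions \<Omega>"
  shows "(cmod (partial_deriv e1 (\<lambda>y. \<phi> (twist_map \<theta> (x, y))) y))\<^sup>2 + (cmod (partial_deriv e2 (\<lambda>y. \<phi> (twist_map \<theta> (x, y))) y))\<^sup>2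
     = (cmod (partial_deriv d2 \<phi> (twist_map \<theta> (x, y))))\<^sup>2 + (cmod (partial_deriv d3 \<phi> (twist_map \<theta> (x, y))))\<^sup>2"
proof -
  define c s where "c = cos (\<theta> x)" and "s = sin (\<theta> x)"
  define p q where "p = partial_deriv d2 \<phi> (twist_map \<theta> (x, y))" and "q = partial_deriv d3 \<phi> (twist_map \<theta> (x, y))"
  have cs: "c\<^sup>2 + s\<^sup>2 = 1" by (simp add: c_def s_def)
  have pd: "partial_deriv b (\<lambda>y. \<phi> (twist_map \<theta> (x, y))) y =
     (\<Sum>e\<in>Basis. complex_of_real ((0, fst b * c + snd b * s, - fst b * s + snd b * c) \<bullet> e) * partial_deriv e \<phi> (twist_map \<theta> (x, y)))" for b
    unfolding twist_map_slice c_def s_def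
    by (rule partial_deriv_affine[OF twist_slice_linear test_functions_C_k[OF \<phi>, of "Suc 0"]])
  have 1: "partial_deriv e1 (\<lambda>y. \<phi> (twist_map \<theta> (x, y))) y = complex_of_real c * p - complex_of_real s * q"
    unfolding pd sum_Basis_real_triple by (simp add: p_def q_def)
  have 2: "partial_deriv e2 (\<lambda>y. \<phi> (twist_map \<theta> (x, y))) y = complex_of_real s * p + complex_of_real c * q"
    unfolding pd sum_Basis_real_triple by (simp add: p_def q_def)
  have "(cmod (complex_of_real c * p - complex_of_real s * q))\<^sup>2 + (cmod (complex_of_real s * p + complex_of_real c * q))\<^sup>2
      = (c\<^sup>2 + s\<^sup>2) * ((cmod p)\<^sup>2 + (cmod q)\<^sup>2)"
    by (simp only: cmod_power2) (simp add: power2_eq_square algebra_simps)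
  then show ?thesis unfolding 1 2 cs by (simp add: p_def q_def)
qed

text \<open>The Rayleigh bound of \<open>\<omega>\<close> on each slice, integrated over
  \<open>x\<close> by volume preservation. It makes \<open>Q\<close> dominate the longitudinal
  energy.\<close>

lemma tube_transversal_estimate:
  assumes \<phi>: "\<phi> \<in> test_functions (tube \<theta> \<omega>)" and \<theta>: "continuous_on UNIV \<theta>" and \<Lambda>: "rayleigh_inf \<omega> \<ge> 0"
  shows "rayleigh_inf \<omega> * (nrm lborel \<phi>)\<^sup>2 \<le> (nrm lborel (partial_deriv d2 \<phi>))\<^sup>2 + (nrm lborel (partial_deriv d3 \<phi>))\<^sup>2"
proof -
  define \<Lambda> where "\<Lambda> = rayleigh_inf \<omega>"
  have dT: "partial_deriv d2 \<phi> \<in> test_functions (tube \<theta> \<omega>)" "partial_deriv d3 \<phi> \<in> test_functions (tube \<theta> \<omega>)"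
    using test_functions_partial_deriv[OF \<phi>] by (auto simp: Basis_real_triple)
  note sq = test_functions_sq_int_lborel
  have [measurable]: "\<phi> \<in> borel_measurable borel" "partial_deriv d2 \<phi> \<in> borel_measurable borel" "partial_deriv d3 \<phi> \<in> borel_measurable borel"
    using \<phi> dT test_functions_measurable by blast+
  have slice: "ennreal \<Lambda> * (\<integral>\<^sup>+y. ennreal ((cmod (\<phi> (twist_map \<theta> (x, y))))\<^sup>2) \<partial>lborel) \<le>
     (\<integral>\<^sup>+y. ennreal ((cmod (partial_deriv d2 \<phi> (twist_map \<theta> (x, y))))\<^sup>2 + (cmod (partial_deriv d3 \<phi> (twist_map \<theta> (x, y))))\<^sup>2) \<partial>lborel)" for x
  proof -
    define f where "f = (\<lambda>y. \<phi> (twist_map \<theta> (x, y)))"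
    have f: "f \<in> test_functions \<omega>" unfolding f_def by (rule slice_test_function[OF \<phi> \<theta>])
    have fd: "partial_deriv e1 f \<in> test_functions \<omega>" "partial_deriv e2 f \<in> test_functions \<omega>"
      using test_functions_partial_deriv[OF f] by (auto simp: Basis_real_pair)
    have [measurable]: "partial_deriv e1 f \<in> borel_measurable borel" "partial_deriv e2 f \<in> borel_measurable borel"
      using fd test_functions_measurable by blast+
    have "ennreal \<Lambda> * ennreal ((nrm lborel f)\<^sup>2) = ennreal (\<Lambda> * (nrm lborel f)\<^sup>2)"
      using \<Lambda> by (simp add: \<Lambda>_def ennreal_mult)
    also have "\<dots> \<le> ennreal ((nrm lborel (partial_deriv e1 f))\<^sup>2 + (nrm lborel (partial_deriv e2 f))\<^sup>2)"
      using rayleigh_inf_le[OF f] by (intro ennreal_leI) (simp add: \<Lambda>_def grad_sq_def sum_Basis_real_pair)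
    also have "\<dots> = (\<integral>\<^sup>+y. ennreal ((cmod (partial_deriv e1 f y))\<^sup>2) \<partial>lborel) + (\<integral>\<^sup>+y. ennreal ((cmod (partial_deriv e2 f y))\<^sup>2) \<partial>lborel)"
      unfolding nn_integral_sq_nrm[OF sq[OF fd(1)]] nn_integral_sq_nrm[OF sq[OF fd(2)]] by simp
    also have "\<dots> = (\<integral>\<^sup>+y. ennreal ((cmod (partial_deriv e1 f y))\<^sup>2 + (cmod (partial_deriv e2 f y))\<^sup>2) \<partial>lborel)"
      by (simp add: nn_integral_add[symmetric])
    also have "\<dots> = (\<integral>\<^sup>+y. ennreal ((cmod (partial_deriv d2 \<phi> (twist_map \<theta> (x, y))))\<^sup>2 + (cmod (partial_deriv d3 \<phi> (twist_map \<theta> (x, y))))\<^sup>2) \<partial>lborel)"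
      unfolding f_def by (simp only: slice_gradient[OF \<phi>])
    finally show ?thesis using nn_integral_sq_nrm[OF sq[OF f]] by (simp add: f_def)
  qed
  have mc: "(\<lambda>x. \<integral>\<^sup>+y. ennreal ((cmod (\<phi> (twist_map \<theta> (x, y))))\<^sup>2) \<partial>lborel) \<in> borel_measurable borel"
  proof -
    have "(\<lambda>z. ennreal ((cmod (\<phi> (twist_map \<theta> z)))\<^sup>2)) \<in> borel_measurable borel"
      by (rule borel_measurable_compose_continuous[OF _ continuous_twist_map[OF \<theta>], of "\<lambda>z. ennreal ((cmod (\<phi> z))\<^sup>2)"]) measurable
    then have "(\<lambda>z. ennreal ((cmod (\<phi> (twist_map \<theta> z)))\<^sup>2)) \<in> borel_measurable (lborel \<Otimes>\<^sub>M lborel)"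
      by (simp add: lborel_prod)
    from lborel.borel_measurable_nn_integral_fst[OF this] show ?thesis by simp
  qed
  have "ennreal (\<Lambda> * (nrm lborel \<phi>)\<^sup>2) = ennreal \<Lambda> * (\<integral>\<^sup>+z. ennreal ((cmod (\<phi> z))\<^sup>2) \<partial>lborel)"
    using \<Lambda> nn_integral_sq_nrm[OF sq[OF \<phi>]] by (simp add: \<Lambda>_def ennreal_mult)
  also have "\<dots> = (\<integral>\<^sup>+x. ennreal \<Lambda> * (\<integral>\<^sup>+y. ennreal ((cmod (\<phi> (twist_map \<theta> (x, y))))\<^sup>2) \<partial>lborel) \<partial>lborel)"
    using nn_integral_twist[OF \<theta>, of "\<lambda>z. ennreal ((cmod (\<phi> z))\<^sup>2)"] mc by (simp add: nn_integral_cmult)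
  also have "\<dots> \<le> (\<integral>\<^sup>+x. (\<integral>\<^sup>+y. ennreal ((cmod (partial_deriv d2 \<phi> (twist_map \<theta> (x, y))))\<^sup>2 + (cmod (partial_deriv d3 \<phi> (twist_map \<theta> (x, y))))\<^sup>2) \<partial>lborel) \<partial>lborel)"
    by (rule nn_integral_mono) (rule slice)
  also have "\<dots> = (\<integral>\<^sup>+z. ennreal ((cmod (partial_deriv d2 \<phi> z))\<^sup>2 + (cmod (partial_deriv d3 \<phi> z))\<^sup>2) \<partial>lborel)"
    by (rule nn_integral_twist[OF \<theta>]) measurable
  also have "\<dots> = ennreal ((nrm lborel (partial_deriv d2 \<phi>))\<^sup>2) + ennreal ((nrm lborel (partial_deriv d3 \<phi>))\<^sup>2)"
    unfolding nn_integral_sq_nrm[OF sq[OF dT(1)], symmetric] nn_integral_sq_nrm[OF sq[OF dT(2)], symmetric]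
    by (simp add: nn_integral_add[symmetric])
  also have "\<dots> = ennreal ((nrm lborel (partial_deriv d2 \<phi>))\<^sup>2 + (nrm lborel (partial_deriv d3 \<phi>))\<^sup>2)" by simp
  finally show ?thesis by (simp add: \<Lambda>_def del: ennreal_plus)
qed

text \<open>The first bound takes \<open>outer 0\<close> and the full fibre derivative. The second
  takes \<open>outer R\<close>, where that derivative is longitudinal, and adds the middle part.
  Here the extended integrals become real numbers.\<close>

lemma tube_real_estimates:
  assumes \<theta>: "\<And>x. (\<theta> has_real_derivative \<theta>' x) (at x)" and c\<theta>': "continuous_on UNIV \<theta>'"
    and \<phi>: "\<phi> \<in> test_functions (tube \<theta> \<omega>)" and g: "g \<in> borel_measurable borel" and l: "l > 0" and R: "R > 0"
    and a: "\<And>y. y \<in> \<omega> \<Longrightarrow> norm y \<le> a" "0 \<le> a" and M: "\<And>x. \<bar>\<theta>' x\<bar> \<le> M" and z: "\<And>x. x \<in> outer R \<Longrightarrow> \<theta>' x = 0"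
    and N: "(\<integral>\<^sup>+y. (\<integral>\<^sup>+x. ennreal (cmod (g (twist_map \<theta> (x, y)))) \<partial>lborel)\<^sup>2 \<partial>lborel) = ennreal N" "0 \<le> N"
    and \<delta>: "(\<integral>\<^sup>+z. ennreal ((cmod (\<phi> z - g z))\<^sup>2) \<partial>lborel) = ennreal \<delta>" "0 \<le> \<delta>"
  defines "S \<equiv> (nrm lborel \<phi>)\<^sup>2" and "A \<equiv> \<lambda>b. (nrm lborel (partial_deriv b \<phi>))\<^sup>2"
  shows "S \<le> 4 * (N / l + \<delta> + l\<^sup>2 * (3 * (A d1 + (M * a)\<^sup>2 * (A d2 + A d3))))"
    and "S \<le> (1 + 4 * R) * (4 * (N / l + \<delta> + l\<^sup>2 * A d1)) + 4 * R * (2 * R + 1) * A d1"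
proof -
  have dT: "partial_deriv b \<phi> \<in> test_functions (tube \<theta> \<omega>)" if "b \<in> {d1, d2, d3}" for b
    using test_functions_partial_deriv[OF \<phi>] that by (auto simp: Basis_real_triple)
  note sq = test_functions_sq_int_lborel
  have md: "partial_deriv b \<phi> \<in> borel_measurable borel" if "b \<in> {d1, d2, d3}" for b
    using dT[OF that] test_functions_measurable by blast
  have [measurable]: "\<phi> \<in> borel_measurable borel" "partial_deriv d1 \<phi> \<in> borel_measurable borel"
    "partial_deriv d2 \<phi> \<in> borel_measurable borel" "partial_deriv d3 \<phi> \<in> borel_measurable borel"
    using md test_functions_measurable[OF \<phi>] by auto
  have AS: "(\<integral>\<^sup>+z. ennreal ((cmod (\<phi> z))\<^sup>2) \<partial>lborel) = ennreal S"
    "\<And>b. b \<in> {d1, d2, d3} \<Longrightarrow> (\<integral>\<^sup>+z. ennreal ((cmod (partial_deriv b \<phi> z))\<^sup>2) \<partial>lborel) = ennreal (A b)"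
    using nn_integral_sq_nrm[OF sq[OF \<phi>]] nn_integral_sq_nrm[OF sq[OF dT]] by (auto simp: S_def A_def)
  have A0: "0 \<le> A b" for b by (simp add: A_def)
  have S0: "0 \<le> S" by (simp add: S_def)
  define \<mu> where "\<mu> = (M * a)\<^sup>2"
  have \<mu>0: "\<mu> \<ge> 0" by (simp add: \<mu>_def)
  have il: "ennreal (1 / l) * ennreal N = ennreal (N / l)" using l N(2) by (simp add: ennreal_mult[symmetric])
  have e4: "4 * (ennreal x + ennreal d + ennreal p * ennreal q) = ennreal (4 * (x + d + p * q))"
    if "0 \<le> x" "0 \<le> d" "0 \<le> p" "0 \<le> q" for x d p q
    using that by (simp add: ennreal_mult)
  have o0: "outer 0 = UNIV" by (auto simp: outer_def)
  define D where "D z = ennreal (3 * ((cmod (partial_deriv d1 \<phi> z))\<^sup>2 + \<mu> * ((cmod (partial_deriv d2 \<phi> z))\<^sup>2 + (cmod (partial_deriv d3 \<phi> z))\<^sup>2)))" for z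
  have mD: "D \<in> borel_measurable borel" unfolding D_def[abs_def] by measurable
  have DI: "(\<integral>\<^sup>+z. D z \<partial>lborel) = ennreal (3 * (A d1 + \<mu> * (A d2 + A d3)))"
  proof -
    have "D z = 3 * (ennreal ((cmod (partial_deriv d1 \<phi> z))\<^sup>2) + ennreal \<mu> * (ennreal ((cmod (partial_deriv d2 \<phi> z))\<^sup>2) + ennreal ((cmod (partial_deriv d3 \<phi> z))\<^sup>2)))" for z
      using \<mu>0 by (simp add: D_def ennreal_mult)
    then have "(\<integral>\<^sup>+z. D z \<partial>lborel) = 3 * (ennreal (A d1) + ennreal \<mu> * (ennreal (A d2) + ennreal (A d3)))"
      using AS(2) by (simp add: nn_integral_cmult nn_integral_add)
    then show ?thesis using A0 \<mu>0 by (simp add: ennreal_mult)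
  qed
  have "(\<integral>\<^sup>+z. ennreal ((cmod (\<phi> z))\<^sup>2) * indicator (outer 0) (fst z) \<partial>lborel) \<le>
     4 * (ennreal (1 / l) * ennreal N + ennreal \<delta> + ennreal (l\<^sup>2) * (\<integral>\<^sup>+z. D z * indicator (outer 0) (fst z) \<partial>lborel))"
    unfolding N(1)[symmetric] \<delta>(1)[symmetric]
  proof (rule tube_outer_estimate[OF \<theta> c\<theta>' \<phi> g l order_refl mD])
    show "ennreal ((cmod (fibre_deriv \<theta> \<theta>' \<phi> y x))\<^sup>2) \<le> D (twist_map \<theta> (x, y))" for x y
      unfolding D_def \<mu>_def
      by (rule ennreal_leI, rule fibre_deriv_bound[where \<theta> = \<theta> and \<theta>' = \<theta>' and x = x and \<omega> = \<omega>])
         (use \<phi> a M in auto)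
  qed
  then have "ennreal S \<le> 4 * (ennreal (N / l) + ennreal \<delta> + ennreal (l\<^sup>2) * ennreal (3 * (A d1 + \<mu> * (A d2 + A d3))))"
    by (simp add: o0 AS DI il)
  also have "\<dots> = ennreal (4 * (N / l + \<delta> + l\<^sup>2 * (3 * (A d1 + \<mu> * (A d2 + A d3)))))"
    by (rule e4) (use A0 \<mu>0 N(2) \<delta>(2) l in auto)
  finally have 1: "S \<le> 4 * (N / l + \<delta> + l\<^sup>2 * (3 * (A d1 + \<mu> * (A d2 + A d3))))"
    by (rule ennreal_le_iff[THEN iffD1, rotated]) (use A0 \<mu>0 N(2) \<delta>(2) l in simp)
  then show "S \<le> 4 * (N / l + \<delta> + l\<^sup>2 * (3 * (A d1 + (M * a)\<^sup>2 * (A d2 + A d3))))" by (simp add: \<mu>_def)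
  define D' where "D' z = ennreal ((cmod (partial_deriv d1 \<phi> z))\<^sup>2)" for z
  have mD': "D' \<in> borel_measurable borel" unfolding D'_def[abs_def] by measurable
  let ?O = "\<integral>\<^sup>+z. ennreal ((cmod (\<phi> z))\<^sup>2) * indicator (outer R) (fst z) \<partial>lborel"
  have "?O \<le> 4 * (ennreal (1 / l) * ennreal N + ennreal \<delta> + ennreal (l\<^sup>2) * (\<integral>\<^sup>+z. D' z * indicator (outer R) (fst z) \<partial>lborel))"
    unfolding N(1)[symmetric] \<delta>(1)[symmetric]
  proof (rule tube_outer_estimate[OF \<theta> c\<theta>' \<phi> g l _ mD'])
    show "ennreal ((cmod (fibre_deriv \<theta> \<theta>' \<phi> y x))\<^sup>2) \<le> D' (twist_map \<theta> (x, y))" if "x \<in> outer R" for x y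
      by (simp add: D'_def fibre_deriv_def z[OF that])
  qed (use R in simp)
  also have "\<dots> \<le> 4 * (ennreal (1 / l) * ennreal N + ennreal \<delta> + ennreal (l\<^sup>2) * ennreal (A d1))"
    using AS(2)[of d1] unfolding D'_def
    by (intro mult_left_mono add_mono order_refl) (auto simp: indicator_def intro!: nn_integral_mono elim!: subst)
  also have "\<dots> = ennreal (4 * (N / l + \<delta> + l\<^sup>2 * A d1))"
    unfolding il by (rule e4) (use A0 N(2) \<delta>(2) l in auto)
  finally have O: "?O \<le> ennreal (4 * (N / l + \<delta> + l\<^sup>2 * A d1))" .
  have mid: "(\<integral>\<^sup>+z. ennreal ((cmod (\<phi> z))\<^sup>2) * indicator {-R..<R} (fst z) \<partial>lborel) \<le>
      ennreal (4 * R) * ?O + ennreal (4 * R * (2 * R + 1)) * ennreal (A d1)"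
    using tube_middle_estimate[OF \<phi> R] AS(2)[of d1] by simp
  have mi: "(\<lambda>z::real\<times>real\<times>real. indicator B (fst z) :: ennreal) \<in> borel_measurable borel" if "B \<in> sets borel" for B
    using that by (intro borel_measurable_compose_continuous[OF borel_measurable_indicator]) (auto intro: continuous_intros)
  have [measurable]: "(\<lambda>z::real\<times>real\<times>real. indicator (outer R) (fst z) :: ennreal) \<in> borel_measurable borel"
    "(\<lambda>z::real\<times>real\<times>real. indicator {-R..<R} (fst z) :: ennreal) \<in> borel_measurable borel"
    by (rule mi, simp)+
  have "ennreal S = ?O + (\<integral>\<^sup>+z. ennreal ((cmod (\<phi> z))\<^sup>2) * indicator {-R..<R} (fst z) \<partial>lborel)"
    unfolding AS(1)[symmetric]
    by (subst nn_integral_add[symmetric], measurable) (auto simp: outer_def indicator_def intro!: nn_integral_cong)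
  also have "\<dots> \<le> ?O + (ennreal (4 * R) * ?O + ennreal (4 * R * (2 * R + 1)) * ennreal (A d1))"
    using mid by (rule add_left_mono)
  also have "\<dots> \<le> ennreal (4 * (N / l + \<delta> + l\<^sup>2 * A d1)) + (ennreal (4 * R) * ennreal (4 * (N / l + \<delta> + l\<^sup>2 * A d1)) + ennreal (4 * R * (2 * R + 1)) * ennreal (A d1))"
    by (intro add_mono mult_left_mono O order_refl) auto
  also have "\<dots> = ennreal ((1 + 4 * R) * (4 * (N / l + \<delta> + l\<^sup>2 * A d1)) + 4 * R * (2 * R + 1) * A d1)"
  proof -
    have q: "ennreal x + (ennreal (4 * R) * ennreal x + ennreal q * ennreal y) = ennreal ((1 + 4 * R) * x + q * y)"
      if "0 \<le> x" "0 \<le> y" "0 \<le> q" for x y q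
      using that R by (simp add: ennreal_mult[symmetric] ennreal_plus[symmetric] distrib_right del: ennreal_plus)
    show ?thesis by (rule q) (use A0 N(2) \<delta>(2) l R in auto)
  qed
  finally show "S \<le> (1 + 4 * R) * (4 * (N / l + \<delta> + l\<^sup>2 * A d1)) + 4 * R * (2 * R + 1) * A d1"
    by (rule ennreal_le_iff[THEN iffD1, rotated]) (use A0 N(2) \<delta>(2) l R in simp)
qed

text \<open>
  For \<open>l \<ge> 1\<close> the second hypothesis suffices; for small \<open>l\<close> the first one does, because there
  \<open>\<Lambda> S\<close> can be absorbed on the left. Intermediate \<open>l\<close> are reduced to a fixed small one.
\<close>

lemma absorb_estimates:
  fixes \<Lambda> \<mu> R :: real
  assumes \<Lambda>: "\<Lambda> \<ge> 0" and \<mu>: "\<mu> \<ge> 0" and R: "R > 0"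
  obtains C where "C > 0" "\<And>S A1 A2 A3 N \<delta> l. \<lbrakk>0 \<le> S; 0 \<le> A1; 0 \<le> A2; 0 \<le> A3; 0 \<le> N; 0 \<le> \<delta>; \<Lambda> * S \<le> A2 + A3;
     \<And>l. l > 0 \<Longrightarrow> S \<le> 4 * (N / l + \<delta> + l\<^sup>2 * (3 * (A1 + \<mu> * (A2 + A3))));
     \<And>l. l > 0 \<Longrightarrow> S \<le> (1 + 4 * R) * (4 * (N / l + \<delta> + l\<^sup>2 * A1)) + 4 * R * (2 * R + 1) * A1; l > 0\<rbrakk>
     \<Longrightarrow> S \<le> C * (l\<^sup>2 * (A1 + A2 + A3 - \<Lambda> * S) + N / l + \<delta>)"
proof -
  \<comment> \<open>The 12 is the \<open>4 * 3\<close> of the first hypothesis. The other factors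
    bound \<open>A1 + \<mu> * (A2 + A3)\<close> by a multiple of \<open>Q + S\<close>, because
    \<open>A1 + A2 + A3\<close> is \<open>Q + \<Lambda> * S\<close>.\<close>
  define k where "k = 12 * (1 + \<mu>) * (1 + \<Lambda>)"
  have k12: "k \<ge> 12"
  proof -
    have "1 * 1 \<le> (1 + \<mu>) * (1 + \<Lambda>)" using \<Lambda> \<mu> by (intro mult_mono) auto
    then have "12 * (1 * 1) \<le> 12 * ((1 + \<mu>) * (1 + \<Lambda>))" by (rule mult_left_mono) simp
    then show ?thesis unfolding k_def by (simp only: mult.assoc mult_1_right)
  qed
  \<comment> \<open>The largest scale treated by absorption: as \<open>l0 < 1\<close>, the
    coefficient \<open>k * l\<^sup>2\<close> of \<open>S\<close> is at most one half up to
    it.\<close>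
  define l0 where "l0 = 1 / (2 * k)"
  have l0: "0 < l0" "l0 < 1" using k12 by (simp_all add: l0_def)
  have kl: "k * l\<^sup>2 \<le> 1 / 2" if "0 < l" "l \<le> l0" for l
  proof -
    have "l\<^sup>2 \<le> l0 * 1" unfolding power2_eq_square using that l0 by (intro mult_mono) auto
    then have "k * l\<^sup>2 \<le> k * l0" using k12 by (simp add: mult_left_mono)
    then show ?thesis using k12 by (simp add: l0_def)
  qed
  \<comment> \<open>The total coefficient of \<open>l\<^sup>2 * Q\<close> that the second hypothesis
    produces when \<open>l \<ge> 1\<close>.\<close>
  define P where "P = (1 + 4 * R) * 4 + 4 * R * (2 * R + 1)"
  have P: "P > 0" using R by (simp add: P_def add_pos_pos)
  define C where "C = P + 8 / l0 + 2 * k + 8"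
  have Cs: "C \<ge> P" "C \<ge> 8 / l0" "C \<ge> 2 * k" "C \<ge> 8" using P l0 k12 by (auto simp: C_def)
  have C0: "C > 0" using Cs(4) by simp
  show ?thesis
  proof (rule that[OF C0])
    fix S A1 A2 A3 N \<delta> l :: real
    assume nn: "0 \<le> S" "0 \<le> A1" "0 \<le> A2" "0 \<le> A3" "0 \<le> N" "0 \<le> \<delta>" and \<Lambda>S: "\<Lambda> * S \<le> A2 + A3"
      and a: "\<And>l. l > 0 \<Longrightarrow> S \<le> 4 * (N / l + \<delta> + l\<^sup>2 * (3 * (A1 + \<mu> * (A2 + A3))))"
      and b: "\<And>l. l > 0 \<Longrightarrow> S \<le> (1 + 4 * R) * (4 * (N / l + \<delta> + l\<^sup>2 * A1)) + 4 * R * (2 * R + 1) * A1"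
      and l: "l > 0"
    define Q where "Q = A1 + A2 + A3 - \<Lambda> * S"
    have Q: "A1 \<le> Q" "0 \<le> Q" using \<Lambda>S nn by (auto simp: Q_def)
    have small: "S \<le> 8 * (N / t) + 8 * \<delta> + 2 * k * (t\<^sup>2 * Q)" if t: "0 < t" "t \<le> l0" for t
    proof -
      have "A1 + \<mu> * (A2 + A3) \<le> (1 + \<mu>) * (A1 + A2 + A3)"
        using nn \<mu> by (simp add: algebra_simps add_nonneg_nonneg)
      also have "A1 + A2 + A3 = Q + \<Lambda> * S" by (simp add: Q_def)
      also have "(1 + \<mu>) * (Q + \<Lambda> * S) \<le> (1 + \<mu>) * ((1 + \<Lambda>) * (Q + S))"
        using nn Q \<mu> \<Lambda> by (intro mult_left_mono) (auto simp: algebra_simps)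
      finally have "A1 + \<mu> * (A2 + A3) \<le> (1 + \<mu>) * ((1 + \<Lambda>) * (Q + S))" .
      then have "12 * (A1 + \<mu> * (A2 + A3)) \<le> 12 * ((1 + \<mu>) * ((1 + \<Lambda>) * (Q + S)))"
        by (rule mult_left_mono) simp
      then have "12 * (A1 + \<mu> * (A2 + A3)) \<le> k * (Q + S)" unfolding k_def by (simp only: mult.assoc)
      then have "t\<^sup>2 * (12 * (A1 + \<mu> * (A2 + A3))) \<le> t\<^sup>2 * (k * (Q + S))" by (rule mult_left_mono) simp
      also have "\<dots> = k * (t\<^sup>2 * Q) + k * t\<^sup>2 * S" by (simp add: algebra_simps)
      also have "k * t\<^sup>2 * S \<le> 1 / 2 * S" using kl[OF t] nn(1) by (rule mult_right_mono)
      finally have w: "t\<^sup>2 * (12 * (A1 + \<mu> * (A2 + A3))) \<le> k * (t\<^sup>2 * Q) + 1 / 2 * S" by simp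
      have "S \<le> 4 * (N / t) + 4 * \<delta> + t\<^sup>2 * (12 * (A1 + \<mu> * (A2 + A3)))"
        using a[OF t(1)] by (simp add: algebra_simps)
      then show ?thesis using w by simp
    qed
    have nl: "0 \<le> N / l" "0 \<le> l\<^sup>2 * Q" using nn Q l by auto
    have fin: "x * (l\<^sup>2 * Q) + y * (N / l) + v * \<delta> \<le> C * (l\<^sup>2 * Q + N / l + \<delta>)" if "x \<le> C" "y \<le> C" "v \<le> C" for x y v
      using mult_right_mono[OF that(1) nl(2)] mult_right_mono[OF that(2) nl(1)] mult_right_mono[OF that(3) nn(6)]
      by (simp add: distrib_left)
    consider "1 \<le> l" | "l < 1" "l0 \<le> l" | "l < l0" by linarith
    then have "S \<le> C * (l\<^sup>2 * Q + N / l + \<delta>)"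
    proof cases
      case 1
      have "1 \<le> l\<^sup>2" using 1 by (simp add: one_le_power)
      \<comment> \<open>The contribution of the middle part carries no factor
        \<open>l\<^sup>2\<close>, so this comparison requires \<open>l \<ge> 1\<close>.\<close>
      have A1Q: "A1 \<le> l\<^sup>2 * Q" using mult_mono[OF \<open>1 \<le> l\<^sup>2\<close> Q(1)] nn by simp
      have "l\<^sup>2 * A1 \<le> l\<^sup>2 * Q" using Q(1) by (rule mult_left_mono) simp
      have "S \<le> (1 + 4 * R) * (4 * (N / l + \<delta> + l\<^sup>2 * A1)) + 4 * R * (2 * R + 1) * A1" by (rule b[OF l])
      also have "\<dots> \<le> (1 + 4 * R) * (4 * (N / l + \<delta> + l\<^sup>2 * Q)) + 4 * R * (2 * R + 1) * (l\<^sup>2 * Q)"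
        using R A1Q Q(1) by (intro add_mono mult_left_mono) auto
      also have "\<dots> = P * (l\<^sup>2 * Q) + (1 + 4 * R) * 4 * (N / l) + (1 + 4 * R) * 4 * \<delta>"
        by (simp only: P_def distrib_left distrib_right mult.assoc)
      also have "\<dots> \<le> C * (l\<^sup>2 * Q + N / l + \<delta>)"
      proof -
        have "(1 + 4 * R) * 4 \<le> P" using R by (simp add: P_def)
        then have q: "(1 + 4 * R) * 4 \<le> C" using Cs(1) by linarith
        show ?thesis by (rule fin[OF Cs(1) q q])
      qed
      finally show ?thesis .
    next
      case 2
      \<comment> \<open>At an intermediate scale the bound at \<open>l0\<close> is used: passing
        from \<open>l0\<close> to \<open>l\<close> enlarges the term with \<open>Q\<close> and costs
        a factor \<open>1 / l0\<close> in the term with \<open>N\<close>.\<close>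
      have "N / l0 \<le> 1 / l0 * (N / l)"
      proof -
        have "l * N \<le> 1 * N" using 2 nn by (intro mult_right_mono) auto
        then have "N \<le> N / l" using l by (simp add: pos_le_divide_eq mult.commute)
        then show ?thesis using mult_left_mono[of N "N / l" "1 / l0"] l0 by simp
      qed
      moreover have "l0\<^sup>2 * Q \<le> l\<^sup>2 * Q" using 2 l0 Q by (intro mult_right_mono power_mono) auto
      then have "2 * k * (l0\<^sup>2 * Q) \<le> 2 * k * (l\<^sup>2 * Q)" using k12 by (intro mult_left_mono) auto
      ultimately have "S \<le> 2 * k * (l\<^sup>2 * Q) + 8 / l0 * (N / l) + 8 * \<delta>"
        using small[of l0] l0 by simp
      also have "\<dots> \<le> C * (l\<^sup>2 * Q + N / l + \<delta>)" by (rule fin[OF Cs(3,2,4)])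
      finally show ?thesis .
    next
      case 3
      have "S \<le> 2 * k * (l\<^sup>2 * Q) + 8 * (N / l) + 8 * \<delta>" using small[OF l] 3 by simp
      also have "\<dots> \<le> C * (l\<^sup>2 * Q + N / l + \<delta>)" by (rule fin[OF Cs(3,4,4)])
      finally show ?thesis .
    qed
    then show "S \<le> C * (l\<^sup>2 * (A1 + A2 + A3 - \<Lambda> * S) + N / l + \<delta>)" by (simp add: Q_def)
  qed
qed

text \<open>For \<open>N = 0\<close> the quotient is 0 by the convention for division, and the claim
  is \<open>Q \<ge> 0\<close>. Otherwise the scale is chosen to make the term with \<open>N\<close>
  half of \<open>S\<close>.\<close>

lemma optimise_scale:
  fixes S Q N C :: real
  assumes C: "C > 0" and S: "S > 0" and Q: "Q \<ge> 0" and N: "N \<ge> 0"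
    and le: "\<And>l. l > 0 \<Longrightarrow> S \<le> C * (l\<^sup>2 * Q + N / l)"
  shows "1 / (8 * C ^ 3) * (S ^ 3 / N\<^sup>2) \<le> Q"
proof (cases "N = 0")
  case False
  then have N: "N > 0" using N by simp
  define l where "l = 2 * C * N / S"
  have l: "l > 0" using C N S by (simp add: l_def)
  \<comment> \<open>The other half of \<open>S\<close> is left for
    \<open>C * l\<^sup>2 * Q = 4 * C ^ 3 * N\<^sup>2 * Q / S\<^sup>2\<close>, whence the 8 in the
    constant.\<close>
  have "C * (N / l) = S / 2" using C N S by (simp add: l_def)
  then have "S / 2 \<le> C * (l\<^sup>2 * Q)" using le[OF l] by (simp add: distrib_left)
  also have "C * (l\<^sup>2 * Q) = 4 * C ^ 3 * N\<^sup>2 * Q / S\<^sup>2"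
    by (simp add: l_def power_divide power_mult_distrib power3_eq_cube power2_eq_square)
  finally have "S / 2 * S\<^sup>2 \<le> 4 * C ^ 3 * N\<^sup>2 * Q" using S by (simp add: pos_le_divide_eq)
  then have "S ^ 3 \<le> Q * (8 * C ^ 3 * N\<^sup>2)" by (simp add: power3_eq_cube power2_eq_square mult_ac)
  then have "S ^ 3 / (8 * C ^ 3 * N\<^sup>2) \<le> Q" using C N by (simp add: pos_divide_le_eq)
  then show ?thesis by simp
qed (use Q in simp)

subsection \<open>The longitudinal norm and the main theorem\<close>

lemma nn_integral_inverse_one_plus_sq_finite:
  "(\<integral>\<^sup>+x. ennreal (1 / (1 + (x::real)\<^sup>2)) \<partial>lborel) < \<infinity>"
proof -
  have [measurable]: "(\<lambda>x::real. ennreal (1 / (1 + x\<^sup>2))) \<in> borel_measurable borel" by measurable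
  have p: "(\<integral>\<^sup>+x\<in>{0..}. ennreal (1 / (1 + x\<^sup>2)) \<partial>lborel) = ennreal (pi / 2 - arctan 0)"
    by (rule nn_integral_FTC_atLeast)
       (auto intro!: derivative_eq_intros tendsto_arctan_at_top simp: inverse_eq_divide)
  have "(\<integral>\<^sup>+x\<in>{..0}. ennreal (1 / (1 + x\<^sup>2)) \<partial>lborel) = (\<integral>\<^sup>+x\<in>{0..}. ennreal (1 / (1 + x\<^sup>2)) \<partial>lborel)"
  proof -
    have "(\<integral>\<^sup>+x\<in>{..0}. ennreal (1 / (1 + x\<^sup>2)) \<partial>lborel) = (\<integral>\<^sup>+x. ennreal (1 / (1 + (- (x::real))\<^sup>2)) * indicator {..0} (- x) \<partial>lborel)"
      using nn_integral_real_affine[of "\<lambda>x. ennreal (1 / (1 + x\<^sup>2)) * indicator {..0} x" "-1" 0] by simp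
    also have "\<dots> = (\<integral>\<^sup>+x\<in>{0..}. ennreal (1 / (1 + x\<^sup>2)) \<partial>lborel)"
      by (intro nn_integral_cong) (auto simp: indicator_def)
    finally show ?thesis .
  qed
  moreover have "(\<integral>\<^sup>+x. ennreal (1 / (1 + (x::real)\<^sup>2)) \<partial>lborel) \<le>
     (\<integral>\<^sup>+x. ennreal (1 / (1 + x\<^sup>2)) * indicator {0..} x + ennreal (1 / (1 + x\<^sup>2)) * indicator {..0} x \<partial>lborel)"
    by (intro nn_integral_mono) (auto simp: indicator_def)
  ultimately have "(\<integral>\<^sup>+x. ennreal (1 / (1 + (x::real)\<^sup>2)) \<partial>lborel) \<le> ennreal (pi / 2 - arctan 0) + ennreal (pi / 2 - arctan 0)"
    using p by (simp add: nn_integral_add)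
  also have "\<dots> < \<infinity>" by (simp add: ennreal_add_eq_top less_top)
  finally show ?thesis .
qed

text \<open>Cauchy-Schwarz for \<open>h\<close> as a product of
  \<open>1 / sqrt (1 + x\<^sup>2)\<close>, which is \<open>rho\<close>, and
  \<open>sqrt (1 + x\<^sup>2) * h x\<close>.\<close>

lemma L1_sq_le_weighted_L2:
  fixes h :: "real \<Rightarrow> real"
  assumes h: "h \<in> borel_measurable borel" "\<And>x. 0 \<le> h x"
    and fin: "(\<integral>\<^sup>+x. ennreal ((1 + x\<^sup>2) * (h x)\<^sup>2) \<partial>lborel) \<noteq> \<infinity>"
  shows "(\<integral>\<^sup>+x. ennreal (h x) \<partial>lborel)\<^sup>2 \<le>
     (\<integral>\<^sup>+x. ennreal (1 / (1 + (x::real)\<^sup>2)) \<partial>lborel) * (\<integral>\<^sup>+x. ennreal ((1 + x\<^sup>2) * (h x)\<^sup>2) \<partial>lborel)"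
proof -
  note [measurable] = h(1)
  define a where "a x = 1 / sqrt (1 + x\<^sup>2)" for x :: real
  define b where "b x = sqrt (1 + x\<^sup>2) * h x" for x
  have pos: "1 + x\<^sup>2 > 0" for x :: real by (simp add: add_pos_nonneg)
  have a2: "(a x)\<^sup>2 = 1 / (1 + x\<^sup>2)" for x using pos[of x] by (simp add: a_def power_divide)
  have b2: "(b x)\<^sup>2 = (1 + x\<^sup>2) * (h x)\<^sup>2" for x using pos[of x] by (simp add: b_def power_mult_distrib)
  have ab: "a x * b x = h x" for x using pos[of x] by (simp add: a_def b_def)
  have ia: "integrable lborel (\<lambda>x. (a x)\<^sup>2)"
    unfolding a2 using nn_integral_inverse_one_plus_sq_finite pos less_imp_le[OF pos] by (intro integrableI_nonneg) auto
  have ib: "integrable lborel (\<lambda>x. (b x)\<^sup>2)"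
    unfolding b2 using fin less_imp_le[OF pos] by (intro integrableI_nonneg) (auto simp: less_top)
  have ih: "integrable lborel h"
  proof (rule Bochner_Integration.integrable_bound[OF Bochner_Integration.integrable_add[OF ia ib]])
    show "AE x in lborel. norm (h x) \<le> norm ((a x)\<^sup>2 + (b x)\<^sup>2)"
    proof (rule AE_I2)
      fix x
      have "2 * h x \<le> (a x)\<^sup>2 + (b x)\<^sup>2" using sum_squares_bound[of "a x" "b x"] ab[of x] by (simp add: mult.assoc)
      then show "norm (h x) \<le> norm ((a x)\<^sup>2 + (b x)\<^sup>2)" using h(2)[of x] by simp
    qed
  qed simp
  have "(\<integral>x. h x \<partial>lborel)\<^sup>2 \<le> (\<integral>x. (a x)\<^sup>2 \<partial>lborel) * (\<integral>x. (b x)\<^sup>2 \<partial>lborel)"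
    using CS_real[OF ia ib] ih by (simp add: ab)
  then have "ennreal ((\<integral>x. h x \<partial>lborel)\<^sup>2) \<le> ennreal ((\<integral>x. (a x)\<^sup>2 \<partial>lborel) * (\<integral>x. (b x)\<^sup>2 \<partial>lborel))"
    by (rule ennreal_leI)
  also have "\<dots> = ennreal (\<integral>x. (a x)\<^sup>2 \<partial>lborel) * ennreal (\<integral>x. (b x)\<^sup>2 \<partial>lborel)"
    by (intro ennreal_mult) auto
  also have "ennreal (\<integral>x. (a x)\<^sup>2 \<partial>lborel) = (\<integral>\<^sup>+x. ennreal ((a x)\<^sup>2) \<partial>lborel)"
    by (rule nn_integral_eq_integral[OF ia, symmetric]) simp
  also have "ennreal (\<integral>x. (b x)\<^sup>2 \<partial>lborel) = (\<integral>\<^sup>+x. ennreal ((b x)\<^sup>2) \<partial>lborel)"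
    by (rule nn_integral_eq_integral[OF ib, symmetric]) simp
  also have "ennreal ((\<integral>x. h x \<partial>lborel)\<^sup>2) = (\<integral>\<^sup>+x. ennreal (h x) \<partial>lborel)\<^sup>2"
    using h(2) by (subst nn_integral_eq_integral[OF ih]) (auto simp: ennreal_power)
  finally show ?thesis unfolding a2 b2 .
qed

text \<open>\<open>norm_one\<close> consists of Bochner integrals, which are 0 when the integrand is
  not integrable, of an arbitrary Lebesgue representative. The weight makes both integrals finite
  almost everywhere, so the value agrees with an iterated nonnegative integral of a Borel version
  extended by zero, the form needed in the estimates.\<close>

lemma norm_one_representative:
  fixes \<Psi> :: "real \<times> real \<times> real \<Rightarrow> complex"
  assumes \<theta>: "continuous_on UNIV \<theta>" and \<omega>: "open \<omega>"
    and \<Psi>: "\<Psi> \<in> L2_weighted (tube \<theta> \<omega>) (\<lambda>x. 1 / (rho x)\<^sup>2)"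
  obtains g where "g \<in> borel_measurable borel" "\<forall>z. z \<notin> tube \<theta> \<omega> \<longrightarrow> g z = 0"
    "AE z in lborel. z \<in> tube \<theta> \<omega> \<longrightarrow> \<Psi> z = g z"
    "(\<integral>\<^sup>+y. (\<integral>\<^sup>+x. ennreal (cmod (g (twist_map \<theta> (x, y)))) \<partial>lborel)\<^sup>2 \<partial>lborel) = ennreal ((norm_one \<theta> \<omega> \<Psi>)\<^sup>2)"
proof -
  define T where "T = tube \<theta> \<omega>"
  have oT: "open T" unfolding T_def by (rule open_tube[OF \<theta> \<omega>])
  have T: "T \<in> sets lebesgue" "T \<in> sets borel" using oT by auto
  note ct = continuous_twist_map[OF \<theta>]
  have cty: "continuous_on UNIV (\<lambda>x. twist_map \<theta> (x, y))" for y
    by (rule continuous_on_compose2[OF ct]) (auto intro: continuous_intros)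
  have m\<Psi>: "\<Psi> \<in> borel_measurable (lebesgue_on T)" and i\<Psi>: "integrable (lebesgue_on T) (\<lambda>x. 1 / (rho x)\<^sup>2 * (cmod (\<Psi> x))\<^sup>2)"
    using \<Psi> by (auto simp: L2_weighted_def T_def)
  define F where "F z = indicator T z *\<^sub>R \<Psi> z" for z
  have "F \<in> borel_measurable lebesgue"
    unfolding F_def[abs_def] using m\<Psi> T by (subst (asm) borel_measurable_restrict_space_iff) auto
  then obtain g0 where g0: "g0 \<in> borel_measurable borel" "AE z in lborel. F z = g0 z"
    using borel_version_complex by blast
  define g where "g z = indicator T z *\<^sub>R g0 z" for z
  have g[measurable]: "g \<in> borel_measurable borel" unfolding g_def[abs_def] using g0(1) T(2) by measurable
  have gT: "g z = 0" if "z \<notin> T" for z using that by (simp add: g_def)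
  have Fg: "AE z in lborel. F z = g z"
    using g0(2) by eventually_elim (auto simp: g_def F_def indicator_def)
  have ae: "AE z in lborel. z \<in> T \<longrightarrow> \<Psi> z = g z"
    using Fg by eventually_elim (auto simp: F_def)
  have rho2: "1 / (rho z)\<^sup>2 = 1 + (fst z)\<^sup>2" for z
    by (simp add: rho_def power_divide add_nonneg_nonneg)
  have mw: "(\<lambda>z::real\<times>real\<times>real. 1 + (fst z)\<^sup>2) \<in> borel_measurable borel"
    by (intro borel_measurable_continuous_onI continuous_intros)
  note [measurable] = mw
  have Wfin: "(\<integral>\<^sup>+z. ennreal ((1 + (fst z)\<^sup>2) * (cmod (g z))\<^sup>2) \<partial>lborel) < \<infinity>"
  proof -
    have "integrable lebesgue (\<lambda>z. indicator T z *\<^sub>R ((1 + (fst z)\<^sup>2) * (cmod (\<Psi> z))\<^sup>2))"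
      using i\<Psi> T(1) unfolding rho2 by (subst (asm) integrable_restrict_space) auto
    then have "(\<integral>\<^sup>+z. ennreal (norm (indicator T z *\<^sub>R ((1 + (fst z)\<^sup>2) * (cmod (\<Psi> z))\<^sup>2))) \<partial>lebesgue) < \<infinity>"
      by (simp add: integrable_iff_bounded)
    also have "(\<integral>\<^sup>+z. ennreal (norm (indicator T z *\<^sub>R ((1 + (fst z)\<^sup>2) * (cmod (\<Psi> z))\<^sup>2))) \<partial>lebesgue)
       = (\<integral>\<^sup>+z. ennreal ((1 + (fst z)\<^sup>2) * (cmod (g z))\<^sup>2) \<partial>lebesgue)"
    proof (rule nn_integral_cong_AE)
      show "AE z in lebesgue. ennreal (norm (indicator T z *\<^sub>R ((1 + (fst z)\<^sup>2) * (cmod (\<Psi> z))\<^sup>2)))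
         = ennreal ((1 + (fst z)\<^sup>2) * (cmod (g z))\<^sup>2)"
        using AE_completion[OF ae] by eventually_elim (auto simp: indicator_def gT abs_mult)
    qed
    also have "\<dots> = (\<integral>\<^sup>+z. ennreal ((1 + (fst z)\<^sup>2) * (cmod (g z))\<^sup>2) \<partial>lborel)"
      by (rule nn_integral_completion) 
    finally show ?thesis .
  qed
  define V where "V y = (\<integral>\<^sup>+x. ennreal (cmod (g (twist_map \<theta> (x, y)))) \<partial>lborel)" for y
  define K where "K y = (\<integral>\<^sup>+x. ennreal ((1 + x\<^sup>2) * (cmod (g (twist_map \<theta> (x, y))))\<^sup>2) \<partial>lborel)" for y
  have mm: "(\<lambda>y. \<integral>\<^sup>+x. h (twist_map \<theta> (x, y)) \<partial>lborel) \<in> borel_measurable borel"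
    if "h \<in> borel_measurable borel" for h :: "real \<times> real \<times> real \<Rightarrow> ennreal"
    by (rule borel_measurable_nn_integral_fst_arg[OF borel_measurable_compose_continuous[OF that ct]])
  have mV[measurable]: "V \<in> borel_measurable borel"
    unfolding V_def by (rule mm[of "\<lambda>z. ennreal (cmod (g z))"]) measurable
  have fst_tw: "fst (twist_map \<theta> (x, y)) = x" for x y by (simp add: twist_map_eq)
  have mW: "(\<lambda>z. ennreal ((1 + (fst z)\<^sup>2) * (cmod (g z))\<^sup>2)) \<in> borel_measurable borel" by measurable
  have mK[measurable]: "K \<in> borel_measurable borel"
    unfolding K_def using mm[OF mW] by (simp add: fst_tw)
  have KI: "(\<integral>\<^sup>+y. K y \<partial>lborel) < \<infinity>"
    using nn_integral_twist_swap[OF \<theta> mW] Wfin by (simp add: K_def fst_tw)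
  define P where "P = (\<integral>\<^sup>+x. ennreal (1 / (1 + (x::real)\<^sup>2)) \<partial>lborel)"
  have P: "P < \<infinity>" unfolding P_def by (rule nn_integral_inverse_one_plus_sq_finite)
  have mh: "(\<lambda>x. cmod (g (twist_map \<theta> (x, y)))) \<in> borel_measurable borel" for y
    using borel_measurable_compose_continuous[OF g cty[of y]] by measurable
  have Kfin: "AE y in lborel. K y \<noteq> \<infinity>"
    by (rule nn_integral_PInf_AE) (use KI in auto)
  have VK: "AE y in lborel. (V y)\<^sup>2 \<le> P * K y"
    using Kfin
  proof eventually_elim
    fix y assume "K y \<noteq> \<infinity>"
    then show "(V y)\<^sup>2 \<le> P * K y"
      unfolding V_def K_def P_def by (intro L1_sq_le_weighted_L2 mh) auto
  qed
  have Vfin: "AE y in lborel. V y \<noteq> \<infinity>"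
    using Kfin VK
  proof eventually_elim
    fix y assume "K y \<noteq> \<infinity>" "(V y)\<^sup>2 \<le> P * K y"
    moreover have "P * K y < \<infinity>" using P \<open>K y \<noteq> \<infinity>\<close> by (simp add: ennreal_mult_less_top less_top)
    ultimately have "(V y)\<^sup>2 < \<infinity>" by (meson le_less_trans)
    then show "V y \<noteq> \<infinity>" by (auto simp: power2_eq_square)
  qed
  have "(\<integral>\<^sup>+y. (V y)\<^sup>2 \<partial>lborel) \<le> (\<integral>\<^sup>+y. P * K y \<partial>lborel)"
    by (rule nn_integral_mono_AE[OF VK])
  also have "\<dots> = P * (\<integral>\<^sup>+y. K y \<partial>lborel)" by (simp add: nn_integral_cmult)
  also have "\<dots> < \<infinity>" using P KI by (simp add: ennreal_mult_less_top)
  finally have V2: "(\<integral>\<^sup>+y. (V y)\<^sup>2 \<partial>lborel) < \<infinity>" .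
  \<comment> \<open>The twist preserves volume, so almost every fibre meets this exceptional set in
    a null set of the line, and the two representatives agree almost everywhere along it.\<close>
  obtain Z where Z: "Z \<in> null_sets lborel" "{z. F z \<noteq> g z} \<subseteq> Z"
    using Fg by (auto simp: eventually_ae_filter)
  have Zm[measurable]: "Z \<in> sets borel" using Z(1) by auto
  have mZ: "(indicator Z :: _ \<Rightarrow> ennreal) \<in> borel_measurable borel" by simp
  have "(\<integral>\<^sup>+y. \<integral>\<^sup>+x. indicator Z (twist_map \<theta> (x, y)) \<partial>lborel \<partial>lborel) = 0"
    using nn_integral_twist_swap[OF \<theta> mZ] Z(1) by auto
  then have "AE y in lborel. (\<integral>\<^sup>+x. indicator Z (twist_map \<theta> (x, y)) \<partial>lborel) = 0"
    by (subst (asm) nn_integral_0_iff_AE) (use mm[OF mZ] in auto)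
  then have fibre_ae: "AE y in lborel. AE x in lborel. F (twist_map \<theta> (x, y)) = g (twist_map \<theta> (x, y))"
  proof eventually_elim
    fix y assume *: "(\<integral>\<^sup>+x. indicator Z (twist_map \<theta> (x, y)) \<partial>lborel) = 0"
    have "(\<lambda>x. indicator Z (twist_map \<theta> (x, y)) :: ennreal) \<in> borel_measurable lborel"
      using borel_measurable_compose_continuous[OF mZ cty[of y]] by simp
    from nn_integral_0_iff_AE[OF this] *
    have "AE x in lborel. (indicator Z (twist_map \<theta> (x, y)) :: ennreal) = 0" by simp
    then show "AE x in lborel. F (twist_map \<theta> (x, y)) = g (twist_map \<theta> (x, y))"
      by eventually_elim (use Z(2) in \<open>auto simp: indicator_def split: if_splits\<close>)
  qed
  define I where "I y = (\<integral>x1. cmod (\<Psi> (twist_map \<theta> (x1, y))) \<partial>lebesgue)" for y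
  \<comment> \<open>Along almost every fibre \<open>\<Psi>\<close> inherits measurability from
    \<open>g\<close>. Off \<open>\<omega>\<close> the indicator and \<open>V\<close> are both
    zero.\<close>
  have IV: "AE y in lborel. indicator \<omega> y *\<^sub>R (I y)\<^sup>2 = (enn2real (V y))\<^sup>2"
    using fibre_ae
  proof eventually_elim
    fix y assume ae_y: "AE x in lborel. F (twist_map \<theta> (x, y)) = g (twist_map \<theta> (x, y))"
    show "indicator \<omega> y *\<^sub>R (I y)\<^sup>2 = (enn2real (V y))\<^sup>2"
    proof (cases "y \<in> \<omega>")
      case True
      have inT: "twist_map \<theta> (x, y) \<in> T" for x using True by (simp add: T_def twist_map_in_tube_iff)
      have e: "AE x in lebesgue. cmod (g (twist_map \<theta> (x, y))) = cmod (\<Psi> (twist_map \<theta> (x, y)))"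
        using AE_completion[OF ae_y] by eventually_elim (use inT in \<open>auto simp: F_def\<close>)
      have mhl: "(\<lambda>x. cmod (g (twist_map \<theta> (x, y)))) \<in> borel_measurable lebesgue"
        using mh[of y] by (intro measurable_completion) simp
      have "I y = (\<integral>x. cmod (g (twist_map \<theta> (x, y))) \<partial>lebesgue)"
        unfolding I_def
        by (rule integral_cong_AE[OF borel_measurable_AE[OF mhl e] mhl]) (use e in \<open>auto elim: eventually_mono\<close>)
      also have "\<dots> = (\<integral>x. cmod (g (twist_map \<theta> (x, y))) \<partial>lborel)"
        using mh[of y] by (intro integral_completion) simp
      also have "\<dots> = enn2real (V y)"
        unfolding V_def by (rule integral_eq_nn_integral) (use mh[of y] in auto)
      finally show ?thesis using True by simp
    next
      case False
      then have "g (twist_map \<theta> (x, y)) = 0" for x by (intro gT) (simp add: T_def twist_map_in_tube_iff)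
      then show ?thesis using False by (simp add: V_def)
    qed
  qed
  have "(norm_one \<theta> \<omega> \<Psi>)\<^sup>2 = (\<integral>y. (I y)\<^sup>2 \<partial>lebesgue_on \<omega>)"
    unfolding norm_one_def I_def by simp
  also have "\<dots> = (\<integral>y. indicator \<omega> y *\<^sub>R (I y)\<^sup>2 \<partial>lebesgue)"
    using \<omega> by (intro integral_restrict_space) simp
  also have "\<dots> = (\<integral>y. (enn2real (V y))\<^sup>2 \<partial>lebesgue)"
  proof -
    have m: "(\<lambda>y. (enn2real (V y))\<^sup>2) \<in> borel_measurable lebesgue"
      by (intro measurable_completion) simp
    have e: "AE y in lebesgue. (enn2real (V y))\<^sup>2 = indicator \<omega> y *\<^sub>R (I y)\<^sup>2"
      using AE_completion[OF IV] by eventually_elim simp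
    show ?thesis
      by (rule integral_cong_AE[OF borel_measurable_AE[OF m e] m]) (use e in \<open>auto elim: eventually_mono\<close>)
  qed
  also have "\<dots> = (\<integral>y. (enn2real (V y))\<^sup>2 \<partial>lborel)" by (intro integral_completion) simp
  also have "\<dots> = enn2real (\<integral>\<^sup>+y. ennreal ((enn2real (V y))\<^sup>2) \<partial>lborel)"
    by (rule integral_eq_nn_integral) auto
  also have "(\<integral>\<^sup>+y. ennreal ((enn2real (V y))\<^sup>2) \<partial>lborel) = (\<integral>\<^sup>+y. (V y)\<^sup>2 \<partial>lborel)"
  proof (rule nn_integral_cong_AE)
    show "AE y in lborel. ennreal ((enn2real (V y))\<^sup>2) = (V y)\<^sup>2"
      using Vfin by eventually_elim (simp add: ennreal_power[symmetric] less_top)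
  qed
  finally have "ennreal ((norm_one \<theta> \<omega> \<Psi>)\<^sup>2) = (\<integral>\<^sup>+y. (V y)\<^sup>2 \<partial>lborel)"
    using V2 by simp
  then show ?thesis
    using that[of g] g gT ae by (simp add: V_def T_def)
qed

text \<open>The constant is fixed before the angle: it is made from \<open>\<Lambda>\<close>,
  \<open>R\<close>, \<open>M\<close> and \<open>a\<close>, which are determined by
  \<open>\<omega>\<close> and \<theta>'. One constant thus serves all primitives of
  \<theta>'.\<close>

theorem theorem3p2:
  fixes \<omega> :: "(real \<times> real) set" and \<theta>' :: "real \<Rightarrow> real"
  assumes "\<omega> \<noteq> {}" and "open \<omega>" and "connected \<omega>" and "bounded \<omega>"
    and "continuous_on UNIV \<theta>'"
    and "compact (closure {t. \<theta>' t \<noteq> 0})"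
  shows "\<exists>c>0. \<forall>\<theta> :: real \<Rightarrow> real. (\<forall>t. (\<theta> has_real_derivative \<theta>' t) (at t)) \<longrightarrow>
    (\<forall>\<Psi> \<in> H10 (tube \<theta> \<omega>) \<inter> L2_weighted (tube \<theta> \<omega>) (\<lambda>x. 1 / (rho x)\<^sup>2).
       \<not> L2_zero (tube \<theta> \<omega>) \<Psi> \<longrightarrow>
       (grad_norm (tube \<theta> \<omega>) \<Psi>)\<^sup>2
         - first_dirichlet_eigenvalue \<omega> * (L2_norm (tube \<theta> \<omega>) \<Psi>)\<^sup>2
       \<ge> c * ((L2_norm (tube \<theta> \<omega>) \<Psi>) ^ 6 / (norm_one \<theta> \<omega> \<Psi>) ^ 4))"
proof -
  define \<Lambda> where "\<Lambda> = rayleigh_inf \<omega>"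
  have E1: "first_dirichlet_eigenvalue \<omega> = \<Lambda>"
    unfolding \<Lambda>_def by (rule first_dirichlet_eigenvalue_eq[OF assms(2,1,4)])
  have \<Lambda>0: "\<Lambda> \<ge> 0" unfolding \<Lambda>_def by (rule rayleigh_inf_nonneg[OF assms(2,1)])
  obtain a0 where a0: "\<And>y. y \<in> \<omega> \<Longrightarrow> norm y \<le> a0" using assms(4) by (auto simp: bounded_iff)
  define a where "a = max a0 0"
  have a: "\<And>y. y \<in> \<omega> \<Longrightarrow> norm y \<le> a" "0 \<le> a" using a0 by (auto simp: a_def le_max_iff_disj)
  let ?X = "closure {t. \<theta>' t \<noteq> 0}"
  have off: "\<theta>' t = 0" if "t \<notin> ?X" for t using that closure_subset[of "{t. \<theta>' t \<noteq> 0}"] by blast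
  obtain B where B: "\<And>t. t \<in> ?X \<Longrightarrow> \<bar>t\<bar> \<le> B"
    using compact_imp_bounded[OF assms(6)] by (auto simp: bounded_iff)
  \<comment> \<open>The added 1 puts the closed end of \<open>outer R\<close> strictly beyond the
    support of \<theta>' and makes \<open>R\<close> positive.\<close>
  define R where "R = max B 0 + 1"
  have R: "R > 0" by (simp add: R_def)
  have zero: "\<theta>' x = 0" if "x \<in> outer R" for x
  proof (rule off)
    show "x \<notin> ?X" using B[of x] that by (auto simp: outer_def R_def)
  qed
  have "bounded (\<theta>' ` ?X)"
    using assms(5,6) continuous_on_subset by (intro compact_imp_bounded compact_continuous_image) auto
  then obtain M0 where M0: "\<And>t. t \<in> ?X \<Longrightarrow> \<bar>\<theta>' t\<bar> \<le> M0" by (auto simp: bounded_iff)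
  define M where "M = max M0 0"
  have M: "\<bar>\<theta>' t\<bar> \<le> M" for t
    using M0[of t] off[of t] by (cases "t \<in> ?X") (auto simp: M_def le_max_iff_disj)
  define \<mu> where "\<mu> = (M * a)\<^sup>2"
  have \<mu>0: "\<mu> \<ge> 0" by (simp add: \<mu>_def)
  obtain C where C: "C > 0" and est: "\<And>S A1 A2 A3 N \<delta> l. \<lbrakk>0 \<le> S; 0 \<le> A1; 0 \<le> A2; 0 \<le> A3; 0 \<le> N; 0 \<le> \<delta>; \<Lambda> * S \<le> A2 + A3;
     \<And>l. l > 0 \<Longrightarrow> S \<le> 4 * (N / l + \<delta> + l\<^sup>2 * (3 * (A1 + \<mu> * (A2 + A3))));
     \<And>l. l > 0 \<Longrightarrow> S \<le> (1 + 4 * R) * (4 * (N / l + \<delta> + l\<^sup>2 * A1)) + 4 * R * (2 * R + 1) * A1; l > 0\<rbrakk>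
     \<Longrightarrow> S \<le> C * (l\<^sup>2 * (A1 + A2 + A3 - \<Lambda> * S) + N / l + \<delta>)"
  proof (rule absorb_estimates[OF \<Lambda>0 \<mu>0 R])
    fix C assume "C > 0" "\<And>S A1 A2 A3 N \<delta> l. \<lbrakk>0 \<le> S; 0 \<le> A1; 0 \<le> A2; 0 \<le> A3; 0 \<le> N; 0 \<le> \<delta>; \<Lambda> * S \<le> A2 + A3;
     \<And>l. l > 0 \<Longrightarrow> S \<le> 4 * (N / l + \<delta> + l\<^sup>2 * (3 * (A1 + \<mu> * (A2 + A3))));
     \<And>l. l > 0 \<Longrightarrow> S \<le> (1 + 4 * R) * (4 * (N / l + \<delta> + l\<^sup>2 * A1)) + 4 * R * (2 * R + 1) * A1; l > 0\<rbrakk>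
     \<Longrightarrow> S \<le> C * (l\<^sup>2 * (A1 + A2 + A3 - \<Lambda> * S) + N / l + \<delta>)"
    then show thesis by (rule that)
  qed
  have c0: "1 / (8 * C ^ 3) > 0" using C by simp
  show ?thesis
  proof (intro exI[of _ "1 / (8 * C ^ 3)"] conjI c0 allI impI ballI)
    fix \<theta> :: "real \<Rightarrow> real" and \<Psi>
    assume d\<theta>: "\<forall>t. (\<theta> has_real_derivative \<theta>' t) (at t)"
      and \<Psi>: "\<Psi> \<in> H10 (tube \<theta> \<omega>) \<inter> L2_weighted (tube \<theta> \<omega>) (\<lambda>x. 1 / (rho x)\<^sup>2)"
      and nz: "\<not> L2_zero (tube \<theta> \<omega>) \<Psi>"
    have \<theta>: "(\<theta> has_real_derivative \<theta>' t) (at t)" for t using d\<theta> by blast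
    have c\<theta>: "continuous_on UNIV \<theta>"
      using \<theta> DERIV_isCont continuous_at_imp_continuous_on by blast
    define T where "T = tube \<theta> \<omega>"
    let ?L = "lebesgue_on T"
    have oT: "open T" unfolding T_def by (rule open_tube[OF c\<theta> assms(2)])
    have sT: "T \<in> sets lebesgue" using oT by simp
    have H: "\<Psi> \<in> H10 T" using \<Psi> by (simp add: T_def)
    have s\<Psi>: "sq_int ?L \<Psi>" by (rule H10_sq_int[OF H])
    have sw: "sq_int ?L (weak_partial T b \<Psi>)" if "b \<in> Basis" for b
      using has_weak_partial_sq_int(2)[OF H10_weak_partial[OF H that]] .
    obtain g where g: "g \<in> borel_measurable borel" and gT: "\<forall>z. z \<notin> T \<longrightarrow> g z = 0"
      and ae: "AE z in lborel. z \<in> T \<longrightarrow> \<Psi> z = g z"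
      and N: "(\<integral>\<^sup>+y. (\<integral>\<^sup>+x. ennreal (cmod (g (twist_map \<theta> (x, y)))) \<partial>lborel)\<^sup>2 \<partial>lborel) = ennreal ((norm_one \<theta> \<omega> \<Psi>)\<^sup>2)"
      by (rule norm_one_representative[OF c\<theta> assms(2) IntD2[OF \<Psi>], folded T_def]) (rule that)
    obtain \<phi> where \<phi>: "\<And>n. \<phi> n \<in> test_functions T" and l0: "(\<lambda>n. nrm ?L (\<lambda>x. \<phi> n x - \<Psi> x)) \<longlonglongrightarrow> 0"
      and l1': "\<forall>b\<in>Basis. (\<lambda>n. nrm ?L (\<lambda>x. partial_deriv b (\<phi> n) x - weak_partial T b \<Psi> x)) \<longlonglongrightarrow> 0"
      by (rule H10_approx_seq[OF oT H]) (rule that)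
    note l1 = bspec[OF l1']
    define N1 where "N1 = (norm_one \<theta> \<omega> \<Psi>)\<^sup>2"
    have N0: "0 \<le> N1" by (simp add: N1_def)
    define \<delta> where "\<delta> n = (nrm ?L (\<lambda>x. \<phi> n x - \<Psi> x))\<^sup>2" for n
    define S where "S n = (nrm lborel (\<phi> n))\<^sup>2" for n
    define A where "A b n = (nrm lborel (partial_deriv b (\<phi> n)))\<^sup>2" for b n
    have st: "sq_int ?L (\<phi> n)" for n using test_functions_sq_int[OF \<phi> sT] .
    have std: "sq_int ?L (partial_deriv b (\<phi> n))" if "b \<in> Basis" for b n
      using test_functions_sq_int[OF test_functions_partial_deriv[OF \<phi> that] sT] .
    \<comment> \<open>Both functions vanish outside the tube, so the squared distance in
      \<open>lborel\<close> to the Borel version is the one to \<open>\<Psi>\<close> in the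
      tube.\<close>
    have \<delta>I: "(\<integral>\<^sup>+z. ennreal ((cmod (\<phi> n z - g z))\<^sup>2) \<partial>lborel) = ennreal (\<delta> n)" for n
    proof -
      have m: "(\<lambda>z. ennreal ((cmod (\<phi> n z - g z))\<^sup>2)) \<in> borel_measurable lborel"
        using test_functions_measurable[OF \<phi>[of n]] g by measurable
      have "(\<integral>\<^sup>+z. ennreal ((cmod (\<phi> n z - g z))\<^sup>2) \<partial>lborel) = (\<integral>\<^sup>+z. ennreal ((cmod (\<phi> n z - g z))\<^sup>2) \<partial>lebesgue)"
        by (rule nn_integral_completion[symmetric])
      also have "\<dots> = (\<integral>\<^sup>+z. ennreal ((cmod (\<phi> n z - \<Psi> z))\<^sup>2) * indicator T z \<partial>lebesgue)"
      proof (rule nn_integral_cong_AE)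
        show "AE z in lebesgue. ennreal ((cmod (\<phi> n z - g z))\<^sup>2) = ennreal ((cmod (\<phi> n z - \<Psi> z))\<^sup>2) * indicator T z"
          using AE_completion[OF ae]
          by eventually_elim (use gT test_functions_outside[OF \<phi>[of n]] in \<open>auto simp: indicator_def\<close>)
      qed
      also have "\<dots> = (\<integral>\<^sup>+z. ennreal ((cmod (\<phi> n z - \<Psi> z))\<^sup>2) \<partial>?L)"
        using sT by (simp add: nn_integral_restrict_space)
      also have "\<dots> = ennreal (\<delta> n)"
        unfolding \<delta>_def by (rule nn_integral_sq_nrm[OF sq_int_diff[OF st s\<Psi>]])
      finally show ?thesis .
    qed
    have \<delta>0: "0 \<le> \<delta> n" for n by (simp add: \<delta>_def)
    have \<phi>': "\<phi> n \<in> test_functions (tube \<theta> \<omega>)" for n using \<phi>[of n] by (simp add: T_def)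
    have tr: "\<Lambda> * S n \<le> A d2 n + A d3 n" for n
      using tube_transversal_estimate[OF \<phi>'[of n] c\<theta>] \<Lambda>0 by (simp add: \<Lambda>_def S_def A_def)
    have main: "S n \<le> C * (l\<^sup>2 * (A d1 n + A d2 n + A d3 n - \<Lambda> * S n) + N1 / l + \<delta> n)" if l: "l > 0" for l n
    proof (rule est)
      show "S n \<le> 4 * (N1 / l + \<delta> n + l\<^sup>2 * (3 * (A d1 n + \<mu> * (A d2 n + A d3 n))))" if "l > 0" for l
        using tube_real_estimates(1)[OF \<theta> assms(5) \<phi>' g that R a M zero N[folded N1_def] N0 \<delta>I \<delta>0]
        by (simp add: S_def A_def \<mu>_def)
      show "S n \<le> (1 + 4 * R) * (4 * (N1 / l + \<delta> n + l\<^sup>2 * A d1 n)) + 4 * R * (2 * R + 1) * A d1 n" if "l > 0" for l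
        using tube_real_estimates(2)[OF \<theta> assms(5) \<phi>' g that R a M zero N[folded N1_def] N0 \<delta>I \<delta>0]
        by (simp add: S_def A_def)
    qed (use tr N0 \<delta>0 l in \<open>auto simp: S_def A_def\<close>)
    define s where "s = (nrm ?L \<Psi>)\<^sup>2"
    define w where "w b = (nrm ?L (weak_partial T b \<Psi>))\<^sup>2" for b
    have Sl: "S \<longlonglongrightarrow> s"
    proof -
      have "S = (\<lambda>n. (nrm ?L (\<phi> n))\<^sup>2)" using test_functions_nrm[OF \<phi> sT] by (simp add: S_def fun_eq_iff)
      moreover have "(\<lambda>n. (nrm ?L (\<phi> n))\<^sup>2) \<longlonglongrightarrow> s"
        unfolding s_def by (intro tendsto_power nrm_tendsto[OF st s\<Psi> l0])
      ultimately show ?thesis by simp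
    qed
    have Al: "A b \<longlonglongrightarrow> w b" if b: "b \<in> Basis" for b
    proof -
      have "A b = (\<lambda>n. (nrm ?L (partial_deriv b (\<phi> n)))\<^sup>2)"
        using test_functions_nrm[OF test_functions_partial_deriv[OF \<phi> b] sT] by (simp add: A_def fun_eq_iff)
      moreover have "(\<lambda>n. (nrm ?L (partial_deriv b (\<phi> n)))\<^sup>2) \<longlonglongrightarrow> w b"
        unfolding w_def by (intro tendsto_power nrm_tendsto[OF std[OF b] sw[OF b] l1[OF b]])
      ultimately show ?thesis by simp
    qed
    have bB: "d1 \<in> Basis" "d2 \<in> Basis" "d3 \<in> Basis" by (auto simp: Basis_real_triple)
    have \<delta>l: "\<delta> \<longlonglongrightarrow> 0"
      unfolding \<delta>_def[abs_def] using tendsto_power[OF l0, of 2] by simp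
    define Q where "Q = w d1 + w d2 + w d3 - \<Lambda> * s"
    \<comment> \<open>The limit is taken at fixed \<open>l\<close>. \<open>N1\<close> already
      belongs to \<open>\<Psi>\<close> and does not move; only \<open>\<delta> n\<close> is
      lost.\<close>
    have sQ: "s \<le> C * (l\<^sup>2 * Q + N1 / l)" if l: "l > 0" for l
    proof -
      have "(\<lambda>n. C * (l\<^sup>2 * (A d1 n + A d2 n + A d3 n - \<Lambda> * S n) + N1 / l + \<delta> n)) \<longlonglongrightarrow>
         C * (l\<^sup>2 * (w d1 + w d2 + w d3 - \<Lambda> * s) + N1 / l + 0)"
        by (intro tendsto_intros Al bB Sl \<delta>l)
      from LIMSEQ_le[OF Sl this] main[OF l] show ?thesis by (auto simp: Q_def)
    qed
    \<comment> \<open>The transversal estimate in the limit; it is needed for the degenerate case in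
      \<open>optimise_scale\<close>.\<close>
    have Q0: "Q \<ge> 0"
    proof -
      have "\<Lambda> * s \<le> w d2 + w d3"
        by (rule LIMSEQ_le[OF tendsto_mult[OF tendsto_const Sl] tendsto_add[OF Al[OF bB(2)] Al[OF bB(3)]]])
           (use tr in auto)
      moreover have "0 \<le> w d1" by (simp add: w_def)
      ultimately show ?thesis by (simp add: Q_def)
    qed
    have s0: "s > 0"
    proof -
      have "nrm ?L \<Psi> \<noteq> 0" using nrm_eq_0_iff[OF s\<Psi>] nz unfolding L2_zero_def T_def[symmetric] by simp
      then show ?thesis by (simp add: s_def)
    qed
    have "1 / (8 * C ^ 3) * (s ^ 3 / N1\<^sup>2) \<le> Q" by (rule optimise_scale[OF C s0 Q0 N0 sQ])
    moreover have "s = (L2_norm T \<Psi>)\<^sup>2" by (simp add: s_def L2_norm_eq_nrm)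
    moreover have "(grad_norm T \<Psi>)\<^sup>2 = w d1 + w d2 + w d3"
      by (simp add: grad_norm_def w_def L2_norm_eq_nrm sum_nonneg sum_Basis_real_triple)
    ultimately show "(grad_norm (tube \<theta> \<omega>) \<Psi>)\<^sup>2 - first_dirichlet_eigenvalue \<omega> * (L2_norm (tube \<theta> \<omega>) \<Psi>)\<^sup>2
       \<ge> 1 / (8 * C ^ 3) * ((L2_norm (tube \<theta> \<omega>) \<Psi>) ^ 6 / (norm_one \<theta> \<omega> \<Psi>) ^ 4)"
      unfolding E1 Q_def N1_def T_def by (simp add: power_mult[symmetric])
  qed
qed

end
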